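(* Let $l\ge 2$ and let $\{P_j(D)\}_{j=1}^N$, $P_j(D)=\sum_{|\alpha|\le l}a_{j\alpha}D^\alpha$, be a system of differential operators on $\mathbb R^n$ of order $l$ with constant (complex) coefficients satisfying the following conditions: (i) $n\ge 2N+1$; (ii) the restrictions of the polynomials $P_1^l(\xi),\dots,P_N^l(\xi)$ to an arbitrary two-dimensional subspace of $\mathbb R^n$ are linearly independent. Then the system $\{P_j(D)\}_1^N$ is weakly coercive in the isotropic Sobolev space $\overset{\circ}{W}{}^l_\infty(\mathbb R^n)$ if and only if it is elliptic.
   Context: Notation: $D_k=-i\,\partial/\partial x_k$, $D^\alpha=D_1^{\alpha_1}\cdots D_n^{\alpha_n}$, $P_j^l(\xi)=\sum_{|\alpha|=l}a_{j\alpha}\xi^\alpha$ (principal symbol). The system is elliptic if $(P_1^l(\xi),\dots,P_N^l(\xi))\ne0$ for all $\xi\in\mathbb R^n\setminus\{0\}$. The system is weakly coercive in $\overset{\circ}{W}{}^l_\infty(\mathbb R^n)$ if there are constants $C_1,C_2$ such that $\sum_{|\alpha|<l}\|D^\alpha f\|_{L^\infty(\mathbb R^n)}\le C_1\sum_{j=1}^N\|P_j(D)f\|_{L^\infty(\mathbb R^n)}+C_2\|f\|_{L^\infty(\mathbb R^n)}$ for all $f\in C_0^\infty(\mathbb R^n)$. *)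

theory Defs
  imports "HOL-Analysis.Analysis" "HOL-Probability.Essential_Supremum"
begin

section \<open>Partial derivatives and test functions\<close>

definition partial_deriv :: "'n::finite \<Rightarrow> (real^'n \<Rightarrow> complex) \<Rightarrow> real^'n \<Rightarrow> complex" where
  "partial_deriv k f x = vector_derivative (\<lambda>t. f (x + t *\<^sub>R axis k 1)) (at 0)"

definition has_partial_derivs :: "(real^'n::finite \<Rightarrow> complex) \<Rightarrow> bool" where
  "has_partial_derivs f \<longleftrightarrow>
     (\<forall>k x. (\<lambda>t. f (x + t *\<^sub>R axis k 1)) differentiable (at (0::real)))"

text \<open>The list \<open>ks\<close> gives the variables of an iterated partial derivative, in any order and
  with repetitions; the empty list gives \<open>f\<close> itself.\<close>

definition smooth :: "(real^'n::finite \<Rightarrow> complex) \<Rightarrow> bool" where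
  "smooth f \<longleftrightarrow>
     (\<forall>ks. continuous_on UNIV (foldr partial_deriv ks f) \<and>
           has_partial_derivs (foldr partial_deriv ks f))"

definition test_functions :: "(real^'n::finite \<Rightarrow> complex) set" where
  "test_functions = {f. smooth f \<and> compact (closure {x. f x \<noteq> 0})}"

section \<open>Multi-indices and differential operators\<close>

type_synonym 'n multi_index = "'n \<Rightarrow> nat"

definition mi_size :: "'n::finite multi_index \<Rightarrow> nat" where
  "mi_size \<alpha> = (\<Sum>k\<in>UNIV. \<alpha> k)"

text \<open>The sums over multi-indices below are therefore genuine finite sums.\<close>

lemma finite_mi_size_le: "finite {\<alpha> :: 'n::finite multi_index. mi_size \<alpha> \<le> l}"
proof (rule finite_subset)
  have "\<alpha> k \<le> mi_size \<alpha>" for \<alpha> :: "'n multi_index" and k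
    unfolding mi_size_def by (rule member_le_sum) auto
  then show "{\<alpha> :: 'n multi_index. mi_size \<alpha> \<le> l} \<subseteq> Pi\<^sub>E UNIV (\<lambda>_. {..l})"
    by (auto simp: PiE_UNIV_domain intro: order_trans)
  show "finite (Pi\<^sub>E (UNIV :: 'n set) (\<lambda>_. {..l}))"
    by (rule finite_PiE) auto
qed

definition mi_power :: "real^'n::finite \<Rightarrow> 'n multi_index \<Rightarrow> real" where
  "mi_power \<xi> \<alpha> = (\<Prod>k\<in>UNIV. (\<xi> $ k) ^ \<alpha> k)"

definition D1 :: "'n::finite \<Rightarrow> (real^'n \<Rightarrow> complex) \<Rightarrow> real^'n \<Rightarrow> complex" where
  "D1 k f x = - \<i> * partial_deriv k f x"

text \<open>The index type \<open>'n\<close> carries no order, so one enumeration of the coordinates is fixed.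
  Which one is immaterial, since the operators \<open>D1 k\<close> commute on smooth functions.\<close>

definition coords :: "'n::finite list" where
  "coords = (SOME ks. distinct ks \<and> set ks = UNIV)"

definition D :: "'n::finite multi_index \<Rightarrow> (real^'n \<Rightarrow> complex) \<Rightarrow> real^'n \<Rightarrow> complex" where
  "D \<alpha> f = foldr (\<lambda>k. D1 k ^^ \<alpha> k) coords f"

text \<open>A polynomial of degree at most \<open>l\<close> is given by its coefficients \<open>p \<alpha>\<close> with
  \<open>mi_size \<alpha> \<le> l\<close>; values of \<open>p\<close> at other multi-indices are never used.\<close>

definition diff_op ::
  "nat \<Rightarrow> ('n::finite multi_index \<Rightarrow> complex) \<Rightarrow> (real^'n \<Rightarrow> complex) \<Rightarrow> real^'n \<Rightarrow> complex" where
  "diff_op l p f x = (\<Sum>\<alpha> | mi_size \<alpha> \<le> l. p \<alpha> * D \<alpha> f x)"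

definition principal_symbol ::
  "nat \<Rightarrow> ('n::finite multi_index \<Rightarrow> complex) \<Rightarrow> real^'n \<Rightarrow> complex" where
  "principal_symbol l p \<xi> = (\<Sum>\<alpha> | mi_size \<alpha> = l. p \<alpha> * of_real (mi_power \<xi> \<alpha>))"

section \<open>Ellipticity, weak coercivity, linear independence\<close>

text \<open>A system of \<open>N\<close> operators is a coefficient family \<open>a j\<close>, \<open>1 \<le> j \<le> N\<close>.\<close>

definition elliptic :: "nat \<Rightarrow> nat \<Rightarrow> (nat \<Rightarrow> 'n::finite multi_index \<Rightarrow> complex) \<Rightarrow> bool" where
  "elliptic l N a \<longleftrightarrow> (\<forall>\<xi>. \<xi> \<noteq> 0 \<longrightarrow> (\<exists>j\<in>{1..N}. principal_symbol l (a j) \<xi> \<noteq> 0))"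

text \<open>The norm is extended-real-valued, so that no finiteness convention is involved; it is
  finite in every use below, all functions there being continuous with compact support.\<close>

definition Linf_norm :: "(real^'n::finite \<Rightarrow> complex) \<Rightarrow> ereal" where
  "Linf_norm f = esssup lborel (\<lambda>x. ereal (norm (f x)))"

definition weakly_coercive_Linf ::
  "nat \<Rightarrow> nat \<Rightarrow> (nat \<Rightarrow> 'n::finite multi_index \<Rightarrow> complex) \<Rightarrow> bool" where
  "weakly_coercive_Linf l N a \<longleftrightarrow>
     (\<exists>C1 C2 :: real. \<forall>f\<in>test_functions.
        (\<Sum>\<alpha> | mi_size \<alpha> < l. Linf_norm (D \<alpha> f))
          \<le> ereal C1 * (\<Sum>j=1..N. Linf_norm (diff_op l (a j) f)) + ereal C2 * Linf_norm f)"

text \<open>Linear independence over the complex numbers of the family of restrictions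
  \<open>g 1, \<dots>, g N\<close> to \<open>V\<close>. It is stated for the family, not for its set of members, so repeated
  members make it dependent.\<close>

definition lin_indep_on :: "'v set \<Rightarrow> nat \<Rightarrow> (nat \<Rightarrow> 'v \<Rightarrow> complex) \<Rightarrow> bool" where
  "lin_indep_on V N g \<longleftrightarrow>
     (\<forall>c :: nat \<Rightarrow> complex. (\<forall>\<xi>\<in>V. (\<Sum>j=1..N. c j * g j \<xi>) = 0) \<longrightarrow> (\<forall>j\<in>{1..N}. c j = 0))"

end

theory Submission
  imports Defs "HOL-Probability.Sinc_Integral"
begin

text \<open>Sufficiency. Let \<open>q = \<Sum>\<^sub>j |P\<^sub>j\<^sup>l|\<^sup>2\<close>, which is positive away from \<open>0\<close> for an elliptic system. Splitting
  \<open>1 = exp (- q(\<tau>\<xi>)) + (1 - exp (- q(\<tau>\<xi>)))\<close> on the Fourier side expresses \<open>D\<^sup>\<alpha>f\<close> through \<open>f\<close> and the \<open>P\<^sub>j\<^sup>l(D)f\<close> by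
  convolution with \<open>L\<^sup>1\<close> kernels, all of them dilates of Fourier transforms of functions \<open>polynomial \<cdot> exp (- q)\<close>. For
  \<open>|\<alpha>| < l\<close> the coefficient of \<open>P\<^sub>j\<^sup>l(D)f\<close> is \<open>O(\<tau>)\<close>, so that for small \<open>\<tau>\<close> the lower order terms are absorbed. Only
  inversion up to a nonzero constant is needed, since \<open>f\<close> is the limit of its dilated averages.

  Necessity. Let \<open>\<xi>\<^sub>0 \<noteq> 0\<close> be a common zero of the \<open>P\<^sub>j\<^sup>l\<close>. Along the ray through \<open>\<xi>\<^sub>0\<close> the full symbols satisfy
  \<open>P\<^sub>j(r\<xi>\<^sub>0 + \<zeta>) = r\<^sup>l\<^sup>-\<^sup>1 (v\<^sub>j \<cdot> \<zeta> + b\<^sub>j) + O(r\<^sup>l\<^sup>-\<^sup>2)\<close>. If \<open>v\<^sub>j \<cdot> \<eta> + b\<^sub>j = 0\<close> for some real \<open>\<eta>\<close> and all \<open>j\<close>, then the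
  exponentials with frequency \<open>r\<xi>\<^sub>0 + \<eta>\<close> violate the coercivity estimate. Otherwise the \<open>2N\<close> real forms \<open>Re v\<^sub>j\<close>,
  \<open>Im v\<^sub>j\<close> are dependent, and since \<open>n \<ge> 2N + 1\<close> all of them vanish on some plane containing \<open>\<xi>\<^sub>0\<close>. On that plane
  the \<open>P\<^sub>j\<^sup>l\<close> are linearly independent, so that frequencies \<open>\<xi>\<close> in it can be found with \<open>\<Sum> d(\<xi>) P\<^sub>j\<^sup>l(\<xi>) = b\<^sub>j\<close>. This
  allows one to correct localized oscillations near \<open>r\<xi>\<^sub>0\<close> so that their images under the \<open>P\<^sub>j(D)\<close> vanish at one point,
  and superposing many lacunary scales violates the estimate.\<close>

section \<open>Smooth functions\<close>

text \<open>In the necessity part one scale never suffices. Unless the affine forms of the expansion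
  have a common zero, an exponential of frequency about \<open>r \<xi>\<^sub>0\<close>, normalized
  so that its derivative of order \<open>l - 1\<close> has size 1, has images that are merely
  bounded, not small, because of the constants \<open>b j\<close>. The contradiction has to come
  from many scales whose images do not accumulate anywhere, and localization must cost nothing: it
  is done by averaging over the frequency shifts \<open>p \<xi>\<^sub>0 + q \<eta>\<close>, along
  which all linear parts vanish, so that the leading part of each image is unaffected. With integer
  coefficients everything becomes a function of the two angles
  \<open>\<xi>\<^sub>0 \<bullet> x\<close> and \<open>\<eta> \<bullet> x\<close> modulo 2 pi, and
  the averages become products of Dirichlet kernels. To work with such sums directly, the estimate
  is first extended from test functions to finite sums of exponentials. In the sufficiency part
  \<open>exp (- q)\<close> is a convenient cut-off because \<open>q\<close> is a homogeneous
  polynomial: its products with polynomials are closed under differentiation, and dilations act on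
  it explicitly.\<close>

definition has_pd :: "'n::finite \<Rightarrow> (real^'n \<Rightarrow> complex) \<Rightarrow> (real^'n \<Rightarrow> complex) \<Rightarrow> bool" where
  "has_pd k f f' \<longleftrightarrow> (\<forall>x. ((\<lambda>t. f (x + t *\<^sub>R axis k 1)) has_vector_derivative f' x) (at 0))"

lemma has_pd_partial_deriv: "has_pd k f f' \<Longrightarrow> partial_deriv k f = f'"
  by (auto simp: has_pd_def partial_deriv_def fun_eq_iff intro: vector_derivative_at)

text \<open>The definition differentiates at parameter 0 only. Moving the base point along the line
  gives the derivative at every parameter, as the fundamental theorem of calculus requires.\<close>

lemma has_pd_line:
  assumes "has_pd k f f'"
  shows "((\<lambda>t. f (x + t *\<^sub>R axis k 1)) has_vector_derivative f' (x + t *\<^sub>R axis k 1)) (at t)"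
proof -
  have *: "((\<lambda>s. f ((x + t *\<^sub>R axis k 1) + s *\<^sub>R axis k 1)) has_vector_derivative f' (x + t *\<^sub>R axis k 1)) (at 0)"
    using assms unfolding has_pd_def by blast
  have "((\<lambda>s. s - t) has_vector_derivative 1) (at t)"
    by (auto intro!: derivative_eq_intros)
  from vector_diff_chain_at[OF this, of "\<lambda>s. f ((x + t *\<^sub>R axis k 1) + s *\<^sub>R axis k 1)" "f' (x + t *\<^sub>R axis k 1)"] *
  have "((\<lambda>s. f ((x + t *\<^sub>R axis k 1) + s *\<^sub>R axis k 1)) \<circ> (\<lambda>s. s - t) has_vector_derivative f' (x + t *\<^sub>R axis k 1)) (at t)"
    by simp
  moreover have "(\<lambda>s. f ((x + t *\<^sub>R axis k 1) + s *\<^sub>R axis k 1)) \<circ> (\<lambda>s. s - t) = (\<lambda>t. f (x + t *\<^sub>R axis k 1))"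
    by (auto simp: fun_eq_iff algebra_simps)
  ultimately show ?thesis by simp
qed

lemma has_pd_const: "has_pd k (\<lambda>x. c) (\<lambda>x. 0)"
  by (simp add: has_pd_def)

lemma has_pd_coord: "has_pd k (\<lambda>x. of_real (x $ j)) (\<lambda>x. if j = k then 1 else 0)"
  unfolding has_pd_def has_vector_derivative_complex_iff
  by (auto simp: axis_def intro!: derivative_eq_intros)

lemma has_pd_add:
  "has_pd k f f' \<Longrightarrow> has_pd k g g' \<Longrightarrow> has_pd k (\<lambda>x. f x + g x) (\<lambda>x. f' x + g' x)"
  unfolding has_pd_def by (auto intro!: has_vector_derivative_add)

lemma has_pd_mult:
  assumes "has_pd k f f'" "has_pd k g g'"
  shows "has_pd k (\<lambda>x. f x * g x) (\<lambda>x. f x * g' x + f' x * g x)"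
  unfolding has_pd_def
proof
  fix x
  show "((\<lambda>t. f (x + t *\<^sub>R axis k 1) * g (x + t *\<^sub>R axis k 1)) has_vector_derivative f x * g' x + f' x * g x) (at 0)"
    using has_vector_derivative_mult[OF assms(1)[unfolded has_pd_def, rule_format, of x] 
       assms(2)[unfolded has_pd_def, rule_format, of x]] by simp
qed

lemma has_pd_exp:
  assumes "has_pd k f f'"
  shows "has_pd k (\<lambda>x. exp (f x)) (\<lambda>x. f' x * exp (f x))"
  unfolding has_pd_def
proof
  fix x
  have "(exp has_field_derivative exp (f x)) (at (f (x + 0 *\<^sub>R axis k 1)))"
    by (auto intro!: derivative_eq_intros)
  from field_vector_diff_chain_at[OF assms[unfolded has_pd_def, rule_format, of x] this]
  show "((\<lambda>t. exp (f (x + t *\<^sub>R axis k 1))) has_vector_derivative f' x * exp (f x)) (at 0)"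
    by (simp add: o_def)
qed

text \<open>Smoothness is a greatest fixed point: a class of continuous functions that contains the
  partial derivatives of its members is never left by iteration. In each application
  \<open>S\<close> is chosen so that one differentiation visibly stays inside.\<close>

lemma smooth_coinduct:
  assumes "f \<in> S"
    and "\<And>f. f \<in> S \<Longrightarrow> continuous_on UNIV f"
    and "\<And>f k. f \<in> S \<Longrightarrow> \<exists>f'\<in>S. has_pd k f f'"
  shows "smooth f"
proof -
  have pd: "partial_deriv k g \<in> S" if "g \<in> S" for g k
    using assms(3)[OF that, of k] has_pd_partial_deriv by blast
  have "foldr partial_deriv ks f \<in> S" for ks
    by (induction ks) (auto simp: assms(1) pd)
  moreover have "has_partial_derivs g" if "g \<in> S" for g
    unfolding has_partial_derivs_def
    using assms(3)[OF that] unfolding has_pd_def by (meson differentiableI_vector)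
  ultimately show ?thesis unfolding smooth_def using assms(2) by blast
qed

lemma smooth_continuous: "smooth f \<Longrightarrow> continuous_on UNIV f"
  unfolding smooth_def by (metis foldr.simps(1) id_apply)

lemma smooth_has_pd: "smooth f \<Longrightarrow> has_pd k f (partial_deriv k f)"
  unfolding smooth_def has_pd_def partial_deriv_def has_partial_derivs_def
  by (metis foldr.simps(1) id_apply vector_derivative_works)

lemma smooth_partial_deriv: "smooth f \<Longrightarrow> smooth (partial_deriv k f)"
  unfolding smooth_def
proof
  fix ks
  assume "\<forall>ks. continuous_on UNIV (foldr partial_deriv ks f) \<and> has_partial_derivs (foldr partial_deriv ks f)"
  \<comment> \<open>\<open>foldr\<close> applies the last variable of the list first, so the inner
    derivative is appended at the end.\<close>
  from this[rule_format, of "ks @ [k]"]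
  show "continuous_on UNIV (foldr partial_deriv ks (partial_deriv k f)) \<and>
      has_partial_derivs (foldr partial_deriv ks (partial_deriv k f))" by simp
qed

section \<open>Algebras of functions generated by a set, and closure properties of smooth
  functions\<close>

inductive_set fun_alg :: "('a \<Rightarrow> complex) set \<Rightarrow> ('a \<Rightarrow> complex) set" for B where
  fun_alg_base: "f \<in> B \<Longrightarrow> f \<in> fun_alg B"
| fun_alg_const: "(\<lambda>x. c) \<in> fun_alg B"
| fun_alg_add: "f \<in> fun_alg B \<Longrightarrow> g \<in> fun_alg B \<Longrightarrow> (\<lambda>x. f x + g x) \<in> fun_alg B"
| fun_alg_mult: "f \<in> fun_alg B \<Longrightarrow> g \<in> fun_alg B \<Longrightarrow> (\<lambda>x. f x * g x) \<in> fun_alg B"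

lemma fun_alg_sum:
  "(\<And>i. i \<in> I \<Longrightarrow> f i \<in> fun_alg B) \<Longrightarrow> (\<lambda>x. \<Sum>i\<in>I. f i x) \<in> fun_alg B"
  by (induction I rule: infinite_finite_induct) (auto intro: fun_alg_const fun_alg_add)

lemma fun_alg_prod:
  "(\<And>i. i \<in> I \<Longrightarrow> f i \<in> fun_alg B) \<Longrightarrow> (\<lambda>x. \<Prod>i\<in>I. f i x) \<in> fun_alg B"
  by (induction I rule: infinite_finite_induct) (auto intro: fun_alg_const fun_alg_mult)

lemma fun_alg_power: "f \<in> fun_alg B \<Longrightarrow> (\<lambda>x. f x ^ m) \<in> fun_alg B"
  by (induction m) (auto intro: fun_alg_const fun_alg_mult)

lemma fun_alg_cmult: "f \<in> fun_alg B \<Longrightarrow> (\<lambda>x. c * f x) \<in> fun_alg B"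
  by (rule fun_alg_mult[OF fun_alg_const])

lemma fun_alg_has_pd:
  assumes "\<And>f. f \<in> B \<Longrightarrow> \<exists>f'\<in>fun_alg B. has_pd k f f'" and "f \<in> fun_alg B"
  shows "\<exists>f'\<in>fun_alg B. has_pd k f f'"
  using assms(2)
proof induction
  case (fun_alg_base f)
  then show ?case using assms(1) by blast
next
  case (fun_alg_const c)
  show ?case by (intro bexI[where x = "\<lambda>x. 0"] has_pd_const fun_alg.fun_alg_const)
next
  case (fun_alg_add f g)
  then obtain f' g' where "f' \<in> fun_alg B" "g' \<in> fun_alg B" "has_pd k f f'" "has_pd k g g'" by blast
  then show ?case by (intro bexI[where x = "\<lambda>x. f' x + g' x"] has_pd_add fun_alg.fun_alg_add)
next
  case (fun_alg_mult f g)
  then obtain f' g' where "f' \<in> fun_alg B" "g' \<in> fun_alg B" "has_pd k f f'" "has_pd k g g'" by blast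
  then show ?case
    using fun_alg_mult.hyps
    by (intro bexI[where x = "\<lambda>x. f x * g' x + f' x * g x"] has_pd_mult
        fun_alg.fun_alg_add fun_alg.fun_alg_mult)
qed

lemma fun_alg_continuous:
  assumes "\<And>f. f \<in> B \<Longrightarrow> continuous_on UNIV f" and "f \<in> fun_alg B"
  shows "continuous_on UNIV f"
  using assms(2)
  by induction (auto intro: assms(1) continuous_on_const continuous_on_add continuous_on_mult)

lemma fun_alg_smooth:
  assumes "f \<in> fun_alg B"
    and "\<And>f. f \<in> B \<Longrightarrow> continuous_on UNIV f"
    and "\<And>f k. f \<in> B \<Longrightarrow> \<exists>f'\<in>fun_alg B. has_pd k f f'"
  shows "smooth f"
proof (rule smooth_coinduct[where S = "fun_alg B"])
  show "f \<in> fun_alg B" by fact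
  show "continuous_on UNIV g" if "g \<in> fun_alg B" for g
    by (rule fun_alg_continuous[OF assms(2) that])
  show "\<exists>f'\<in>fun_alg B. has_pd k g f'" if "g \<in> fun_alg B" for g k
    by (rule fun_alg_has_pd[OF assms(3) that])
qed

text \<open>The first derivative of a sum or product of smooth functions lies again in the algebra
  that they generate. Hence sums and products need no Leibniz formula for iterated
  derivatives.\<close>

lemma fun_alg_smooth_iff: "f \<in> fun_alg (Collect smooth) \<longleftrightarrow> smooth f"
proof
  assume "f \<in> fun_alg (Collect smooth)"
  then show "smooth f"
  proof (rule fun_alg_smooth)
    fix g :: "real^'a \<Rightarrow> complex" and k
    assume "g \<in> Collect smooth"
    then have g: "smooth g" by simp
    then show "continuous_on UNIV g" by (rule smooth_continuous)
    show "\<exists>f'\<in>fun_alg (Collect smooth). has_pd k g f'"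
      using smooth_has_pd[OF g, of k] smooth_partial_deriv[OF g, of k]
      by (intro bexI[of _ "partial_deriv k g"]) (auto intro: fun_alg_base)
  qed
qed (simp add: fun_alg_base)

lemma smooth_const: "smooth (\<lambda>x. c)"
  by (rule fun_alg_smooth_iff[THEN iffD1, OF fun_alg_const])

lemma smooth_add: "smooth f \<Longrightarrow> smooth g \<Longrightarrow> smooth (\<lambda>x. f x + g x)"
  by (rule fun_alg_smooth_iff[THEN iffD1, OF fun_alg_add]) (auto simp: fun_alg_base)

lemma smooth_mult: "smooth f \<Longrightarrow> smooth g \<Longrightarrow> smooth (\<lambda>x. f x * g x)"
  by (rule fun_alg_smooth_iff[THEN iffD1, OF fun_alg_mult]) (auto simp: fun_alg_base)

lemma smooth_cmult: "smooth f \<Longrightarrow> smooth (\<lambda>x. c * f x)"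
  by (rule smooth_mult[OF smooth_const])

lemma smooth_sum: "(\<And>i. i \<in> I \<Longrightarrow> smooth (f i)) \<Longrightarrow> smooth (\<lambda>x. \<Sum>i\<in>I. f i x)"
  by (induction I rule: infinite_finite_induct) (auto intro: smooth_const smooth_add)

abbreviation coord_funs :: "(real^'n::finite \<Rightarrow> complex) set" where
  "coord_funs \<equiv> range (\<lambda>k x. of_real (x $ k))"

lemma coord_has_pd:
  fixes k :: "'n::finite"
  shows "f \<in> coord_funs \<Longrightarrow> \<exists>f'\<in>fun_alg B. has_pd k f f'"
proof -
  assume "f \<in> coord_funs"
  then obtain j where f: "f = (\<lambda>x. of_real (x $ j))" by blast
  show ?thesis
    unfolding f by (intro bexI[where x = "\<lambda>x. if j = k then 1 else 0"] has_pd_coord fun_alg_const)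
qed

lemma coord_continuous: "f \<in> coord_funs \<Longrightarrow> continuous_on UNIV f"
  by (auto intro!: continuous_intros)

lemma poly_fun_smooth: "f \<in> fun_alg coord_funs \<Longrightarrow> smooth f"
  by (rule fun_alg_smooth[OF _ coord_continuous coord_has_pd])

text \<open>Adjoin the exponential to the smooth functions: its derivative is a smooth multiple of
  itself, so the generated algebra is closed under differentiation.\<close>

lemma smooth_exp:
  assumes "smooth f" shows "smooth (\<lambda>x. exp (f x))"
proof (rule fun_alg_smooth[where B = "insert (\<lambda>x. exp (f x)) (Collect smooth)"])
  let ?B = "insert (\<lambda>x. exp (f x)) (Collect smooth)"
  show "(\<lambda>x. exp (f x)) \<in> fun_alg ?B" by (simp add: fun_alg_base)
  show "continuous_on UNIV g" if "g \<in> ?B" for g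
    using that assms smooth_continuous by (auto intro!: continuous_intros)
  show "\<exists>f'\<in>fun_alg ?B. has_pd k g f'" if "g \<in> ?B" for g k
  proof -
    have "(\<lambda>x. partial_deriv k f x * exp (f x)) \<in> fun_alg ?B"
      using smooth_partial_deriv[OF assms, of k]
      by (intro fun_alg_mult) (auto simp: fun_alg_base)
    moreover have "partial_deriv k g \<in> fun_alg ?B" if "smooth g" for g
      using smooth_partial_deriv[OF that, of k] by (simp add: fun_alg_base)
    ultimately show ?thesis
      using that has_pd_exp[OF smooth_has_pd[OF assms, of k]] smooth_has_pd[of g k]
      by (cases "smooth g") blast+
  qed
qed

lemma has_pd_scale:
  assumes "has_pd k f f'"
  shows "has_pd k (\<lambda>x. f (c *\<^sub>R x)) (\<lambda>x. of_real c * f' (c *\<^sub>R x))"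
  unfolding has_pd_def
proof
  fix x
  have *: "((\<lambda>t. f (c *\<^sub>R x + t *\<^sub>R axis k 1)) has_vector_derivative f' (c *\<^sub>R x)) (at (c * 0))"
    using assms unfolding has_pd_def by simp
  have "((\<lambda>t. c * t) has_vector_derivative c) (at 0)"
    by (auto intro!: derivative_eq_intros)
  from vector_diff_chain_at[OF this *]
  show "((\<lambda>t. f (c *\<^sub>R (x + t *\<^sub>R axis k 1))) has_vector_derivative of_real c * f' (c *\<^sub>R x)) (at 0)"
    by (simp add: o_def scaleR_add_right scaleR_conv_of_real[where 'a = complex])
qed

text \<open>The constant factor \<open>b\<close> in the class absorbs the factors \<open>c\<close>
  that the chain rule produces.\<close>

lemma smooth_scale:
  assumes "smooth f" shows "smooth (\<lambda>x. f (c *\<^sub>R x))"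
proof (rule smooth_coinduct[where S = "{(\<lambda>x. b * g (c *\<^sub>R x)) |b g. smooth g}"])
  show "(\<lambda>x. f (c *\<^sub>R x)) \<in> {(\<lambda>x. b * g (c *\<^sub>R x)) |b g. smooth g}"
    using assms by (auto intro!: exI[of _ 1])
  fix h assume "h \<in> {(\<lambda>x. b * g (c *\<^sub>R x)) |b g. smooth g}"
  then obtain b g where h: "h = (\<lambda>x. b * g (c *\<^sub>R x))" and g: "smooth g" by blast
  show "continuous_on UNIV h"
    unfolding h by (intro continuous_intros continuous_on_compose2[OF smooth_continuous[OF g]]) auto
  fix k
  have "has_pd k h (\<lambda>x. b * (of_real c * partial_deriv k g (c *\<^sub>R x)) + 0 * g (c *\<^sub>R x))"
    unfolding h by (rule has_pd_mult[OF has_pd_const has_pd_scale[OF smooth_has_pd[OF g]]])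
  then show "\<exists>f'\<in>{(\<lambda>x. b * g (c *\<^sub>R x)) |b g. smooth g}. has_pd k h f'"
    using smooth_partial_deriv[OF g, of k]
    by (intro bexI[of _ "\<lambda>x. (b * of_real c) * partial_deriv k g (c *\<^sub>R x)"]) (simp add: mult.assoc, blast)
qed

subsection \<open>Iterated derivatives\<close>

lemma D1_has_pd: "has_pd k f f' \<Longrightarrow> D1 k f = (\<lambda>x. - \<i> * f' x)"
  using has_pd_partial_deriv[of k f f'] by (simp add: D1_def fun_eq_iff)

lemma smooth_D1: "smooth f \<Longrightarrow> smooth (D1 k f)"
  unfolding D1_def by (intro smooth_cmult smooth_partial_deriv)

lemma D1_add: "smooth f \<Longrightarrow> smooth g \<Longrightarrow> D1 k (\<lambda>x. f x + g x) = (\<lambda>x. D1 k f x + D1 k g x)"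
  by (subst D1_has_pd[OF has_pd_add[OF smooth_has_pd smooth_has_pd]])
    (auto simp: D1_def algebra_simps)

lemma D1_mult:
  "smooth f \<Longrightarrow> smooth g \<Longrightarrow> D1 k (\<lambda>x. f x * g x) = (\<lambda>x. f x * D1 k g x + D1 k f x * g x)"
  by (subst D1_has_pd[OF has_pd_mult[OF smooth_has_pd smooth_has_pd]])
    (auto simp: D1_def algebra_simps)

lemma D1_const: "D1 k (\<lambda>x. c) = (\<lambda>x. 0)"
  by (subst D1_has_pd[OF has_pd_const]) simp

lemma D1_cmult: "smooth f \<Longrightarrow> D1 k (\<lambda>x. c * f x) = (\<lambda>x. c * D1 k f x)"
  by (subst D1_mult[OF smooth_const]) (auto simp: D1_const)

lemma D1_scale: "smooth f \<Longrightarrow> D1 k (\<lambda>x. f (c *\<^sub>R x)) = (\<lambda>x. of_real c * D1 k f (c *\<^sub>R x))"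
  by (subst D1_has_pd[OF has_pd_scale[OF smooth_has_pd]]) (auto simp: D1_def)

lemma coords_props: "distinct (coords :: 'n::finite list)" "set (coords :: 'n list) = UNIV"
proof -
  have "\<exists>ks :: 'n list. distinct ks \<and> set ks = UNIV"
    using finite_distinct_list[of "UNIV :: 'n set"] by auto
  then have "distinct (coords :: 'n list) \<and> set (coords :: 'n list) = UNIV"
    unfolding coords_def by (rule someI_ex)
  then show "distinct (coords :: 'n list)" "set (coords :: 'n list) = UNIV" by auto
qed

text \<open>Induction along the factors of \<open>D \<alpha>\<close>. The number \<open>c\<close>
  collects one coordinate of \<open>\<xi>\<close> for each \<open>D1 k\<close> and ends as a
  monomial, which suits statements that \<open>D \<alpha>\<close> acts as multiplication, exactly or
  up to errors. The family \<open>G\<close> allows properties that tie several functions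
  together.\<close>

lemma D_product_family:
  fixes \<alpha> :: "'n::finite multi_index" and P :: "complex \<Rightarrow> ('i \<Rightarrow> real^'n \<Rightarrow> complex) \<Rightarrow> bool"
  assumes "P 1 G" and "\<And>k c G. P c G \<Longrightarrow> P (of_real (\<xi> $ k) * c) (\<lambda>i. D1 k (G i))"
  shows "P (of_real (mi_power \<xi> \<alpha>)) (\<lambda>i. D \<alpha> (G i))"
proof -
  have pow: "P (of_real (\<xi> $ k) ^ m * c) (\<lambda>i. (D1 k ^^ m) (G i))" if "P c G" for k m c G
  proof (induction m)
    case (Suc m)
    from assms(2)[OF this, of k] show ?case by (simp add: mult.assoc)
  qed (simp add: that)
  have "P (\<Prod>k\<in>set ks. of_real (\<xi> $ k) ^ \<alpha> k) (\<lambda>i. foldr (\<lambda>k. D1 k ^^ \<alpha> k) ks (G i))" if "distinct ks" for ks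
    using that
  proof (induction ks)
    case (Cons k ks)
    then show ?case using pow[of "\<Prod>k\<in>set ks. of_real (\<xi> $ k) ^ \<alpha> k" _ k "\<alpha> k"] by simp
  qed (simp add: assms(1))
  from this[OF coords_props(1)] show ?thesis
    unfolding D_def coords_props(2) mi_power_def by (simp add: of_real_power)
qed

lemma D_induct:
  assumes "P f" and "\<And>k g. P g \<Longrightarrow> P (D1 k g)"
  shows "P (D \<alpha> f)"
  using D_product_family[where P = "\<lambda>c G. P (G ())" and G = "\<lambda>_. f" and \<alpha> = \<alpha>] assms by simp

lemma D_induct_family:
  assumes "P f G" and "\<And>k f G. P f G \<Longrightarrow> P (D1 k f) (\<lambda>i. D1 k (G i))"
  shows "P (D \<alpha> f) (\<lambda>i. D \<alpha> (G i))"
  \<comment> \<open>The index \<open>None\<close> carries the distinguished function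
    \<open>f\<close>, and \<open>Some i\<close> carries \<open>G i\<close>.\<close>
  using D_product_family[where P = "\<lambda>c H. P (H None) (\<lambda>i. H (Some i))" and G = "case_option f G" and \<alpha> = \<alpha>] assms
  by simp

lemma D1_sum_cmult:
  assumes "finite I" "\<And>i. i \<in> I \<Longrightarrow> smooth (f i)"
  shows "D1 k (\<lambda>x. \<Sum>i\<in>I. c i * f i x) = (\<lambda>x. \<Sum>i\<in>I. c i * D1 k (f i) x)"
  using assms
proof (induction I)
  case empty
  show ?case by (simp add: D1_const)
next
  case (insert i I)
  have "smooth (\<lambda>x. c i * f i x)" "smooth (\<lambda>x. \<Sum>i\<in>I. c i * f i x)"
    using insert.prems by (intro smooth_sum smooth_cmult; simp)+
  with insert show ?case by (simp add: D1_add D1_cmult)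
qed

lemma D_sum_cmult:
  assumes "finite I" "\<And>i. i \<in> I \<Longrightarrow> smooth (f i)"
  shows "D \<alpha> (\<lambda>x. \<Sum>i\<in>I. c i * f i x) = (\<lambda>x. \<Sum>i\<in>I. c i * D \<alpha> (f i) x)"
proof -
  have "D \<alpha> (\<lambda>x. \<Sum>i\<in>I. c i * f i x) = (\<lambda>x. \<Sum>i\<in>I. c i * D \<alpha> (f i) x) \<and> (\<forall>i\<in>I. smooth (D \<alpha> (f i)))"
  proof (rule D_induct_family[where P = "\<lambda>f G. f = (\<lambda>x. \<Sum>i\<in>I. c i * G i x) \<and> (\<forall>i\<in>I. smooth (G i))"])
    show "D1 k f = (\<lambda>x. \<Sum>i\<in>I. c i * D1 k (G i) x) \<and> (\<forall>i\<in>I. smooth (D1 k (G i)))"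
      if "f = (\<lambda>x. \<Sum>i\<in>I. c i * G i x) \<and> (\<forall>i\<in>I. smooth (G i))" for k f G
      using that D1_sum_cmult[OF assms(1), of G k c] by (simp add: smooth_D1)
  qed (simp add: assms(2))
  then show ?thesis by blast
qed

subsection \<open>Test functions\<close>

lemma test_functions_iff:
  "f \<in> test_functions \<longleftrightarrow> smooth f \<and> (\<exists>r. \<forall>x. norm x > r \<longrightarrow> f x = 0)"
proof
  assume "f \<in> test_functions"
  then have s: "smooth f" and "bounded (closure {x. f x \<noteq> 0})"
    by (auto simp: test_functions_def compact_imp_bounded)
  then have "bounded {x. f x \<noteq> 0}" using bounded_subset closure_subset by blast
  then obtain r where "\<forall>x\<in>{x. f x \<noteq> 0}. norm x \<le> r" by (auto simp: bounded_iff)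
  then show "smooth f \<and> (\<exists>r. \<forall>x. norm x > r \<longrightarrow> f x = 0)" using s by (intro conjI exI[of _ r]) (auto simp flip: not_less)
next
  assume "smooth f \<and> (\<exists>r. \<forall>x. norm x > r \<longrightarrow> f x = 0)"
  then obtain r where s: "smooth f" and "\<And>x. norm x > r \<Longrightarrow> f x = 0" by blast
  then have "bounded {x. f x \<noteq> 0}" unfolding bounded_iff by (intro exI[of _ r]) (auto simp flip: not_less)
  then have "compact (closure {x. f x \<noteq> 0})" by simp
  with s show "f \<in> test_functions" by (simp add: test_functions_def)
qed

lemma test_functions_smooth: "f \<in> test_functions \<Longrightarrow> smooth f"
  by (simp add: test_functions_def)

lemma partial_deriv_eq_0:
  assumes "has_pd k f f'" "\<And>x. norm x > r \<Longrightarrow> f x = 0" "norm x > r"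
  shows "f' x = 0"
proof -
  have "open {t. r < norm (x + t *\<^sub>R axis k 1)}"
    by (intro open_Collect_less continuous_intros)
  then have "eventually (\<lambda>t. r < norm (x + t *\<^sub>R axis k 1)) (nhds (0::real))"
    using assms(3) by (auto simp: eventually_nhds intro!: exI[of _ "{t. r < norm (x + t *\<^sub>R axis k 1)}"])
  then have ev: "eventually (\<lambda>t. f (x + t *\<^sub>R axis k 1) = 0) (nhds (0::real))"
    by eventually_elim (simp add: assms(2))
  have "((\<lambda>t. f (x + t *\<^sub>R axis k 1)) has_vector_derivative f' x) (at 0)"
    using assms(1) by (simp add: has_pd_def)
  then have "((\<lambda>t. 0) has_vector_derivative f' x) (at (0::real))"
    by (rule has_vector_derivative_transform_within_open[OF _ \<open>open {t. r < norm (x + t *\<^sub>R axis k 1)}\<close>])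
      (use assms in auto)
  moreover have "((\<lambda>t. 0::complex) has_vector_derivative 0) (at (0::real))" by simp
  ultimately show ?thesis by (rule vector_derivative_unique_at)
qed

lemma test_functions_partial_deriv:
  assumes "f \<in> test_functions" shows "partial_deriv k f \<in> test_functions"
proof -
  obtain r where r: "\<And>x. norm x > r \<Longrightarrow> f x = 0" and f: "smooth f"
    using assms unfolding test_functions_iff by auto
  have "partial_deriv k f x = 0" if "norm x > r" for x
    using partial_deriv_eq_0[OF smooth_has_pd[OF f] r that] .
  with smooth_partial_deriv[OF f] show ?thesis unfolding test_functions_iff by blast
qed

lemma test_functions_cmult: "f \<in> test_functions \<Longrightarrow> (\<lambda>x. c * f x) \<in> test_functions"
  unfolding test_functions_iff using smooth_cmult[of f c] by auto

lemma test_functions_mult: "smooth g \<Longrightarrow> f \<in> test_functions \<Longrightarrow> (\<lambda>x. g x * f x) \<in> test_functions"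
  unfolding test_functions_iff using smooth_mult[of g f] by auto

lemma test_functions_add:
  assumes "f \<in> test_functions" "g \<in> test_functions"
  shows "(\<lambda>x. f x + g x) \<in> test_functions"
proof -
  obtain r where r: "\<And>x. norm x > r \<Longrightarrow> f x = 0"
    using assms(1) unfolding test_functions_iff by auto
  obtain s where s: "\<And>x. norm x > s \<Longrightarrow> g x = 0"
    using assms(2) unfolding test_functions_iff by auto
  show ?thesis
    using assms unfolding test_functions_iff
    by (intro conjI smooth_add exI[of _ "max r s"]) (auto simp: r s)
qed

lemma test_functions_sum:
  assumes "\<And>i. i \<in> I \<Longrightarrow> f i \<in> test_functions"
  shows "(\<lambda>x. \<Sum>i\<in>I. f i x) \<in> test_functions"
proof -
  have "(\<lambda>x. 0) \<in> test_functions" by (auto simp: test_functions_iff smooth_const)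
  then show ?thesis
    using assms by (induction I rule: infinite_finite_induct) (auto intro!: test_functions_add)
qed

lemma test_functions_D1: "f \<in> test_functions \<Longrightarrow> D1 k f \<in> test_functions"
  unfolding D1_def by (intro test_functions_cmult test_functions_partial_deriv)

lemma test_functions_D: "f \<in> test_functions \<Longrightarrow> D \<alpha> f \<in> test_functions"
  by (rule D_induct) (auto intro: test_functions_D1)

lemma test_functions_diff_op: "f \<in> test_functions \<Longrightarrow> diff_op l p f \<in> test_functions"
  unfolding diff_op_def[abs_def] by (intro test_functions_sum test_functions_cmult test_functions_D)

lemma test_functions_scale:
  assumes "f \<in> test_functions" "c > 0"
  shows "(\<lambda>x. f (c *\<^sub>R x)) \<in> test_functions"
proof -
  obtain r where "\<And>x. norm x > r \<Longrightarrow> f x = 0" using assms by (auto simp: test_functions_iff)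
  then have "\<forall>x. norm x > r / c \<longrightarrow> f (c *\<^sub>R x) = 0"
    using assms(2) by (simp add: divide_less_eq mult.commute)
  then show ?thesis using assms unfolding test_functions_iff by (intro conjI smooth_scale exI[of _ "r / c"]) auto
qed

lemma test_functions_bounded:
  assumes "f \<in> test_functions"
  shows "\<exists>B\<ge>0. \<forall>x. norm (f x) \<le> B"
proof -
  obtain r where r: "\<And>x. norm x > r \<Longrightarrow> f x = 0" using assms by (auto simp: test_functions_iff)
  have "compact (f ` cball 0 r)"
    by (rule compact_continuous_image[OF continuous_on_subset[OF smooth_continuous[OF test_functions_smooth[OF assms]]]]) auto
  then have "bounded (f ` cball 0 r)" by (rule compact_imp_bounded)
  then obtain B where B: "\<And>y. y \<in> f ` cball 0 r \<Longrightarrow> norm y \<le> B"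
    unfolding bounded_iff by auto
  have "norm (f x) \<le> max B 0" for x
  proof (cases "norm x > r")
    case False
    then have "norm (f x) \<le> B" by (intro B) auto
    then show ?thesis by simp
  qed (simp add: r)
  then show ?thesis by (intro exI[of _ "max B 0"]) simp
qed

section \<open>Supremum norms\<close>

text \<open>An open null set is empty. This turns almost-everywhere statements about continuous
  functions into pointwise ones.\<close>

lemma AE_lborel_open_imp_all:
  fixes P :: "'a::euclidean_space \<Rightarrow> bool"
  assumes "AE x in lborel. P x" "open {x. \<not> P x}"
  shows "P x"
proof -
  have "{x. \<not> P x} \<in> sets lborel" using assms(2) by simp
  then have "emeasure lborel {x. \<not> P x} = 0"
    using assms(1) AE_iff_measurable[of "{x. \<not> P x}" lborel P] by simp
  then have "{x. \<not> P x} \<in> null_sets lborel" using assms(2) by auto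
  then have "negligible {x. \<not> P x}"
    by (simp add: negligible_iff_null_sets null_sets_completionI)
  then have "{x. \<not> P x} = {}" using open_not_negligible assms(2) by blast
  then show ?thesis by auto
qed

definition supnorm :: "('a \<Rightarrow> complex) \<Rightarrow> real" where
  "supnorm f = (SUP x. norm (f x))"

lemma supnorm_upper:
  assumes "\<And>x. norm (f x) \<le> B" shows "norm (f x) \<le> supnorm f"
  unfolding supnorm_def using assms by (intro cSUP_upper) (auto simp: bdd_above_def)

lemma supnorm_least: "(\<And>x. norm (f x) \<le> B) \<Longrightarrow> supnorm f \<le> B"
  unfolding supnorm_def by (intro cSUP_least) auto

lemma Linf_norm_eq_supnorm:
  assumes cont: "continuous_on UNIV f" and B: "\<And>x. norm (f x) \<le> B"
  shows "Linf_norm f = ereal (supnorm f)"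
proof (rule antisym)
  have "f \<in> borel_measurable borel" using cont by (rule borel_measurable_continuous_onI)
  then have meas: "(\<lambda>x. ereal (norm (f x))) \<in> borel_measurable lborel" by simp
  show "Linf_norm f \<le> ereal (supnorm f)"
    unfolding Linf_norm_def using supnorm_upper[of f, OF B] by (intro esssup_I[OF meas]) simp
  \<comment> \<open>The set where this fails is open by continuity, and null by the defining
    property of the essential supremum.\<close>
  have *: "ereal (norm (f x)) \<le> Linf_norm f" for x
  proof (rule AE_lborel_open_imp_all[where P = "\<lambda>x. ereal (norm (f x)) \<le> Linf_norm f"])
    show "AE x in lborel. ereal (norm (f x)) \<le> Linf_norm f"
      unfolding Linf_norm_def by (rule esssup_AE)
    have "continuous_on UNIV (\<lambda>x. ereal (norm (f x)))"
      using cont by (intro continuous_intros)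
    then have "open {x. Linf_norm f < ereal (norm (f x))}"
      by (rule open_Collect_less[OF continuous_on_const])
    then show "open {x. \<not> ereal (norm (f x)) \<le> Linf_norm f}" by (simp add: not_le)
  qed
  show "ereal (supnorm f) \<le> Linf_norm f"
  proof (cases "Linf_norm f")
    case (real r)
    then have "supnorm f \<le> r" using * by (intro supnorm_least) simp
    with real show ?thesis by simp
  next
    case MInf
    with *[of undefined] show ?thesis by simp
  qed simp
qed

lemma supnorm_nonneg:
  assumes "\<And>x. norm (f x) \<le> B" shows "0 \<le> supnorm f"
  by (rule order_trans[OF norm_ge_zero supnorm_upper[where x = undefined]]) (rule assms)

lemma test_supnorm:
  assumes "f \<in> test_functions"
  shows "Linf_norm f = ereal (supnorm f)" "norm (f x) \<le> supnorm f" "0 \<le> supnorm f"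
proof -
  obtain B where B: "\<And>x. norm (f x) \<le> B" using test_functions_bounded[OF assms] by auto
  show "Linf_norm f = ereal (supnorm f)"
    by (rule Linf_norm_eq_supnorm[OF smooth_continuous[OF test_functions_smooth[OF assms]] B])
  show "norm (f x) \<le> supnorm f" "0 \<le> supnorm f"
    by (rule supnorm_upper[OF B] supnorm_nonneg[OF B])+
qed

lemma finite_mi_size_less: "finite {\<alpha> :: 'n::finite multi_index. mi_size \<alpha> < l}"
  by (rule finite_subset[OF _ finite_mi_size_le[of l]]) auto

lemma finite_mi_size_eq: "finite {\<alpha> :: 'n::finite multi_index. mi_size \<alpha> = l}"
  by (rule finite_subset[OF _ finite_mi_size_le[of l]]) auto

lemma weakly_coercive_iff_supnorm:
  "weakly_coercive_Linf l N a \<longleftrightarrow>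
     (\<exists>C1 C2. \<forall>f\<in>test_functions. (\<Sum>\<alpha> | mi_size \<alpha> < l. supnorm (D \<alpha> f))
        \<le> C1 * (\<Sum>j=1..N. supnorm (diff_op l (a j) f)) + C2 * supnorm f)"
proof -
  have "(\<Sum>\<alpha> | mi_size \<alpha> < l. Linf_norm (D \<alpha> f))
          \<le> ereal C1 * (\<Sum>j=1..N. Linf_norm (diff_op l (a j) f)) + ereal C2 * Linf_norm f \<longleftrightarrow>
      (\<Sum>\<alpha> | mi_size \<alpha> < l. supnorm (D \<alpha> f))
        \<le> C1 * (\<Sum>j=1..N. supnorm (diff_op l (a j) f)) + C2 * supnorm f"
    if f: "f \<in> test_functions" for f and C1 C2 :: real
  proof -
    have "(\<Sum>\<alpha> | mi_size \<alpha> < l. Linf_norm (D \<alpha> f)) = ereal (\<Sum>\<alpha> | mi_size \<alpha> < l. supnorm (D \<alpha> f))"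
      by (simp add: test_supnorm(1)[OF test_functions_D[OF f]])
    moreover have "(\<Sum>j=1..N. Linf_norm (diff_op l (a j) f)) = ereal (\<Sum>j=1..N. supnorm (diff_op l (a j) f))"
      by (simp add: test_supnorm(1)[OF test_functions_diff_op[OF f]])
    ultimately show ?thesis by (simp add: test_supnorm(1)[OF f])
  qed
  then show ?thesis unfolding weakly_coercive_Linf_def by blast
qed

section \<open>A bump function\<close>

text \<open>The polynomial parameter makes the family closed under differentiation and under
  division by \<open>t\<close>, and every member tends to 0 at 0; that is all the smoothness at 0
  requires.\<close>

definition flat :: "real poly \<Rightarrow> real \<Rightarrow> real" where
  "flat p t = (if t \<le> 0 then 0 else poly p (1 / t) * exp (- (1 / t)))"

lemma poly_times_exp_tendsto_0:
  fixes p :: "real poly"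
  shows "((\<lambda>s. poly p s * exp (- s)) \<longlongrightarrow> 0) at_top"
proof -
  have "((\<lambda>s. \<Sum>i\<le>degree p. coeff p i * (s ^ i / exp s)) \<longlongrightarrow> (\<Sum>i\<le>degree p. coeff p i * 0)) at_top"
    by (intro tendsto_intros tendsto_power_div_exp_0)
  moreover have "(\<lambda>s. \<Sum>i\<le>degree p. coeff p i * (s ^ i / exp s)) = (\<lambda>s. poly p s * exp (- s))"
    by (simp add: poly_altdef sum_distrib_right exp_minus divide_inverse mult.assoc fun_eq_iff)
  ultimately show ?thesis by simp
qed

lemma flat_tendsto_0: "((flat p) \<longlongrightarrow> 0) (at 0)"
proof -
  have "((\<lambda>t. poly p (inverse t) * exp (- inverse t)) \<longlongrightarrow> 0) (at_right 0)"
    by (rule filterlim_compose[OF poly_times_exp_tendsto_0 filterlim_inverse_at_top_right])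
  then have "((flat p) \<longlongrightarrow> 0) (at_right 0)"
    by (rule Lim_transform_eventually)
      (auto simp: flat_def eventually_at_filter inverse_eq_divide)
  moreover have "((flat p) \<longlongrightarrow> 0) (at_left 0)"
    by (rule tendsto_eventually) (auto simp: flat_def eventually_at_filter)
  ultimately show ?thesis by (simp add: filterlim_at_split)
qed

lemma flat_div: "flat p t / t = flat ([:0, 1:] * p) t"
  by (simp add: flat_def)

text \<open>With \<open>q(s) = s\<^sup>2 (p(s) - p'(s))\<close> the derivative of \<open>p(1/t) exp(-1/t)\<close> is \<open>q(1/t) exp(-1/t)\<close>.\<close>

lemma flat_has_derivative:
  "(flat p has_real_derivative flat ([:0, 0, 1:] * (p - pderiv p)) t) (at t)"
proof (cases t "0 :: real" rule: linorder_cases)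
  case less
  have "(flat p has_real_derivative 0) (at t)"
    by (rule has_field_derivative_transform_within_open[where f = "\<lambda>_. 0" and S = "{..<0}"])
      (use less in \<open>auto simp: flat_def\<close>)
  with less show ?thesis by (simp add: flat_def)
next
  case equal
  have "((\<lambda>t. (flat p t - flat p 0) / (t - 0)) \<longlongrightarrow> 0) (at 0)"
    using flat_tendsto_0[of "[:0, 1:] * p"] by (simp add: flat_def[of p 0] flat_div del: mult_pCons_left)
  with equal show ?thesis by (simp add: has_field_derivative_iff flat_def[of _ 0])
next
  case greater
  have "((\<lambda>t. poly p (1 / t) * exp (- (1 / t))) has_real_derivative
      flat ([:0, 0, 1:] * (p - pderiv p)) t) (at t)"
    using greater
    by (auto intro!: derivative_eq_intros DERIV_chain2[OF poly_DERIV] simp: flat_def field_simps power2_eq_square)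
  then show ?thesis
    by (rule has_field_derivative_transform_within_open[where S = "{0<..}"])
      (use greater in \<open>auto simp: flat_def\<close>)
qed

text \<open>The classical bump \<open>exp (1 - 1 / (1 - |x|^2))\<close> on the unit ball, 0 outside.
  Derivatives of the functions \<open>F p\<close> are again such functions times coordinates, so the
  algebra generated by both is closed under differentiation.\<close>

lemma exists_bump:
  "\<exists>\<phi> :: real^'n::finite \<Rightarrow> real.
     (\<lambda>x. of_real (\<phi> x)) \<in> test_functions \<and> \<phi> 0 = 1 \<and> (\<forall>x. 0 \<le> \<phi> x \<and> \<phi> x \<le> 1)"
proof -
  define u :: "real^'n \<Rightarrow> real" where "u x = 1 - (\<Sum>k\<in>UNIV. (x $ k)\<^sup>2)" for x
  define F :: "real poly \<Rightarrow> real^'n \<Rightarrow> complex" where "F p x = of_real (flat p (u x))" for p x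
  let ?B = "range F \<union> coord_funs"
  have pd_F: "has_pd k (F p) (\<lambda>x. (- 2) * of_real (x $ k) * F ([:0, 0, 1:] * (p - pderiv p)) x)" for k p
    unfolding has_pd_def
  proof
    fix x
    have "((\<lambda>t. ((x + t *\<^sub>R axis k 1) $ j)\<^sup>2) has_real_derivative (if j = k then 2 * x $ k else 0)) (at 0)" for j
      by (auto intro!: derivative_eq_intros simp: axis_def)
    from DERIV_diff[OF DERIV_const[of 1] DERIV_sum[where S = UNIV and f = "\<lambda>t j. ((x + t *\<^sub>R axis k 1) $ j)\<^sup>2", OF this]]
    have "((\<lambda>t. u (x + t *\<^sub>R axis k 1)) has_real_derivative - 2 * (x $ k)) (at 0)"
      unfolding u_def by simp
    from DERIV_chain2[of "flat p" _ "\<lambda>t. u (x + t *\<^sub>R axis k 1)", OF _ this, of "flat ([:0, 0, 1:] * (p - pderiv p)) (u x)"]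
    have "((\<lambda>t. flat p (u (x + t *\<^sub>R axis k 1))) has_real_derivative
       flat ([:0, 0, 1:] * (p - pderiv p)) (u x) * (- 2 * (x $ k))) (at 0)"
      using flat_has_derivative by simp
    then show "((\<lambda>t. F p (x + t *\<^sub>R axis k 1)) has_vector_derivative
        - 2 * complex_of_real (x $ k) * F ([:0, 0, 1:] * (p - pderiv p)) x) (at 0)"
      unfolding F_def has_vector_derivative_complex_iff has_real_derivative_iff_has_vector_derivative[symmetric]
      by (auto simp: mult_ac)
  qed
  have smooth_F: "smooth (F p)" for p
  proof (rule fun_alg_smooth[where B = ?B])
    show "F p \<in> fun_alg ?B" by (simp add: fun_alg_base)
    show "continuous_on UNIV f" if "f \<in> ?B" for f
    proof -
      have u: "continuous_on UNIV u"
        unfolding u_def by (intro continuous_intros)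
      have "continuous_on UNIV (flat p)" for p
        using flat_has_derivative by (intro continuous_at_imp_continuous_on ballI DERIV_isCont)
      then have "continuous_on UNIV (\<lambda>x. flat p (u x))" for p
        by (rule continuous_on_compose2[OF _ u]) simp
      then have "continuous_on UNIV (F p)" for p
        unfolding F_def by (rule continuous_on_of_real)
      then show ?thesis using that coord_continuous[of f] by (elim UnE) auto
    qed
    show "\<exists>f'\<in>fun_alg ?B. has_pd k f f'" if f: "f \<in> ?B" for f k
    proof (cases "f \<in> coord_funs")
      case True
      then show ?thesis by (rule coord_has_pd)
    next
      case False
      with f obtain p where p: "f = F p" by auto
      have "(\<lambda>x. (- 2) * of_real (x $ k) * F ([:0, 0, 1:] * (p - pderiv p)) x) \<in> fun_alg ?B"
        by (intro fun_alg_mult fun_alg_const; rule fun_alg_base; simp)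
      with pd_F[of k p] show ?thesis unfolding p by (rule bexI)
    qed
  qed
  have norm_u: "u x = 1 - (norm x)\<^sup>2" for x
    unfolding u_def by (simp add: norm_vec_def L2_set_def sum_nonneg)
  have "F p \<in> test_functions" for p
    unfolding test_functions_iff
  proof (intro conjI exI[of _ 1] allI impI smooth_F)
    fix x :: "real^'n" assume "norm x > 1"
    then have "u x \<le> 0" by (simp add: norm_u)
    then show "F p x = 0" by (simp add: F_def flat_def)
  qed
  then have "(\<lambda>x. of_real (exp 1) * F 1 x) \<in> test_functions" by (rule test_functions_cmult)
  then have "(\<lambda>x. of_real (exp 1 * flat 1 (u x))) \<in> test_functions" by (simp add: F_def)
  then show ?thesis
  proof (intro exI conjI allI)
    show "exp 1 * flat 1 (u 0) = 1" by (simp add: norm_u flat_def mult_exp_exp)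
    show "0 \<le> exp 1 * flat 1 (u x)" for x by (simp add: flat_def)
    have "1 \<le> 1 / u x" if "0 < u x" for x using that by (simp add: norm_u)
    then show "exp 1 * flat 1 (u x) \<le> 1" for x by (simp add: flat_def mult_exp_exp not_le)
  qed
qed

section \<open>Fourier integrals\<close>

lemma lborel_integral_affine:
  fixes f :: "'a::euclidean_space \<Rightarrow> 'b::{banach, second_countable_topology}"
  assumes [measurable]: "f \<in> borel_measurable borel" and c: "c \<noteq> 0"
  shows "integrable lborel (\<lambda>x. f (t + c *\<^sub>R x)) \<longleftrightarrow> integrable lborel f"
    and "integral\<^sup>L lborel f = \<bar>c\<bar> ^ DIM('a) *\<^sub>R (\<integral>x. f (t + c *\<^sub>R x) \<partial>lborel)"
proof -
  let ?T = "\<lambda>x::'a. t + c *\<^sub>R x"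
  have L: "lborel = density (distr lborel borel ?T) (\<lambda>_. ennreal (\<bar>c\<bar> ^ DIM('a)))"
    using lborel_affine[OF c, of t] by simp
  have "integrable lborel f \<longleftrightarrow> integrable (distr lborel borel ?T) (\<lambda>x. (\<bar>c\<bar> ^ DIM('a)) *\<^sub>R f x)"
    by (subst L, subst integrable_density) auto
  also have "\<dots> \<longleftrightarrow> integrable lborel (\<lambda>x. (\<bar>c\<bar> ^ DIM('a)) *\<^sub>R f (?T x))"
    by (subst integrable_distr_eq) auto
  also have "\<dots> \<longleftrightarrow> integrable lborel (\<lambda>x. f (?T x))"
  proof
    assume "integrable lborel (\<lambda>x. \<bar>c\<bar> ^ DIM('a) *\<^sub>R f (?T x))"
    then have "integrable lborel (\<lambda>x. inverse (\<bar>c\<bar> ^ DIM('a)) *\<^sub>R (\<bar>c\<bar> ^ DIM('a) *\<^sub>R f (?T x)))"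
      by (rule integrable_scaleR_right)
    with c show "integrable lborel (\<lambda>x. f (?T x))" by simp
  qed simp
  finally show "integrable lborel (\<lambda>x. f (t + c *\<^sub>R x)) \<longleftrightarrow> integrable lborel f" ..
  have "integral\<^sup>L lborel f = (\<integral>x. (\<bar>c\<bar> ^ DIM('a)) *\<^sub>R f x \<partial>distr lborel borel ?T)"
    by (subst L, subst integral_density) auto
  also have "\<dots> = (\<integral>x. (\<bar>c\<bar> ^ DIM('a)) *\<^sub>R f (?T x) \<partial>lborel)"
    by (subst integral_distr) auto
  finally show "integral\<^sup>L lborel f = \<bar>c\<bar> ^ DIM('a) *\<^sub>R (\<integral>x. f (t + c *\<^sub>R x) \<partial>lborel)"
    by simp
qed

lemma lborel_integral_translate:
  fixes f :: "'a::euclidean_space \<Rightarrow> 'b::{banach, second_countable_topology}"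
  assumes "f \<in> borel_measurable borel"
  shows "integrable lborel (\<lambda>x. f (x + t)) \<longleftrightarrow> integrable lborel f"
    and "(\<integral>x. f (x + t) \<partial>lborel) = integral\<^sup>L lborel f"
  using lborel_integral_affine[OF assms, of 1 t] by (simp_all add: add.commute)

text \<open>Integrate \<open>F (x + e) - F x\<close>, which is the integral of \<open>F'\<close>
  over a unit segment, over all \<open>x\<close>. The left side gives 0 by translation invariance;
  the right side gives the integral of \<open>F'\<close> by Fubini. No boundary terms at infinity
  have to be estimated.\<close>

lemma integral_partial_deriv_eq_0:
  fixes F :: "real^'n::finite \<Rightarrow> complex"
  assumes pd: "has_pd k F F'" and cont: "continuous_on UNIV F'"
    and intF: "integrable lborel F" and intF': "integrable lborel F'"
  shows "integral\<^sup>L lborel F' = 0"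
proof -
  let ?e = "axis k 1 :: real^'n"
  have [measurable]: "F' \<in> borel_measurable borel"
    by (rule borel_measurable_continuous_onI[OF cont])
  have [measurable]: "F \<in> borel_measurable borel"
    using borel_measurable_integrable[OF intF] by simp
  define H where "H s x = indicator {0..1} s *\<^sub>R F' (x + s *\<^sub>R ?e)" for s :: real and x
  have trans: "integrable lborel (\<lambda>x. F' (x + s *\<^sub>R ?e))"
    "(\<integral>x. F' (x + s *\<^sub>R ?e) \<partial>lborel) = integral\<^sup>L lborel F'"
    "(\<integral>x. norm (F' (x + s *\<^sub>R ?e)) \<partial>lborel) = (\<integral>x. norm (F' x) \<partial>lborel)" for s
    using intF' by (simp_all add: lborel_integral_translate lborel_integral_translate[of "\<lambda>x. norm (F' x)"])
  have "integrable (lborel \<Otimes>\<^sub>M lborel) (case_prod H)"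
  proof (rule lborel_pair.Fubini_integrable)
    show "case_prod H \<in> borel_measurable (lborel \<Otimes>\<^sub>M lborel)"
      unfolding H_def by measurable
    have "(\<lambda>s. \<integral>x. norm (case (s, x) of (s, x) \<Rightarrow> H s x) \<partial>lborel) =
        (\<lambda>s. indicator {0..1} s * (\<integral>x. norm (F' x) \<partial>lborel))"
      by (simp add: H_def trans(3))
    then show "integrable lborel (\<lambda>s. \<integral>x. norm (case (s, x) of (s, x) \<Rightarrow> H s x) \<partial>lborel)"
      by simp
    show "AE s in lborel. integrable lborel (\<lambda>x. case (s, x) of (s, x) \<Rightarrow> H s x)"
      by (simp add: H_def trans(1))
  qed
  then have "(\<integral>x. (\<integral>s. H s x \<partial>lborel) \<partial>lborel) = (\<integral>s. (\<integral>x. H s x \<partial>lborel) \<partial>lborel)"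
    by (rule lborel_pair.Fubini_integral)
  moreover have "(\<integral>s. H s x \<partial>lborel) = F (x + ?e) - F x" for x
  proof -
    have "(\<integral>s. indicator {0..1} s *\<^sub>R F' (x + s *\<^sub>R ?e) \<partial>lborel) = F (x + 1 *\<^sub>R ?e) - F (x + 0 *\<^sub>R ?e)"
    proof (rule integral_FTC_Icc[where F = "\<lambda>s. F (x + s *\<^sub>R ?e)"])
      show "((\<lambda>s. F (x + s *\<^sub>R ?e)) has_vector_derivative F' (x + s *\<^sub>R ?e)) (at s within {0..1})" for s
        by (rule has_vector_derivative_at_within[OF has_pd_line[OF pd]])
      show "continuous_on {0..1} (\<lambda>s. F' (x + s *\<^sub>R ?e))"
        by (rule continuous_on_compose2[OF cont]) (auto intro!: continuous_intros)
    qed simp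
    then show ?thesis by (simp add: H_def)
  qed
  moreover have "(\<integral>x. F (x + ?e) - F x \<partial>lborel) = 0"
    using intF by (subst Bochner_Integration.integral_diff) (simp_all add: lborel_integral_translate)
  moreover have "(\<integral>s. (\<integral>x. H s x \<partial>lborel) \<partial>lborel) = integral\<^sup>L lborel F'"
    by (simp add: H_def trans(2))
  ultimately show ?thesis by simp
qed

section \<open>Smooth functions with integrable derivatives, and the decay of their Fourier
  integrals\<close>

definition smooth_L1 :: "(real^'n::finite \<Rightarrow> complex) \<Rightarrow> bool" where
  "smooth_L1 g \<longleftrightarrow> smooth g \<and> (\<forall>ks. integrable lborel (foldr partial_deriv ks g))"

lemma smooth_L1_smooth: "smooth_L1 g \<Longrightarrow> smooth g"
  by (simp add: smooth_L1_def)

lemma smooth_L1_integrable: "smooth_L1 g \<Longrightarrow> integrable lborel g"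
  unfolding smooth_L1_def by (metis foldr.simps(1) id_apply)

lemma smooth_L1_partial_deriv: "smooth_L1 g \<Longrightarrow> smooth_L1 (partial_deriv k g)"
  unfolding smooth_L1_def
proof (intro conjI allI)
  fix ks
  assume "smooth g \<and> (\<forall>ks. integrable lborel (foldr partial_deriv ks g))"
  then show "smooth (partial_deriv k g)" "integrable lborel (foldr partial_deriv ks (partial_deriv k g))"
    using smooth_partial_deriv[of g k] by (auto dest: spec[of _ "ks @ [k]"])
qed

lemma smooth_L1_coinduct:
  assumes "f \<in> S"
    and "\<And>f. f \<in> S \<Longrightarrow> smooth f"
    and "\<And>f. f \<in> S \<Longrightarrow> integrable lborel f"
    and "\<And>f k. f \<in> S \<Longrightarrow> partial_deriv k f \<in> S"
  shows "smooth_L1 f"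
proof -
  have "foldr partial_deriv ks f \<in> S" for ks
    by (induction ks) (auto simp: assms(1,4))
  with assms show ?thesis unfolding smooth_L1_def by simp
qed

lemma smooth_L1_linear_comb:
  assumes "smooth_L1 f" "smooth_L1 g"
  shows "smooth_L1 (\<lambda>x. a * f x + b * g x)"
proof (rule smooth_L1_coinduct[where S = "{\<lambda>x. a * f x + b * g x |f g. smooth_L1 f \<and> smooth_L1 g}"])
  show "(\<lambda>x. a * f x + b * g x) \<in> {\<lambda>x. a * f x + b * g x |f g. smooth_L1 f \<and> smooth_L1 g}"
    using assms by blast
  fix h assume "h \<in> {\<lambda>x. a * f x + b * g x |f g. smooth_L1 f \<and> smooth_L1 g}"
  then obtain f g where h: "h = (\<lambda>x. a * f x + b * g x)" and fg: "smooth_L1 f" "smooth_L1 g" by blast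
  note sm = smooth_L1_smooth[OF fg(1)] smooth_L1_smooth[OF fg(2)]
  show "smooth h" unfolding h by (intro smooth_add smooth_cmult sm)
  show "integrable lborel h" unfolding h
    by (intro Bochner_Integration.integrable_add integrable_mult_right smooth_L1_integrable fg)
  fix k
  have "has_pd k h (\<lambda>x. (a * partial_deriv k f x + 0 * f x) + (b * partial_deriv k g x + 0 * g x))"
    unfolding h by (intro has_pd_add has_pd_mult has_pd_const smooth_has_pd sm)
  then have "partial_deriv k h = (\<lambda>x. a * partial_deriv k f x + b * partial_deriv k g x)"
    using has_pd_partial_deriv by fastforce
  then show "partial_deriv k h \<in> {\<lambda>x. a * f x + b * g x |f g. smooth_L1 f \<and> smooth_L1 g}"
    using fg[THEN smooth_L1_partial_deriv[of _ k]] by blast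
qed

lemma smooth_L1_D1:
  assumes "smooth_L1 g" shows "smooth_L1 (D1 k g)"
  using smooth_L1_linear_comb[OF smooth_L1_partial_deriv[OF assms] assms, of "- \<i>" k 0]
  by (simp add: D1_def[abs_def])

lemma test_functions_integrable:
  assumes "f \<in> test_functions" shows "integrable lborel f"
proof -
  obtain r where r: "\<And>x. norm x > r \<Longrightarrow> f x = 0" and f: "smooth f"
    using assms unfolding test_functions_iff by auto
  have "integrable lborel (\<lambda>x. indicator (cball 0 r) x *\<^sub>R f x)"
    using borel_integrable_compact[OF compact_cball continuous_on_subset[OF smooth_continuous[OF f]]]
    by (simp add: set_integrable_def)
  moreover have "(\<lambda>x. indicator (cball 0 r) x *\<^sub>R f x) = f"
    using r by (auto simp: fun_eq_iff indicator_def not_le)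
  ultimately show ?thesis by simp
qed

lemma test_functions_smooth_L1: "f \<in> test_functions \<Longrightarrow> smooth_L1 f"
  by (rule smooth_L1_coinduct[where S = test_functions])
    (auto intro: test_functions_smooth test_functions_integrable test_functions_partial_deriv)

text \<open>This has the sign of the inverse transform and no normalizing factor. The usual
  transform of \<open>f\<close> appears as \<open>fourier f (- \<xi>)\<close>, under which
  \<open>D1 k\<close> becomes multiplication by \<open>\<xi> $ k\<close>.\<close>

definition fourier :: "(real^'n::finite \<Rightarrow> complex) \<Rightarrow> real^'n \<Rightarrow> complex" where
  "fourier g x = (\<integral>\<xi>. g \<xi> * cis (x \<bullet> \<xi>) \<partial>lborel)"

lemma measurable_cis [measurable]:
  "f \<in> borel_measurable M \<Longrightarrow> (\<lambda>x. cis (f x)) \<in> borel_measurable M"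
  by (rule measurable_compose[OF _ borel_measurable_continuous_onI[OF continuous_on_cis[OF continuous_on_id]]])

lemma integrable_mult_cis:
  assumes "integrable lborel g" and [measurable]: "f \<in> borel_measurable lborel"
  shows "integrable lborel (\<lambda>x. g x * cis (f x))"
proof -
  have [measurable]: "g \<in> borel_measurable lborel"
    using assms(1) by (rule borel_measurable_integrable)
  show ?thesis
    by (rule Bochner_Integration.integrable_bound[OF assms(1)]) (auto simp: norm_mult)
qed

lemma fourier_linear:
  assumes "integrable lborel f" "integrable lborel g"
  shows "fourier (\<lambda>x. a * f x + b * g x) x = a * fourier f x + b * fourier g x"
  unfolding fourier_def using integrable_mult_cis[OF assms(1)] integrable_mult_cis[OF assms(2)]
  by (simp add: distrib_right mult.assoc)

text \<open>Integration by parts: the derivative of \<open>g\<close> times the exponential has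
  integral 0.\<close>

lemma fourier_D1:
  assumes "smooth_L1 g"
  shows "fourier (D1 k g) x = - of_real (x $ k) * fourier g x"
proof -
  let ?F = "\<lambda>\<xi>. g \<xi> * exp (\<i> * of_real (x \<bullet> \<xi>))"
  let ?F' = "\<lambda>\<xi>. g \<xi> * (\<i> * of_real (x $ k) * exp (\<i> * of_real (x \<bullet> \<xi>))) + partial_deriv k g \<xi> * exp (\<i> * of_real (x \<bullet> \<xi>))"
  have exp_cis: "exp (\<i> * of_real t) = cis t" for t by (simp add: cis_conv_exp)
  have g: "smooth g" using assms by (rule smooth_L1_smooth)
  have "has_pd k (\<lambda>\<xi>. \<i> * of_real (x \<bullet> \<xi>)) (\<lambda>_. \<i> * of_real (x $ k))"
    unfolding has_pd_def has_vector_derivative_complex_iff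
    by (auto intro!: derivative_eq_intros simp: inner_add_right inner_axis)
  then have pd: "has_pd k ?F ?F'"
    by (intro has_pd_mult has_pd_exp smooth_has_pd g)
  have int1: "integrable lborel (\<lambda>\<xi>. g \<xi> * cis (x \<bullet> \<xi>))"
    by (rule integrable_mult_cis[OF smooth_L1_integrable[OF assms]]) simp
  have int2: "integrable lborel (\<lambda>\<xi>. partial_deriv k g \<xi> * cis (x \<bullet> \<xi>))"
    by (rule integrable_mult_cis[OF smooth_L1_integrable[OF smooth_L1_partial_deriv[OF assms]]]) simp
  have F': "?F' = (\<lambda>\<xi>. (\<i> * of_real (x $ k)) * (g \<xi> * cis (x \<bullet> \<xi>)) + partial_deriv k g \<xi> * cis (x \<bullet> \<xi>))"
    by (auto simp: exp_cis mult_ac)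
  have "integral\<^sup>L lborel ?F' = 0"
  proof (rule integral_partial_deriv_eq_0[OF pd])
    show "continuous_on UNIV ?F'"
      by (intro continuous_intros smooth_continuous smooth_partial_deriv g)
    show "integrable lborel ?F" using int1 by (simp add: exp_cis)
    show "integrable lborel ?F'"
      unfolding F' by (intro Bochner_Integration.integrable_add integrable_mult_right int1 int2)
  qed
  then have "\<i> * of_real (x $ k) * fourier g x + fourier (partial_deriv k g) x = 0"
    unfolding F' fourier_def using int1 int2 by simp
  then have "fourier (partial_deriv k g) x = - (\<i> * of_real (x $ k) * fourier g x)"
    by (simp add: add_eq_0_iff)
  moreover have "fourier (D1 k g) x = - \<i> * fourier (partial_deriv k g) x"
    using fourier_linear[OF smooth_L1_integrable[OF smooth_L1_partial_deriv[OF assms]] smooth_L1_integrable[OF assms], of "- \<i>" k 0]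
    by (simp add: D1_def[abs_def])
  ultimately show ?thesis by (simp flip: mult.assoc)
qed

text \<open>Adding to \<open>g\<close> its second derivative under \<open>D1 k\<close> multiplies
  the transform by \<open>1 + (x $ k)^2\<close>. After this has been done once for each coordinate,
  the transform is still bounded by an L1 norm. The product form of the bound reduces its
  integrability to one variable.\<close>

lemma fourier_decay:
  fixes g :: "real^'n::finite \<Rightarrow> complex"
  assumes "smooth_L1 g"
  shows "\<exists>C. \<forall>x. norm (fourier g x) \<le> C * (\<Prod>k\<in>UNIV. 1 / (1 + (x $ k)\<^sup>2))"
proof -
  have pos: "0 < (\<Prod>k\<in>A. 1 + (x $ k)\<^sup>2)" for A and x :: "real^'n"
    by (intro prod_pos) (auto intro: add_pos_nonneg)
  have "\<exists>C. \<forall>x. (\<Prod>k\<in>A. 1 + (x $ k)\<^sup>2) * norm (fourier g x) \<le> C" if "finite A" "smooth_L1 g" for A g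
    using that
  proof (induction A arbitrary: g)
    case empty
    have "norm (fourier g x) \<le> (\<integral>\<xi>. norm (g \<xi>) \<partial>lborel)" for x
      unfolding fourier_def by (rule order_trans[OF integral_norm_bound]) (simp add: norm_mult)
    then show ?case by auto
  next
    case (insert k A)
    let ?h = "\<lambda>x. 1 * g x + 1 * D1 k (D1 k g) x"
    have n2: "smooth_L1 (D1 k (D1 k g))" by (intro smooth_L1_D1 insert.prems)
    have "smooth_L1 ?h" by (rule smooth_L1_linear_comb[OF insert.prems n2])
    then obtain C where C: "\<And>x. (\<Prod>k\<in>A. 1 + (x $ k)\<^sup>2) * norm (fourier ?h x) \<le> C"
      using insert.IH by blast
    have "fourier ?h x = of_real (1 + (x $ k)\<^sup>2) * fourier g x" for x
      by (subst fourier_linear[OF smooth_L1_integrable[OF insert.prems] smooth_L1_integrable[OF n2]])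
        (simp add: fourier_D1 smooth_L1_D1 insert.prems power2_eq_square algebra_simps)
    then have "norm (fourier ?h x) = (1 + (x $ k)\<^sup>2) * norm (fourier g x)" for x
      by (simp add: norm_mult abs_of_nonneg del: of_real_add)
    with C have "(\<Prod>k\<in>insert k A. 1 + (x $ k)\<^sup>2) * norm (fourier g x) \<le> C" for x
      using insert.hyps by (simp add: mult_ac)
    then show ?case by blast
  qed
  from this[OF finite assms, of UNIV] obtain C
    where "\<And>x. (\<Prod>k\<in>UNIV. 1 + (x $ k)\<^sup>2) * norm (fourier g x) \<le> C" by blast
  then have "norm (fourier g x) \<le> C * (\<Prod>k\<in>UNIV. 1 / (1 + (x $ k)\<^sup>2))" for x
    using pos[where A = UNIV and x = x] by (simp add: prod_dividef field_simps)
  then show ?thesis by blast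
qed

lemma integrable_prod_inverse_square:
  "integrable lborel (\<lambda>x::real^'n::finite. \<Prod>k\<in>UNIV. 1 / (1 + (x $ k)\<^sup>2))"
proof (rule integrableI_bounded)
  have meas: "(\<lambda>x::real^'n. x $ k) \<in> borel_measurable borel" for k
    by (intro borel_measurable_continuous_onI continuous_intros)
  show "(\<lambda>x::real^'n. \<Prod>k\<in>UNIV. 1 / (1 + (x $ k)\<^sup>2)) \<in> borel_measurable lborel"
    using meas by measurable
  let ?f = "\<lambda>t::real. 1 / (1 + t\<^sup>2)"
  have nn: "0 \<le> ?f t" for t by simp
  have "integrable lborel ?f"
    using integrable_inverse_1_plus_square
    by (simp add: set_integrable_def einterval_def inverse_eq_divide)
  then have fin: "(\<integral>\<^sup>+t. ?f t \<partial>lborel) < \<infinity>"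
    using nn by (simp add: integrable_iff_bounded)
  have "(\<integral>\<^sup>+(x::real^'n). ennreal (norm (\<Prod>k\<in>UNIV. ?f (x $ k))) \<partial>lborel) =
      (\<integral>\<^sup>+(x::real^'n). (\<Prod>b\<in>Basis. ennreal (?f (x \<bullet> b))) \<partial>lborel)"
  proof (rule nn_integral_cong)
    fix x :: "real^'n"
    have B: "(Basis :: (real^'n) set) = (\<lambda>k. axis k 1) ` UNIV" by (auto simp: Basis_vec_def)
    have inj: "inj (\<lambda>k. axis k 1 :: real^'n)" by (auto simp: inj_on_def axis_eq_axis)
    show "ennreal (norm (\<Prod>k\<in>UNIV. ?f (x $ k))) = (\<Prod>b\<in>Basis. ennreal (?f (x \<bullet> b)))"
      unfolding B by (subst prod.reindex[OF inj]) (simp add: prod_ennreal inner_axis abs_of_nonneg prod_nonneg)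
  qed
  also have "\<dots> = (\<Prod>b\<in>(Basis :: (real^'n) set). (\<integral>\<^sup>+t. ?f t \<partial>lborel))"
    by (rule nn_integral_lborel_prod) auto
  also have "\<dots> < \<infinity>"
    using fin by (simp add: prod_constant power_less_top_ennreal)
  finally show "(\<integral>\<^sup>+x. ennreal (norm (\<Prod>k\<in>UNIV. ?f ((x::real^'n) $ k))) \<partial>lborel) < \<infinity>" .
qed

lemma measurable_fourier [measurable]:
  assumes [measurable]: "g \<in> borel_measurable borel"
  shows "fourier g \<in> borel_measurable borel"
  unfolding fourier_def[abs_def]
  by (rule lborel.borel_measurable_lebesgue_integral) measurable

lemma smooth_measurable: "smooth f \<Longrightarrow> f \<in> borel_measurable borel"
  by (intro borel_measurable_continuous_onI smooth_continuous)

lemma fourier_integrable: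
  assumes "smooth_L1 g" shows "integrable lborel (fourier g)"
proof -
  obtain C where C: "\<And>x. norm (fourier g x) \<le> C * (\<Prod>k\<in>UNIV. 1 / (1 + (x $ k)\<^sup>2))"
    using fourier_decay[OF assms] by blast
  have "fourier g \<in> borel_measurable lborel"
    using smooth_measurable[OF smooth_L1_smooth[OF assms]] by simp
  then show ?thesis
    by (rule Bochner_Integration.integrable_bound[OF integrable_mult_right[OF integrable_prod_inverse_square, of C]])
      (use C order_trans[OF _ abs_ge_self] in auto)
qed

section \<open>Fourier multipliers as convolutions, and inversion up to a constant\<close>

lemma fourier_mult_eq_convolution:
  fixes f g :: "real^'n::finite \<Rightarrow> complex"
  assumes g: "integrable lborel g" and f: "integrable lborel f"
  shows "(\<integral>\<xi>. g \<xi> * cis (x \<bullet> \<xi>) * fourier f (- \<xi>) \<partial>lborel) = (\<integral>y. fourier g (x - y) * f y \<partial>lborel)"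
proof -
  have [measurable]: "g \<in> borel_measurable borel" "f \<in> borel_measurable borel"
    using borel_measurable_integrable[OF g] borel_measurable_integrable[OF f] by simp_all
  define H where "H \<xi> y = g \<xi> * cis ((x - y) \<bullet> \<xi>) * f y" for \<xi> y
  have H: "H \<xi> y = (g \<xi> * cis (x \<bullet> \<xi>)) * (f y * cis (- \<xi> \<bullet> y))" for \<xi> y
  proof -
    have "cis ((x - y) \<bullet> \<xi>) = cis (x \<bullet> \<xi>) * cis (- \<xi> \<bullet> y)"
      by (simp add: cis_mult inner_diff_left inner_commute[of y])
    then show ?thesis by (simp add: H_def)
  qed
  have intf: "integrable lborel (\<lambda>y. f y * cis (- \<xi> \<bullet> y))" for \<xi>
    by (rule integrable_mult_cis[OF f]) simp
  have "integrable (lborel \<Otimes>\<^sub>M lborel) (case_prod H)"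
  proof (rule lborel_pair.Fubini_integrable)
    show "case_prod H \<in> borel_measurable (lborel \<Otimes>\<^sub>M lborel)"
      unfolding H_def by measurable
    have "(\<lambda>\<xi>. \<integral>y. norm (case (\<xi>, y) of (\<xi>, y) \<Rightarrow> H \<xi> y) \<partial>lborel) =
        (\<lambda>\<xi>. norm (g \<xi>) * (\<integral>y. norm (f y) \<partial>lborel))"
      by (simp add: H_def norm_mult)
    then show "integrable lborel (\<lambda>\<xi>. \<integral>y. norm (case (\<xi>, y) of (\<xi>, y) \<Rightarrow> H \<xi> y) \<partial>lborel)"
      using g by simp
    show "AE \<xi> in lborel. integrable lborel (\<lambda>y. case (\<xi>, y) of (\<xi>, y) \<Rightarrow> H \<xi> y)"
      unfolding H split_conv by (intro AE_I2 integrable_mult_right intf)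
  qed
  then have "(\<integral>y. (\<integral>\<xi>. H \<xi> y \<partial>lborel) \<partial>lborel) = (\<integral>\<xi>. (\<integral>y. H \<xi> y \<partial>lborel) \<partial>lborel)"
    by (rule lborel_pair.Fubini_integral)
  moreover have "(\<integral>\<xi>. H \<xi> y \<partial>lborel) = fourier g (x - y) * f y" for y
    unfolding H_def fourier_def by simp
  moreover have "(\<integral>y. H \<xi> y \<partial>lborel) = g \<xi> * cis (x \<bullet> \<xi>) * fourier f (- \<xi>)" for \<xi>
    unfolding H fourier_def by simp
  ultimately show ?thesis by simp
qed

lemma fourier_dilate:
  fixes g :: "real^'n::finite \<Rightarrow> complex"
  assumes "integrable lborel g" "\<tau> > 0"
  shows "fourier g z = of_real (\<tau> ^ CARD('n)) * fourier (\<lambda>\<xi>. g (\<tau> *\<^sub>R \<xi>)) (\<tau> *\<^sub>R z)"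
proof -
  have [measurable]: "g \<in> borel_measurable borel"
    using borel_measurable_integrable[OF assms(1)] by simp
  have "(\<lambda>\<xi>. g \<xi> * cis (z \<bullet> \<xi>)) \<in> borel_measurable borel" by measurable
  from lborel_integral_affine(2)[OF this, of \<tau> 0] assms(2) show ?thesis
    unfolding fourier_def by (simp add: scaleR_conv_of_real[where 'a = complex] inner_commute)
qed

lemma integrable_cis_fourier:
  assumes "smooth_L1 f" shows "integrable lborel (\<lambda>\<xi>. cis (x \<bullet> \<xi>) * fourier f (- \<xi>))"
proof -
  have "integrable lborel (\<lambda>\<xi>. fourier f (- \<xi>))"
    using lborel_integral_affine(1)[of "fourier f" "-1" 0] fourier_integrable[OF assms] by simp
  from integrable_mult_cis[OF this, of "\<lambda>\<xi>. x \<bullet> \<xi>"] show ?thesis by (simp add: mult.commute)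
qed

text \<open>The kernel on the right does not depend on \<open>\<tau>\<close>; this gives \<open>L\<^sup>\<infinity>\<close> bounds uniform in \<open>\<tau>\<close>.\<close>

lemma fourier_dilated_multiplier:
  fixes f g :: "real^'n::finite \<Rightarrow> complex"
  assumes g: "integrable lborel g" and f: "integrable lborel f" and \<tau>: "\<tau> > 0"
  shows "(\<integral>\<xi>. g (\<tau> *\<^sub>R \<xi>) * cis (x \<bullet> \<xi>) * fourier f (- \<xi>) \<partial>lborel) = (\<integral>z. fourier g z * f (x - \<tau> *\<^sub>R z) \<partial>lborel)"
proof -
  have [measurable]: "g \<in> borel_measurable borel" "f \<in> borel_measurable borel"
    using borel_measurable_integrable[OF g] borel_measurable_integrable[OF f] by simp_all
  let ?g = "\<lambda>\<xi>. g (\<tau> *\<^sub>R \<xi>)"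
  have intg: "integrable lborel ?g"
    using lborel_integral_affine(1)[of g \<tau> 0] g \<tau> by simp
  have "(\<integral>\<xi>. ?g \<xi> * cis (x \<bullet> \<xi>) * fourier f (- \<xi>) \<partial>lborel) = (\<integral>y. fourier ?g (x - y) * f y \<partial>lborel)"
    by (rule fourier_mult_eq_convolution[OF intg f])
  \<comment> \<open>Substitution \<open>y = x - \<tau> z\<close>. The Jacobian is exactly the factor
    that turns the kernel of the dilated multiplier into that of \<open>g\<close>.\<close>
  also have "\<dots> = \<tau> ^ CARD('n) *\<^sub>R (\<integral>z. fourier ?g (x - (x - \<tau> *\<^sub>R z)) * f (x - \<tau> *\<^sub>R z) \<partial>lborel)"
    using lborel_integral_affine(2)[of "\<lambda>y. fourier ?g (x - y) * f y" "- \<tau>" x] \<tau> by simp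
  also have "\<dots> = (\<integral>z. (of_real (\<tau> ^ CARD('n)) * fourier ?g (\<tau> *\<^sub>R z)) * f (x - \<tau> *\<^sub>R z) \<partial>lborel)"
    by (simp add: scaleR_conv_of_real[where 'a = complex] mult.assoc)
  also have "\<dots> = (\<integral>z. fourier g z * f (x - \<tau> *\<^sub>R z) \<partial>lborel)"
    by (simp only: fourier_dilate[OF g \<tau>, symmetric])
  finally show ?thesis .
qed

lemma fourier_dilated_multiplier_bound:
  fixes f g :: "real^'n::finite \<Rightarrow> complex"
  assumes g: "smooth_L1 g" and f: "integrable lborel f" and \<tau>: "\<tau> > 0" and B: "\<And>x. norm (f x) \<le> B"
  shows "norm (\<integral>\<xi>. g (\<tau> *\<^sub>R \<xi>) * cis (x \<bullet> \<xi>) * fourier f (- \<xi>) \<partial>lborel) \<le> (\<integral>z. norm (fourier g z) \<partial>lborel) * B"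
proof -
  note Fg = fourier_integrable[OF g]
  have [measurable]: "f \<in> borel_measurable borel" "fourier g \<in> borel_measurable borel"
    using borel_measurable_integrable[OF f] borel_measurable_integrable[OF Fg] by simp_all
  have "norm (\<integral>z. fourier g z * f (x - \<tau> *\<^sub>R z) \<partial>lborel) \<le> (\<integral>z. norm (fourier g z) * B \<partial>lborel)"
  proof (rule order_trans[OF integral_norm_bound Bochner_Integration.integral_mono])
    have le: "norm (fourier g z * f (x - \<tau> *\<^sub>R z)) \<le> norm (fourier g z) * B" for z
      unfolding norm_mult by (intro mult_left_mono B norm_ge_zero)
    show int: "integrable lborel (\<lambda>z. norm (fourier g z) * B)" using Fg by simp
    show "integrable lborel (\<lambda>z. norm (fourier g z * f (x - \<tau> *\<^sub>R z)))"
      by (rule Bochner_Integration.integrable_bound[OF int])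
        (use order_trans[OF le abs_ge_self] in \<open>auto simp: norm_mult\<close>)
    show "norm (fourier g z * f (x - \<tau> *\<^sub>R z)) \<le> norm (fourier g z) * B" for z by (rule le)
  qed
  then show ?thesis
    unfolding fourier_dilated_multiplier[OF smooth_L1_integrable[OF g] f \<tau>] by simp
qed

text \<open>Insert the regularizer \<open>E (\<tau> \<xi>)\<close> and let \<tau> tend to 0. On the
  frequency side it tends to \<open>E 0 = 1\<close>; on the other side the averages of
  \<open>f\<close> against the kernel on scale \<tau> tend to \<open>f x\<close> times the integral
  of the kernel. Both limits use dominated convergence.\<close>

lemma fourier_inversion_up_to_constant:
  fixes f E :: "real^'n::finite \<Rightarrow> complex"
  assumes E: "smooth_L1 E" and E0: "E 0 = 1" and E1: "\<And>x. norm (E x) \<le> 1" and f: "f \<in> test_functions"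
  shows "(\<integral>\<xi>. cis (x \<bullet> \<xi>) * fourier f (- \<xi>) \<partial>lborel) = (\<integral>z. fourier E z \<partial>lborel) * f x"
proof -
  note nf = test_functions_smooth_L1[OF f]
  note contE = smooth_continuous[OF smooth_L1_smooth[OF E]] and contf = smooth_continuous[OF test_functions_smooth[OF f]]
  have [measurable]: "f \<in> borel_measurable borel" "E \<in> borel_measurable borel"
    by (intro smooth_measurable smooth_L1_smooth nf E)+
  obtain B where B: "\<And>x. norm (f x) \<le> B" using test_functions_bounded[OF f] by auto
  define \<tau> where "\<tau> n = 1 / (1 + real n)" for n
  have \<tau>: "\<tau> n > 0" for n by (simp add: \<tau>_def)
  have \<tau>0: "\<tau> \<longlonglongrightarrow> 0" unfolding \<tau>_def by real_asymp
  have intf: "integrable lborel (\<lambda>\<xi>. fourier f (- \<xi>))"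
    using integrable_cis_fourier[OF nf, of 0] by simp
  have "(\<lambda>n. \<integral>\<xi>. E (\<tau> n *\<^sub>R \<xi>) * cis (x \<bullet> \<xi>) * fourier f (- \<xi>) \<partial>lborel)
      \<longlonglongrightarrow> (\<integral>\<xi>. cis (x \<bullet> \<xi>) * fourier f (- \<xi>) \<partial>lborel)"
  proof (rule integral_dominated_convergence[where w = "\<lambda>\<xi>. norm (fourier f (- \<xi>))"])
    show "integrable lborel (\<lambda>\<xi>. norm (fourier f (- \<xi>)))" using intf by simp
    have "(\<lambda>n. E (\<tau> n *\<^sub>R \<xi>)) \<longlonglongrightarrow> E (0 *\<^sub>R \<xi>)" for \<xi>
      by (rule continuous_on_tendsto_compose[OF contE tendsto_scaleR[OF \<tau>0 tendsto_const]]) auto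
    then have "(\<lambda>n. E (\<tau> n *\<^sub>R \<xi>) * cis (x \<bullet> \<xi>) * fourier f (- \<xi>)) \<longlonglongrightarrow> 1 * cis (x \<bullet> \<xi>) * fourier f (- \<xi>)" for \<xi>
      using E0 by (intro tendsto_mult tendsto_const) simp
    then show "AE \<xi> in lborel. (\<lambda>n. E (\<tau> n *\<^sub>R \<xi>) * cis (x \<bullet> \<xi>) * fourier f (- \<xi>)) \<longlonglongrightarrow> cis (x \<bullet> \<xi>) * fourier f (- \<xi>)"
      by simp
    show "AE \<xi> in lborel. norm (E (\<tau> n *\<^sub>R \<xi>) * cis (x \<bullet> \<xi>) * fourier f (- \<xi>)) \<le> norm (fourier f (- \<xi>))" for n
      by (simp add: norm_mult mult_left_le_one_le E1)
  qed measurable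
  moreover have "(\<lambda>n. \<integral>z. fourier E z * f (x - \<tau> n *\<^sub>R z) \<partial>lborel) \<longlonglongrightarrow> (\<integral>z. fourier E z * f x \<partial>lborel)"
  proof (rule integral_dominated_convergence[where w = "\<lambda>z. norm (fourier E z) * B"])
    show "integrable lborel (\<lambda>z. norm (fourier E z) * B)" using fourier_integrable[OF E] by simp
    have "(\<lambda>n. f (x - \<tau> n *\<^sub>R z)) \<longlonglongrightarrow> f (x - 0 *\<^sub>R z)" for z
      by (rule continuous_on_tendsto_compose[OF contf tendsto_diff[OF tendsto_const tendsto_scaleR[OF \<tau>0 tendsto_const]]]) auto
    then have "(\<lambda>n. fourier E z * f (x - \<tau> n *\<^sub>R z)) \<longlonglongrightarrow> fourier E z * f x" for z
      by (intro tendsto_mult tendsto_const) simp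
    then show "AE z in lborel. (\<lambda>n. fourier E z * f (x - \<tau> n *\<^sub>R z)) \<longlonglongrightarrow> fourier E z * f x"
      by simp
    show "AE z in lborel. norm (fourier E z * f (x - \<tau> n *\<^sub>R z)) \<le> norm (fourier E z) * B" for n
      by (simp add: norm_mult mult_left_mono B)
  qed measurable
  ultimately have "(\<integral>\<xi>. cis (x \<bullet> \<xi>) * fourier f (- \<xi>) \<partial>lborel) = (\<integral>z. fourier E z * f x \<partial>lborel)"
    unfolding fourier_dilated_multiplier[OF smooth_L1_integrable[OF E] smooth_L1_integrable[OF nf] \<tau>]
    by (rule LIMSEQ_unique)
  then show ?thesis by simp
qed

text \<open>This shows that the constant of the inversion formula is not 0 without computing it. Let
  \<open>h\<close> be the transform of a nonnegative bump. If all inverse transforms of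
  \<open>h\<close> vanished, pairing with the reflected bump would give integral 0 for the square of
  \<open>norm h\<close>, hence \<open>h = 0\<close> by continuity, although \<open>h 0\<close> is
  the integral of the bump.\<close>

lemma test_fourier_nonzero:
  "\<exists>f\<in>test_functions. \<exists>x :: real^'n::finite.
     (\<integral>\<xi>. cis (x \<bullet> \<xi>) * fourier f (- \<xi>) \<partial>lborel) \<noteq> 0"
proof (rule ccontr)
  assume hyp: "\<not> ?thesis"
  obtain \<phi> :: "real^'n \<Rightarrow> real" where test: "(\<lambda>x. of_real (\<phi> x)) \<in> test_functions"
    and \<phi>0: "\<phi> 0 = 1" and nn: "\<And>x. 0 \<le> \<phi> x" using exists_bump by auto
  define f :: "real^'n \<Rightarrow> complex" where "f x = of_real (\<phi> x)" for x
  have f: "f \<in> test_functions" using test by (simp add: f_def[abs_def])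
  note nf = test_functions_smooth_L1[OF f] and contf = smooth_continuous[OF test_functions_smooth[OF f]]
  note intf = smooth_L1_integrable[OF nf]
  have [measurable]: "f \<in> borel_measurable borel" by (rule smooth_measurable[OF smooth_L1_smooth[OF nf]])
  define h where "h \<xi> = fourier f (- \<xi>)" for \<xi>
  have h: "h \<xi> = (\<integral>y. f y * cis (- \<xi> \<bullet> y) \<partial>lborel)" for \<xi> by (simp add: h_def fourier_def)
  have inth: "integrable lborel h"
    using integrable_cis_fourier[OF nf, of 0] by (simp add: h_def[abs_def])
  have [measurable]: "h \<in> borel_measurable borel" using borel_measurable_integrable[OF inth] by simp
  have zero: "fourier h x = 0" for x
  proof -
    have "(\<integral>\<xi>. cis (x \<bullet> \<xi>) * fourier f (- \<xi>) \<partial>lborel) = 0"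
      using hyp f by blast
    then show ?thesis by (simp add: fourier_def[of h] h_def mult.commute)
  qed
  let ?f = "\<lambda>y. f (- y)"
  have intf': "integrable lborel ?f"
    using lborel_integral_affine(1)[of f "-1" 0] intf by simp
  \<comment> \<open>Since \<open>f\<close> is real-valued, reflecting it conjugates its
    transform.\<close>
  have "fourier ?f (- \<xi>) = cnj (h \<xi>)" for \<xi>
  proof -
    have "fourier ?f (- \<xi>) = (\<integral>y. f y * cis (\<xi> \<bullet> y) \<partial>lborel)"
      using lborel_integral_affine(2)[of "\<lambda>y. f y * cis (\<xi> \<bullet> y)" "-1" 0] by (simp add: fourier_def)
    also have "\<dots> = (\<integral>y. cnj (f y * cis (- \<xi> \<bullet> y)) \<partial>lborel)"
      by (simp add: f_def cis_cnj)
    also have "\<dots> = cnj (h \<xi>)" unfolding h by (rule Bochner_Integration.integral_cnj)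
    finally show ?thesis .
  qed
  with fourier_mult_eq_convolution[OF inth intf', of 0]
  have "(\<integral>\<xi>. h \<xi> * cnj (h \<xi>) \<partial>lborel) = 0" by (simp add: zero)
  then have "complex_of_real (\<integral>\<xi>. (norm (h \<xi>))\<^sup>2 \<partial>lborel) = 0"
    by (simp add: complex_norm_square[symmetric] del: of_real_power)
  then have 0: "(\<integral>\<xi>. (norm (h \<xi>))\<^sup>2 \<partial>lborel) = 0" by simp
  have hb: "norm (h \<xi>) \<le> (\<integral>y. norm (f y) \<partial>lborel)" for \<xi>
    unfolding h by (rule order_trans[OF integral_norm_bound]) (simp add: norm_mult)
  have "integrable lborel (\<lambda>\<xi>. (norm (h \<xi>))\<^sup>2)"
  proof (rule Bochner_Integration.integrable_bound)
    show "integrable lborel (\<lambda>\<xi>. (\<integral>y. norm (f y) \<partial>lborel) * norm (h \<xi>))" using inth by simp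
    show "AE \<xi> in lborel. norm ((norm (h \<xi>))\<^sup>2) \<le> norm ((\<integral>y. norm (f y) \<partial>lborel) * norm (h \<xi>))"
      by (simp add: power2_eq_square norm_mult) (intro AE_I2 mult_right_mono hb norm_ge_zero)
  qed measurable
  with 0 have AE0: "AE \<xi> in lborel. h \<xi> = 0"
    by (subst (asm) integral_nonneg_eq_0_iff_AE) auto
  have "continuous_on UNIV h"
    unfolding continuous_on_sequentially comp_def
  proof (intro ballI allI impI)
    fix X :: "nat \<Rightarrow> real^'n" and \<xi> assume "(\<forall>n. X n \<in> UNIV) \<and> X \<longlonglongrightarrow> \<xi>"
    then have X: "X \<longlonglongrightarrow> \<xi>" by simp
    show "(\<lambda>n. h (X n)) \<longlonglongrightarrow> h \<xi>"
      unfolding h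
    proof (rule integral_dominated_convergence[where w = "\<lambda>y. norm (f y)"])
      have "(\<lambda>n. - X n \<bullet> y) \<longlonglongrightarrow> - \<xi> \<bullet> y" for y by (intro tendsto_intros X)
      then have "(\<lambda>n. cis (- X n \<bullet> y)) \<longlonglongrightarrow> cis (- \<xi> \<bullet> y)" for y
        by (rule tendsto_cis)
      then show "AE y in lborel. (\<lambda>n. f y * cis (- X n \<bullet> y)) \<longlonglongrightarrow> f y * cis (- \<xi> \<bullet> y)"
        by (intro AE_I2 tendsto_mult tendsto_const)
    qed (use intf in \<open>auto simp: norm_mult\<close>)
  qed
  then have "open {\<xi>. h \<xi> \<noteq> 0}"
    by (intro open_Collect_neq continuous_on_const)
  from AE_lborel_open_imp_all[OF AE0 this] have "h 0 = 0" .
  then have "complex_of_real (\<integral>y. \<phi> y \<partial>lborel) = 0" by (simp add: h f_def)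
  then have "(\<integral>y. \<phi> y \<partial>lborel) = 0" by simp
  moreover have "integrable lborel \<phi>" using integrable_Re[OF intf] by (simp add: f_def[abs_def])
  ultimately have "AE y in lborel. \<phi> y = 0"
    using nn by (subst (asm) integral_nonneg_eq_0_iff_AE) auto
  then have "AE y in lborel. f y = 0" by (simp add: f_def)
  moreover have "open {y. f y \<noteq> 0}"
    by (intro open_Collect_neq continuous_on_const contf)
  ultimately have "f 0 = 0" by (rule AE_lborel_open_imp_all)
  with \<phi>0 show False by (simp add: f_def)
qed

section \<open>Symbols\<close>

lemma mi_power_poly: "(\<lambda>\<xi>. of_real (mi_power \<xi> \<alpha>)) \<in> fun_alg coord_funs"
proof -
  have "(\<lambda>\<xi>::real^'a. \<Prod>k\<in>UNIV. of_real (\<xi> $ k) ^ \<alpha> k) \<in> fun_alg coord_funs"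
    by (intro fun_alg_prod fun_alg_power fun_alg_base) auto
  then show ?thesis by (simp add: mi_power_def)
qed

lemma principal_symbol_poly: "principal_symbol l p \<in> fun_alg coord_funs"
  unfolding principal_symbol_def[abs_def] by (intro fun_alg_sum fun_alg_cmult mi_power_poly)

lemma cnj_poly: "p \<in> fun_alg coord_funs \<Longrightarrow> (\<lambda>\<xi>. cnj (p \<xi>)) \<in> fun_alg coord_funs"
proof (induction rule: fun_alg.induct)
  case (fun_alg_base f)
  then obtain k where "f = (\<lambda>x. of_real (x $ k))" by auto
  then show ?case by (auto intro!: fun_alg.fun_alg_base)
qed (simp_all add: fun_alg_const fun_alg_add fun_alg_mult)

lemma mi_power_scaleR: "mi_power (c *\<^sub>R \<xi>) \<alpha> = c ^ mi_size \<alpha> * mi_power \<xi> \<alpha>"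
  by (simp add: mi_power_def mi_size_def power_mult_distrib prod.distrib power_sum)

lemma principal_symbol_scaleR:
  "principal_symbol l p (c *\<^sub>R \<xi>) = of_real (c ^ l) * principal_symbol l p \<xi>"
  unfolding principal_symbol_def sum_distrib_left
  by (rule sum.cong) (auto simp: mi_power_scaleR)

lemma poly_fun_bound:
  assumes "p \<in> fun_alg (coord_funs :: (real^'n::finite \<Rightarrow> complex) set)"
  shows "\<exists>C m. 0 \<le> C \<and> (\<forall>\<xi>. norm (p \<xi>) \<le> C * (1 + norm \<xi>) ^ m)"
  using assms
proof induction
  case (fun_alg_base f)
  then obtain k where f: "f = (\<lambda>x. of_real (x $ k))" by auto
  have "norm (f x) \<le> 1 * (1 + norm x) ^ 1" for x
    using component_le_norm_cart[of x k] by (simp add: f)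
  then show ?case by (metis zero_le_one)
next
  case (fun_alg_const c)
  have "norm c \<le> norm c * (1 + norm x) ^ 0" for x :: "real^'n" by simp
  then show ?case by (metis norm_ge_zero)
next
  case (fun_alg_add f g)
  then obtain C m D k where C: "0 \<le> C" "\<And>x. norm (f x) \<le> C * (1 + norm x) ^ m"
    and D: "0 \<le> D" "\<And>x. norm (g x) \<le> D * (1 + norm x) ^ k" by blast
  have "norm (f x + g x) \<le> (C + D) * (1 + norm x) ^ (m + k)" for x
  proof -
    have "norm (f x + g x) \<le> C * (1 + norm x) ^ m + D * (1 + norm x) ^ k"
      by (intro order_trans[OF norm_triangle_ineq] add_mono C D)
    also have "\<dots> \<le> C * (1 + norm x) ^ (m + k) + D * (1 + norm x) ^ (m + k)"
      by (intro add_mono mult_left_mono power_increasing C D) auto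
    finally show ?thesis by (simp add: algebra_simps)
  qed
  with C D show ?case by (metis add_nonneg_nonneg)
next
  case (fun_alg_mult f g)
  then obtain C m D k where C: "0 \<le> C" "\<And>x. norm (f x) \<le> C * (1 + norm x) ^ m"
    and D: "0 \<le> D" "\<And>x. norm (g x) \<le> D * (1 + norm x) ^ k" by blast
  have "norm (f x * g x) \<le> (C * D) * (1 + norm x) ^ (m + k)" for x
  proof -
    have "norm (f x * g x) \<le> (C * (1 + norm x) ^ m) * (D * (1 + norm x) ^ k)"
      unfolding norm_mult by (intro mult_mono C D) (auto intro: mult_nonneg_nonneg C)
    then show ?thesis by (simp add: power_add mult_ac)
  qed
  with C D show ?case by (metis mult_nonneg_nonneg)
qed

lemma power_div_fact_le_exp:
  assumes "0 \<le> x" shows "x ^ m / fact m \<le> exp (x::real)"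
proof -
  have "(\<Sum>n\<in>{m}. x ^ n /\<^sub>R fact n) \<le> (\<Sum>n. x ^ n /\<^sub>R fact n)"
    by (rule sum_le_suminf[OF summable_exp_generic]) (use assms in auto)
  then show ?thesis by (simp add: exp_def divide_inverse mult.commute)
qed

lemma power_times_exp_bounded:
  assumes "0 < c" "0 < n"
  shows "\<exists>B. \<forall>r\<ge>0. (1 + r) ^ m * exp (- (c * r ^ n)) \<le> (B::real)"
proof (intro exI allI impI)
  fix r :: real assume r: "0 \<le> r"
  \<comment> \<open>This reduces the exponent \<open>n\<close> to 1. The shift by 1 covers small
    \<open>r\<close> and costs the factor \<open>exp (2 * c)\<close>.\<close>
  have "r - 1 \<le> r ^ n"
  proof (cases "r \<le> 1")
    case False
    then have "r ^ 1 \<le> r ^ n" using assms by (intro power_increasing) auto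
    then show ?thesis by simp
  qed (use r zero_le_power[of r n] in linarith)
  then have "c * (r - 1) \<le> c * r ^ n" using assms by (intro mult_left_mono) auto
  then have e: "exp (- (c * r ^ n)) \<le> exp (- (c * (1 + r)) + 2 * c)" by (simp add: algebra_simps)
  have "(c * (1 + r)) ^ m / fact m \<le> exp (c * (1 + r))"
    using assms r by (intro power_div_fact_le_exp) simp
  then have "(1 + r) ^ m \<le> fact m / c ^ m * exp (c * (1 + r))"
    using assms unfolding power_mult_distrib by (simp add: field_simps del: distrib_left distrib_right)
  then have "(1 + r) ^ m * exp (- (c * r ^ n)) \<le> (fact m / c ^ m * exp (c * (1 + r))) * exp (- (c * (1 + r)) + 2 * c)"
    using r assms by (intro mult_mono e) auto
  also have "\<dots> = fact m / c ^ m * (exp (c * (1 + r)) * exp (- (c * (1 + r)) + 2 * c))" by simp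
  also have "exp (c * (1 + r)) * exp (- (c * (1 + r)) + 2 * c) = exp (2 * c)"
    by (simp add: mult_exp_exp)
  finally show "(1 + r) ^ m * exp (- (c * r ^ n)) \<le> fact m / c ^ m * exp (2 * c)" .
qed

section \<open>Elliptic systems are weakly coercive\<close>

lemma fourier_D:
  fixes f :: "real^'n::finite \<Rightarrow> complex"
  assumes "smooth_L1 f"
  shows "fourier (D \<alpha> f) (- \<xi>) = of_real (mi_power \<xi> \<alpha>) * fourier f (- \<xi>)"
proof -
  have "smooth_L1 (D \<alpha> f) \<and> fourier (D \<alpha> f) (- \<xi>) = of_real (mi_power \<xi> \<alpha>) * fourier f (- \<xi>)"
    by (rule D_product_family[where P = "\<lambda>c G. smooth_L1 (G ()) \<and> fourier (G ()) (- \<xi>) = c * fourier f (- \<xi>)" and G = "\<lambda>_. f"])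
      (use assms in \<open>auto simp: smooth_L1_D1 fourier_D1\<close>)
  then show ?thesis by simp
qed

lemma fourier_sum_cmult:
  assumes "\<And>i. i \<in> I \<Longrightarrow> integrable lborel (f i)"
  shows "fourier (\<lambda>x. \<Sum>i\<in>I. c i * f i x) \<xi> = (\<Sum>i\<in>I. c i * fourier (f i) \<xi>)"
proof -
  have "fourier (\<lambda>x. \<Sum>i\<in>I. c i * f i x) \<xi> = (\<integral>x. (\<Sum>i\<in>I. c i * (f i x * cis (\<xi> \<bullet> x))) \<partial>lborel)"
    unfolding fourier_def by (simp add: sum_distrib_right mult.assoc)
  also have "\<dots> = (\<Sum>i\<in>I. \<integral>x. c i * (f i x * cis (\<xi> \<bullet> x)) \<partial>lborel)"
    by (intro Bochner_Integration.integral_sum integrable_mult_right integrable_mult_cis assms) simp_all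
  finally show ?thesis by (simp add: fourier_def)
qed

lemma integrable_dilated_multiplier:
  fixes f g :: "real^'n::finite \<Rightarrow> complex"
  assumes g: "integrable lborel g" and f: "integrable lborel f" and \<tau>: "\<tau> \<noteq> 0"
  shows "integrable lborel (\<lambda>\<xi>. g (\<tau> *\<^sub>R \<xi>) * cis (x \<bullet> \<xi>) * fourier f (- \<xi>))"
proof -
  have [measurable]: "g \<in> borel_measurable borel" "f \<in> borel_measurable borel"
    using borel_measurable_integrable[OF g] borel_measurable_integrable[OF f] by simp_all
  have "integrable lborel (\<lambda>\<xi>. g (\<tau> *\<^sub>R \<xi>))"
    using lborel_integral_affine(1)[of g \<tau> 0] g \<tau> by simp
  then have int: "integrable lborel (\<lambda>\<xi>. norm (g (\<tau> *\<^sub>R \<xi>)) * (\<integral>y. norm (f y) \<partial>lborel))" by simp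
  have "norm (fourier f \<xi>) \<le> (\<integral>y. norm (f y) \<partial>lborel)" for \<xi>
    unfolding fourier_def by (rule order_trans[OF integral_norm_bound]) (simp add: norm_mult)
  then have "norm (g (\<tau> *\<^sub>R \<xi>) * cis (x \<bullet> \<xi>) * fourier f (- \<xi>)) \<le> norm (g (\<tau> *\<^sub>R \<xi>)) * (\<integral>y. norm (f y) \<partial>lborel)" for \<xi>
    by (simp add: norm_mult mult_left_mono)
  then show ?thesis
    by (intro Bochner_Integration.integrable_bound[OF int] AE_I2) auto
qed

locale elliptic_system =
  fixes l N :: nat and a :: "nat \<Rightarrow> 'n::finite multi_index \<Rightarrow> complex"
  assumes l_pos: "0 < l" and elliptic: "elliptic l N a"
begin

abbreviation P :: "nat \<Rightarrow> real^'n \<Rightarrow> complex" where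
  "P j \<equiv> principal_symbol l (a j)"

definition q :: "real^'n \<Rightarrow> real" where
  "q \<xi> = (\<Sum>j=1..N. (norm (P j \<xi>))\<^sup>2)"

definition E :: "real^'n \<Rightarrow> complex" where
  "E \<xi> = of_real (exp (- q \<xi>))"

lemma q_nonneg: "0 \<le> q \<xi>"
  by (simp add: q_def sum_nonneg)

lemma q_poly: "(\<lambda>\<xi>. of_real (q \<xi>)) \<in> fun_alg coord_funs"
proof -
  have "(\<lambda>\<xi>. \<Sum>j=1..N. P j \<xi> * cnj (P j \<xi>)) \<in> fun_alg coord_funs"
    by (intro fun_alg_sum fun_alg_mult cnj_poly principal_symbol_poly)
  then show ?thesis by (simp add: q_def complex_norm_square del: of_real_power)
qed

lemma of_real_q: "of_real (q \<xi>) = (\<Sum>j=1..N. cnj (P j \<xi>) * P j \<xi>)"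
  by (simp add: q_def complex_norm_square mult.commute del: of_real_power)

lemma q_scaleR: "q (c *\<^sub>R \<xi>) = c ^ (2 * l) * q \<xi>"
  by (simp add: q_def principal_symbol_scaleR norm_mult norm_power power_mult_distrib sum_distrib_left
      power_mult[symmetric] mult.commute[of l] power_even_abs)

lemma q_continuous: "continuous_on UNIV q"
proof -
  have "continuous_on UNIV (\<lambda>\<xi>. Re (of_real (q \<xi>)))"
    by (intro continuous_on_Re smooth_continuous poly_fun_smooth q_poly)
  then show ?thesis by simp
qed

text \<open>Ellipticity makes \<open>q\<close> positive on the unit sphere, compactness gives a
  positive minimum there, and homogeneity of degree \<open>2 * l\<close> extends the bound to the
  whole space.\<close>

lemma q_lower_bound: "\<exists>c>0. \<forall>\<xi>. c * norm \<xi> ^ (2 * l) \<le> q \<xi>"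
proof -
  have "\<exists>\<xi>\<in>sphere 0 1. \<forall>\<eta>\<in>sphere 0 1. q \<xi> \<le> q \<eta>"
    by (rule continuous_attains_inf) (auto intro: continuous_on_subset[OF q_continuous])
  then obtain \<xi>\<^sub>0 where \<xi>\<^sub>0: "norm \<xi>\<^sub>0 = 1" and min: "\<And>\<eta>. norm \<eta> = 1 \<Longrightarrow> q \<xi>\<^sub>0 \<le> q \<eta>"
    by auto
  have "q \<xi>\<^sub>0 > 0"
  proof -
    have "\<xi>\<^sub>0 \<noteq> 0" using \<xi>\<^sub>0 by auto
    then obtain j where j: "j \<in> {1..N}" "P j \<xi>\<^sub>0 \<noteq> 0"
      using elliptic unfolding elliptic_def by blast
    then have "0 < (norm (P j \<xi>\<^sub>0))\<^sup>2" by simp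
    also have "\<dots> \<le> q \<xi>\<^sub>0" unfolding q_def using j(1) by (intro member_le_sum) auto
    finally show ?thesis .
  qed
  moreover have "q \<xi>\<^sub>0 * norm \<xi> ^ (2 * l) \<le> q \<xi>" for \<xi>
  proof (cases "\<xi> = 0")
    case False
    have "q \<xi> = q (norm \<xi> *\<^sub>R ((1 / norm \<xi>) *\<^sub>R \<xi>))" using False by simp
    also have "\<dots> = norm \<xi> ^ (2 * l) * q ((1 / norm \<xi>) *\<^sub>R \<xi>)" by (rule q_scaleR)
    finally show ?thesis
      using False min[of "(1 / norm \<xi>) *\<^sub>R \<xi>"] by (simp add: mult.commute mult_right_mono)
  qed (use l_pos q_nonneg[of 0] in \<open>simp add: power_0_left\<close>)
  ultimately show ?thesis by blast
qed

text \<open>Polynomial multiples of \<open>E\<close> are closed under differentiation because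
  \<open>q\<close> is a polynomial. For integrability, multiply \<open>p\<close> by all the factors
  \<open>1 + (\<xi> $ k)^2\<close>: the result is still a polynomial, hence dominated by the decay
  of \<open>E\<close>.\<close>

lemma poly_E_smooth_L1:
  assumes "p \<in> fun_alg coord_funs" shows "smooth_L1 (\<lambda>\<xi>. p \<xi> * E \<xi>)"
proof (rule smooth_L1_coinduct[where S = "{\<lambda>\<xi>. p \<xi> * E \<xi> |p. p \<in> fun_alg coord_funs}"])
  show "(\<lambda>\<xi>. p \<xi> * E \<xi>) \<in> {\<lambda>\<xi>. p \<xi> * E \<xi> |p. p \<in> fun_alg coord_funs}" using assms by blast
  fix f assume "f \<in> {\<lambda>\<xi>. p \<xi> * E \<xi> |p. p \<in> fun_alg coord_funs}"
  then obtain p where f: "f = (\<lambda>\<xi>. p \<xi> * E \<xi>)" and p: "p \<in> fun_alg coord_funs" by blast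
  let ?Q = "\<lambda>\<xi>. (- 1) * complex_of_real (q \<xi>)"
  have Q: "?Q \<in> fun_alg coord_funs" by (intro fun_alg_cmult q_poly)
  have E: "E = (\<lambda>\<xi>. exp (?Q \<xi>))" by (simp add: E_def fun_eq_iff exp_of_real[symmetric])
  have smE: "smooth E" unfolding E by (intro smooth_exp poly_fun_smooth Q)
  show smf: "smooth f" unfolding f by (intro smooth_mult poly_fun_smooth p smE)
  show "integrable lborel f"
  proof -
    have "(\<lambda>\<xi>. p \<xi> * (\<Prod>k\<in>UNIV. 1 + of_real (\<xi> $ k) ^ 2)) \<in> fun_alg coord_funs"
      by (intro fun_alg_mult p fun_alg_prod fun_alg_add fun_alg_const fun_alg_power) (auto intro: fun_alg_base)
    then obtain C m where C: "0 \<le> C"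
        "\<And>\<xi>. norm (p \<xi> * (\<Prod>k\<in>UNIV. 1 + of_real (\<xi> $ k) ^ 2)) \<le> C * (1 + norm \<xi>) ^ m"
      using poly_fun_bound by blast
    obtain c where c: "0 < c" "\<And>\<xi>. c * norm \<xi> ^ (2 * l) \<le> q \<xi>" using q_lower_bound by blast
    obtain B where B: "\<And>r. 0 \<le> r \<Longrightarrow> (1 + r) ^ m * exp (- (c * r ^ (2 * l))) \<le> B"
      using power_times_exp_bounded[OF c(1), of "2 * l" m] l_pos by auto
    have bound: "norm (f \<xi>) \<le> C * B * (\<Prod>k\<in>UNIV. 1 / (1 + (\<xi> $ k)\<^sup>2))" for \<xi>
    proof -
      have pos: "0 < (\<Prod>k\<in>UNIV. 1 + (\<xi> $ k)\<^sup>2)"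
        by (intro prod_pos) (auto intro: add_pos_nonneg)
      have pr: "norm (\<Prod>k\<in>UNIV. 1 + complex_of_real (\<xi> $ k) ^ 2) = (\<Prod>k\<in>UNIV. 1 + (\<xi> $ k)\<^sup>2)"
      proof -
        have "(\<Prod>k\<in>UNIV. 1 + complex_of_real (\<xi> $ k) ^ 2) = of_real (\<Prod>k\<in>UNIV. 1 + (\<xi> $ k)\<^sup>2)" by simp
        then show ?thesis using pos by (simp only: norm_of_real abs_of_pos)
      qed
      have "norm (f \<xi>) * (\<Prod>k\<in>UNIV. 1 + (\<xi> $ k)\<^sup>2)
          = norm (p \<xi> * (\<Prod>k\<in>UNIV. 1 + of_real (\<xi> $ k) ^ 2)) * exp (- q \<xi>)"
        by (simp add: f E_def norm_mult pr)
      also have "\<dots> \<le> (C * (1 + norm \<xi>) ^ m) * exp (- (c * norm \<xi> ^ (2 * l)))"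
        using C c by (intro mult_mono) auto
      also have "\<dots> \<le> C * B"
        using B[of "norm \<xi>"] C(1) by (simp add: mult.assoc mult_left_mono)
      finally show ?thesis using pos by (simp add: prod_dividef pos_le_divide_eq)
    qed
    have "f \<in> borel_measurable lborel" using smooth_measurable[OF smf] by simp
    then show ?thesis
      by (rule Bochner_Integration.integrable_bound[OF integrable_mult_right[OF integrable_prod_inverse_square, of "C * B"]])
        (intro AE_I2, use order_trans[OF bound abs_ge_self] in simp)
  qed
  fix k
  obtain p' where p': "p' \<in> fun_alg coord_funs" "has_pd k p p'"
    using fun_alg_has_pd[OF coord_has_pd p] by blast
  obtain Q' where Q': "Q' \<in> fun_alg coord_funs" "has_pd k ?Q Q'"
    using fun_alg_has_pd[OF coord_has_pd Q] by blast
  have "has_pd k f (\<lambda>\<xi>. p \<xi> * (Q' \<xi> * exp (?Q \<xi>)) + p' \<xi> * exp (?Q \<xi>))"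
    unfolding f E by (intro has_pd_mult has_pd_exp p' Q')
  then have "partial_deriv k f = (\<lambda>\<xi>. p \<xi> * (Q' \<xi> * exp (?Q \<xi>)) + p' \<xi> * exp (?Q \<xi>))"
    by (rule has_pd_partial_deriv)
  also have "\<dots> = (\<lambda>\<xi>. (p \<xi> * Q' \<xi> + p' \<xi>) * E \<xi>)" unfolding E by (simp add: algebra_simps)
  finally have "partial_deriv k f = (\<lambda>\<xi>. (p \<xi> * Q' \<xi> + p' \<xi>) * E \<xi>)" .
  moreover have "(\<lambda>\<xi>. p \<xi> * Q' \<xi> + p' \<xi>) \<in> fun_alg coord_funs"
    by (intro fun_alg_add fun_alg_mult p p' Q')
  ultimately show "partial_deriv k f \<in> {\<lambda>\<xi>. p \<xi> * E \<xi> |p. p \<in> fun_alg coord_funs}"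
    by (intro CollectI exI[of _ "\<lambda>\<xi>. p \<xi> * Q' \<xi> + p' \<xi>"] conjI)
qed

lemma E_smooth_L1: "smooth_L1 E"
  using poly_E_smooth_L1[OF fun_alg_const, of 1] by simp

definition \<kappa> :: complex where
  "\<kappa> = (\<integral>z. fourier E z \<partial>lborel)"

lemma inversion:
  fixes f :: "real^'n \<Rightarrow> complex"
  assumes "f \<in> test_functions"
  shows "(\<integral>\<xi>. cis (x \<bullet> \<xi>) * fourier f (- \<xi>) \<partial>lborel) = \<kappa> * f x"
proof -
  have "E 0 = 1" using q_scaleR[of 0 0] l_pos by (simp add: E_def power_0_left)
  moreover have "norm (E x) \<le> 1" for x by (simp add: E_def q_nonneg)
  ultimately show ?thesis
    unfolding \<kappa>_def by (rule fourier_inversion_up_to_constant[OF E_smooth_L1 _ _ assms])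
qed

lemma \<kappa>_nonzero: "\<kappa> \<noteq> 0"
proof
  assume "\<kappa> = 0"
  then show False using test_fourier_nonzero[where 'n = 'n] inversion by auto
qed

section \<open>Estimates of low and high frequencies\<close>

definition top_op :: "nat \<Rightarrow> (real^'n \<Rightarrow> complex) \<Rightarrow> real^'n \<Rightarrow> complex" where
  "top_op j f x = (\<Sum>\<beta> | mi_size \<beta> = l. a j \<beta> * D \<beta> f x)"

lemma top_op_test: "f \<in> test_functions \<Longrightarrow> top_op j f \<in> test_functions"
  unfolding top_op_def[abs_def] by (intro test_functions_sum test_functions_cmult test_functions_D)

lemma fourier_top_op:
  assumes "f \<in> test_functions"
  shows "fourier (top_op j f) (- \<xi>) = P j \<xi> * fourier f (- \<xi>)"
  unfolding top_op_def[abs_def] principal_symbol_def sum_distrib_right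
  by (subst fourier_sum_cmult)
    (auto simp: fourier_D test_functions_smooth_L1 assms mult.assoc intro!: test_functions_integrable test_functions_D)

text \<open>\<open>A \<alpha>\<close> and \<open>B \<alpha> j\<close> are the L1 norms of the two
  kinds of kernels: the first acts on \<open>f\<close> at low frequencies, the second on
  \<open>top_op j f\<close> at high ones.\<close>

definition A :: "'n multi_index \<Rightarrow> real" where
  "A \<alpha> = (\<integral>z. norm (fourier (\<lambda>\<xi>. of_real (mi_power \<xi> \<alpha>) * E \<xi>) z) \<partial>lborel)"

definition B :: "'n multi_index \<Rightarrow> nat \<Rightarrow> real" where
  "B \<alpha> j = (\<integral>z. norm (fourier (\<lambda>\<xi>. (of_real (mi_power \<xi> \<alpha>) * cnj (P j \<xi>)) * E \<xi>) z) \<partial>lborel)"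

lemma A_nonneg: "0 \<le> A \<alpha>" and B_nonneg: "0 \<le> B \<alpha> j"
  by (simp_all add: A_def B_def)

text \<open>The monomial is homogeneous, so writing it as a function of \<open>\<tau> \<xi>\<close>
  costs exactly \<open>mi_size \<alpha>\<close> negative powers of \<tau>.\<close>

lemma low_frequency_bound:
  fixes \<tau> :: real
  assumes f: "f \<in> test_functions" and \<tau>: "0 < \<tau>"
  shows "norm (\<integral>\<xi>. E (\<tau> *\<^sub>R \<xi>) * (cis (x \<bullet> \<xi>) * fourier (D \<alpha> f) (- \<xi>)) \<partial>lborel) \<le> A \<alpha> / \<tau> ^ mi_size \<alpha> * supnorm f"
proof -
  let ?g = "\<lambda>\<xi>. of_real (mi_power \<xi> \<alpha>) * E \<xi>"
  have "(\<lambda>\<xi>. E (\<tau> *\<^sub>R \<xi>) * (cis (x \<bullet> \<xi>) * fourier (D \<alpha> f) (- \<xi>)))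
      = (\<lambda>\<xi>. of_real (1 / \<tau> ^ mi_size \<alpha>) * (?g (\<tau> *\<^sub>R \<xi>) * cis (x \<bullet> \<xi>) * fourier f (- \<xi>)))"
    using \<tau> by (simp add: fourier_D test_functions_smooth_L1 f mi_power_scaleR fun_eq_iff)
  then have "norm (\<integral>\<xi>. E (\<tau> *\<^sub>R \<xi>) * (cis (x \<bullet> \<xi>) * fourier (D \<alpha> f) (- \<xi>)) \<partial>lborel)
      = 1 / \<tau> ^ mi_size \<alpha> * norm (\<integral>\<xi>. ?g (\<tau> *\<^sub>R \<xi>) * cis (x \<bullet> \<xi>) * fourier f (- \<xi>) \<partial>lborel)"
    using \<tau> by (simp only: integral_mult_right_zero norm_mult norm_of_real) simp
  also have "\<dots> \<le> 1 / \<tau> ^ mi_size \<alpha> * (A \<alpha> * supnorm f)"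
    unfolding A_def using \<tau>
    by (intro mult_left_mono fourier_dilated_multiplier_bound poly_E_smooth_L1 mi_power_poly
        test_functions_integrable f test_supnorm) auto
  finally show ?thesis by simp
qed

text \<open>In the sum of \<open>cnj (P j) * P j\<close> that makes up \<open>q\<close>, the factor
  \<open>P j\<close> is passed to \<open>f\<close>, where it forms \<open>top_op j f\<close>. The
  rest, together with the monomial, is homogeneous of degree \<open>mi_size \<alpha> + l\<close>, so
  writing it as a function of \<open>\<tau> \<xi>\<close> uses up that many of the
  \<open>2 * l - 1\<close> powers of \<tau>.\<close>

lemma high_frequency_slice_bound:
  fixes \<tau> :: real
  assumes f: "f \<in> test_functions" and \<tau>: "0 \<le> \<tau>" "\<tau> \<le> 1" and \<alpha>: "mi_size \<alpha> < l"
  shows "norm (\<integral>\<xi>. of_real (2 * l * \<tau> ^ (2 * l - 1) * q \<xi>) * E (\<tau> *\<^sub>R \<xi>) * (cis (x \<bullet> \<xi>) * fourier (D \<alpha> f) (- \<xi>)) \<partial>lborel)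
    \<le> 2 * l * (\<Sum>j=1..N. B \<alpha> j * supnorm (top_op j f))" (is "norm (\<integral>\<xi>. ?F \<xi> \<partial>lborel) \<le> ?R")
\<comment> \<open>At \<open>\<tau> = 0\<close> the dilation is not invertible, but the integrand
  vanishes because \<open>2 * l - 1\<close> is positive.\<close>
proof (cases "\<tau> = 0")
  case True
  have "0 \<le> ?R"
    by (intro mult_nonneg_nonneg sum_nonneg B_nonneg test_supnorm(3) top_op_test f) auto
  with True l_pos show ?thesis by (simp add: power_0_left)
next
  case False
  then have \<tau>pos: "0 < \<tau>" using \<tau> by simp
  let ?g = "\<lambda>j \<xi>. (of_real (mi_power \<xi> \<alpha>) * cnj (P j \<xi>)) * E \<xi>"
  let ?G = "\<lambda>j \<xi>. ?g j (\<tau> *\<^sub>R \<xi>) * cis (x \<bullet> \<xi>) * fourier (top_op j f) (- \<xi>)"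
  define s where "s = 2 * l * \<tau> ^ (l - 1 - mi_size \<alpha>)"
  have pw: "\<tau> ^ (2 * l - 1) = \<tau> ^ (l - 1 - mi_size \<alpha>) * (\<tau> ^ mi_size \<alpha> * \<tau> ^ l)"
    using \<alpha> by (simp flip: power_add) (rule arg_cong[where f = "\<lambda>m. \<tau> ^ m"], linarith)
  have F: "?F = (\<lambda>\<xi>. of_real s * (\<Sum>j=1..N. ?G j \<xi>))"
    unfolding fun_eq_iff of_real_mult of_real_q pw s_def sum_distrib_left sum_distrib_right
    by (auto simp: fourier_D fourier_top_op test_functions_smooth_L1 f mi_power_scaleR principal_symbol_scaleR
        mult_ac intro!: sum.cong)
  have gn: "smooth_L1 (?g j)" for j
    by (intro poly_E_smooth_L1 fun_alg_mult mi_power_poly cnj_poly principal_symbol_poly)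
  have int: "integrable lborel (?G j)" for j
    using \<tau>pos
    by (intro integrable_dilated_multiplier smooth_L1_integrable[OF gn] test_functions_integrable top_op_test f) simp
  have "0 \<le> s" unfolding s_def using \<tau> by simp
  then have "norm (\<integral>\<xi>. ?F \<xi> \<partial>lborel) = s * norm (\<Sum>j=1..N. \<integral>\<xi>. ?G j \<xi> \<partial>lborel)"
    unfolding F using \<tau> int
    by (simp only: integral_mult_right_zero norm_mult norm_of_real Bochner_Integration.integral_sum)
  also have "\<dots> \<le> (2 * l) * (\<Sum>j=1..N. B \<alpha> j * supnorm (top_op j f))"
  proof (intro mult_mono order_trans[OF norm_sum sum_mono])
    show "s \<le> 2 * l" unfolding s_def using \<tau> by (simp add: mult_left_le power_le_one)
    fix j
    show "norm (\<integral>\<xi>. ?G j \<xi> \<partial>lborel) \<le> B \<alpha> j * supnorm (top_op j f)"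
      unfolding B_def
      by (intro fourier_dilated_multiplier_bound gn test_functions_integrable top_op_test f test_supnorm \<tau>pos)
  qed auto
  finally show ?thesis .
qed


text \<open>The integrand is the derivative in \<tau> of
  \<open>- exp (- (\<tau> ^ (2 * l) * s))\<close>. With \<open>s = q \<xi>\<close> this writes the
  complement of the low-frequency cut-off as an integral over dilations.\<close>

lemma weighted_slice_integral:
  fixes s \<tau>\<^sub>0 :: real
  assumes "0 \<le> s" "0 \<le> \<tau>\<^sub>0"
  shows "(\<integral>(\<tau>::real). indicator {0..\<tau>\<^sub>0} \<tau> *\<^sub>R ((2 * l * \<tau> ^ (2 * l - 1) * s) * exp (- (\<tau> ^ (2 * l) * s))) \<partial>lborel)
      = 1 - exp (- (\<tau>\<^sub>0 ^ (2 * l) * s))"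
    and "integrable lborel (\<lambda>\<tau>::real. indicator {0..\<tau>\<^sub>0} \<tau> *\<^sub>R ((2 * l * \<tau> ^ (2 * l - 1) * s) * exp (- (\<tau> ^ (2 * l) * s))))"
proof -
  have cont: "continuous_on {0..\<tau>\<^sub>0} (\<lambda>\<tau>::real. (2 * l * \<tau> ^ (2 * l - 1) * s) * exp (- (\<tau> ^ (2 * l) * s)))"
    by (intro continuous_intros)
  have "((\<lambda>\<tau>::real. - exp (- (\<tau> ^ (2 * l) * s))) has_real_derivative (2 * l * \<tau> ^ (2 * l - 1) * s) * exp (- (\<tau> ^ (2 * l) * s))) (at \<tau>)" for \<tau> :: real
    by (auto intro!: derivative_eq_intros)
  then have "((\<lambda>\<tau>::real. - exp (- (\<tau> ^ (2 * l) * s))) has_vector_derivative (2 * l * \<tau> ^ (2 * l - 1) * s) * exp (- (\<tau> ^ (2 * l) * s))) (at \<tau> within {0..\<tau>\<^sub>0})" for \<tau> :: real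
    using has_real_derivative_iff_has_vector_derivative has_vector_derivative_at_within by blast
  from integral_FTC_Icc[OF assms(2) this cont]
  show "(\<integral>(\<tau>::real). indicator {0..\<tau>\<^sub>0} \<tau> *\<^sub>R ((2 * l * \<tau> ^ (2 * l - 1) * s) * exp (- (\<tau> ^ (2 * l) * s))) \<partial>lborel)
      = 1 - exp (- (\<tau>\<^sub>0 ^ (2 * l) * s))"
    using l_pos by (simp add: power_0_left)
  show "integrable lborel (\<lambda>\<tau>::real. indicator {0..\<tau>\<^sub>0} \<tau> *\<^sub>R ((2 * l * \<tau> ^ (2 * l - 1) * s) * exp (- (\<tau> ^ (2 * l) * s))))"
    using borel_integrable_compact[OF compact_Icc cont] by (simp add: set_integrable_def)
qed

text \<open>By the identity for \<open>1 - exp (- \<tau>\<^sub>0\<^bsup>2l\<^esup> q)\<close>, the high frequencies are a superposition of dilates of fixed kernels,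
  with weight \<open>2 l \<tau>\<^bsup>l - 1 - |\<alpha>|\<^esup>\<close>. This is bounded precisely because \<open>|\<alpha>| < l\<close>.\<close>

lemma high_frequency_bound:
  fixes \<tau>\<^sub>0 :: real
  assumes f: "f \<in> test_functions" and \<tau>: "0 < \<tau>\<^sub>0" "\<tau>\<^sub>0 \<le> 1" and \<alpha>: "mi_size \<alpha> < l"
  shows "norm (\<integral>\<xi>. (1 - E (\<tau>\<^sub>0 *\<^sub>R \<xi>)) * (cis (x \<bullet> \<xi>) * fourier (D \<alpha> f) (- \<xi>)) \<partial>lborel)
    \<le> \<tau>\<^sub>0 * (2 * l * (\<Sum>j=1..N. B \<alpha> j * supnorm (top_op j f)))"
proof -
  let ?k = "\<lambda>(\<tau>::real) \<xi>. indicator {0..\<tau>\<^sub>0} \<tau> *\<^sub>R ((2 * l * \<tau> ^ (2 * l - 1) * q \<xi>) * exp (- (\<tau> ^ (2 * l) * q \<xi>)))"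
  let ?h = "\<lambda>\<xi>. cis (x \<bullet> \<xi>) * fourier (D \<alpha> f) (- \<xi>)"
  define R where "R = 2 * l * (\<Sum>j=1..N. B \<alpha> j * supnorm (top_op j f))"
  have nD: "smooth_L1 (D \<alpha> f)" by (intro test_functions_smooth_L1 test_functions_D f)
  have [measurable]: "q \<in> borel_measurable borel" "D \<alpha> f \<in> borel_measurable borel"
    by (intro borel_measurable_continuous_onI q_continuous smooth_measurable smooth_L1_smooth nD)+
  have [measurable]: "fourier (D \<alpha> f) \<in> borel_measurable borel" by measurable
  have inth: "integrable lborel ?h" by (rule integrable_cis_fourier[OF nD])
  define H where "H \<xi> \<tau> = of_real (?k \<tau> \<xi>) * ?h \<xi>" for \<xi> \<tau>
  have knn: "0 \<le> ?k \<tau> \<xi>" for \<tau> \<xi> by (simp add: indicator_def q_nonneg)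
  have normH: "norm (H \<xi> \<tau>) = ?k \<tau> \<xi> * norm (?h \<xi>)" for \<xi> \<tau>
    unfolding H_def norm_mult norm_of_real using knn by (simp only: abs_of_nonneg)
  have E\<tau>: "exp (- (\<tau> ^ (2 * l) * q \<xi>)) = exp (- q (\<tau> *\<^sub>R \<xi>))" for \<tau> \<xi> by (simp add: q_scaleR)
  have intk: "integrable lborel (\<lambda>\<tau>::real. ?k \<tau> \<xi>)" "(\<integral>(\<tau>::real). ?k \<tau> \<xi> \<partial>lborel) = 1 - exp (- q (\<tau>\<^sub>0 *\<^sub>R \<xi>))" for \<xi>
    using weighted_slice_integral[OF q_nonneg, of \<tau>\<^sub>0 \<xi>] \<tau> by (simp_all add: E\<tau>)
  have "integrable (lborel \<Otimes>\<^sub>M lborel) (case_prod H)"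
  proof (rule lborel_pair.Fubini_integrable)
    show "case_prod H \<in> borel_measurable (lborel \<Otimes>\<^sub>M lborel)" unfolding H_def by measurable
    \<comment> \<open>The weight is nonnegative and integrates over \<tau> to a number between 0 and
      1; this gives the integrability that Fubini requires.\<close>
    have "(\<lambda>\<xi>. \<integral>(\<tau>::real). norm (case (\<xi>, \<tau>) of (\<xi>, \<tau>) \<Rightarrow> H \<xi> \<tau>) \<partial>lborel) = (\<lambda>\<xi>. (1 - exp (- q (\<tau>\<^sub>0 *\<^sub>R \<xi>))) * norm (?h \<xi>))"
      unfolding split_conv normH integral_mult_left_zero intk(2) ..
    moreover have "integrable lborel (\<lambda>\<xi>. (1 - exp (- q (\<tau>\<^sub>0 *\<^sub>R \<xi>))) * norm (?h \<xi>))"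
    proof (rule Bochner_Integration.integrable_bound[OF integrable_norm[OF inth]])
      have "\<bar>1 - exp (- q (\<tau>\<^sub>0 *\<^sub>R \<xi>))\<bar> \<le> 1" for \<xi> using q_nonneg by simp
      then show "AE \<xi> in lborel. norm ((1 - exp (- q (\<tau>\<^sub>0 *\<^sub>R \<xi>))) * norm (?h \<xi>)) \<le> norm (norm (?h \<xi>))"
        by (simp add: abs_mult mult_left_le_one_le)
    qed measurable
    ultimately show "integrable lborel (\<lambda>\<xi>. \<integral>(\<tau>::real). norm (case (\<xi>, \<tau>) of (\<xi>, \<tau>) \<Rightarrow> H \<xi> \<tau>) \<partial>lborel)"
      by simp
    show "AE \<xi> in lborel. integrable lborel (\<lambda>\<tau>::real. case (\<xi>, \<tau>) of (\<xi>, \<tau>) \<Rightarrow> H \<xi> \<tau>)"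
      unfolding split_conv H_def by (intro AE_I2 integrable_mult_left integrable_of_real intk)
  qed
  then have "(\<integral>(\<tau>::real). (\<integral>\<xi>. H \<xi> \<tau> \<partial>lborel) \<partial>lborel) = (\<integral>\<xi>. (\<integral>(\<tau>::real). H \<xi> \<tau> \<partial>lborel) \<partial>lborel)"
      and int\<tau>: "integrable lborel (\<lambda>\<tau>::real. \<integral>\<xi>. H \<xi> \<tau> \<partial>lborel)"
    by (rule lborel_pair.Fubini_integral, rule lborel_pair.integrable_snd)
  moreover have "(\<integral>(\<tau>::real). H \<xi> \<tau> \<partial>lborel) = (1 - E (\<tau>\<^sub>0 *\<^sub>R \<xi>)) * ?h \<xi>" for \<xi>
  proof -
    have "(\<integral>(\<tau>::real). complex_of_real (?k \<tau> \<xi>) \<partial>lborel) = of_real (1 - exp (- q (\<tau>\<^sub>0 *\<^sub>R \<xi>)))"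
      unfolding intk(2)[symmetric] by (rule integral_complex_of_real)
    then show ?thesis unfolding H_def integral_mult_left_zero by (simp only: E_def of_real_diff of_real_1)
  qed
  ultimately have eq: "(\<integral>\<xi>. (1 - E (\<tau>\<^sub>0 *\<^sub>R \<xi>)) * ?h \<xi> \<partial>lborel) = (\<integral>(\<tau>::real). (\<integral>\<xi>. H \<xi> \<tau> \<partial>lborel) \<partial>lborel)"
    by simp
  have slice: "norm (\<integral>\<xi>. H \<xi> \<tau> \<partial>lborel) \<le> indicator {0..\<tau>\<^sub>0} \<tau> * R" for \<tau>
  proof (cases "\<tau> \<in> {0..\<tau>\<^sub>0}")
    case True
    then have "(\<lambda>\<xi>. H \<xi> \<tau>) = (\<lambda>\<xi>. of_real (2 * l * \<tau> ^ (2 * l - 1) * q \<xi>) * E (\<tau> *\<^sub>R \<xi>) * ?h \<xi>)"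
      by (simp add: H_def E_def q_scaleR fun_eq_iff)
    with high_frequency_slice_bound[OF f, of \<tau> \<alpha> x] True \<tau> \<alpha> show ?thesis
      by (simp add: R_def)
  qed (simp add: H_def)
  have "norm (\<integral>(\<tau>::real). (\<integral>\<xi>. H \<xi> \<tau> \<partial>lborel) \<partial>lborel) \<le> (\<integral>(\<tau>::real). indicator {0..\<tau>\<^sub>0} \<tau> * R \<partial>lborel)"
  proof (rule order_trans[OF integral_norm_bound Bochner_Integration.integral_mono])
    show "integrable lborel (\<lambda>\<tau>::real. norm (\<integral>\<xi>. H \<xi> \<tau> \<partial>lborel))" using int\<tau> by simp
    show "integrable lborel (\<lambda>\<tau>::real. indicator {0..\<tau>\<^sub>0} \<tau> * R)"
      using \<tau> by (intro integrable_mult_left integrable_real_indicator) auto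
  qed (use slice in auto)
  also have "\<dots> = \<tau>\<^sub>0 * R" using \<tau> by simp
  finally show ?thesis unfolding eq R_def .
qed

lemma derivative_bound:
  fixes \<tau>\<^sub>0 :: real
  assumes f: "f \<in> test_functions" and \<tau>: "0 < \<tau>\<^sub>0" "\<tau>\<^sub>0 \<le> 1" and \<alpha>: "mi_size \<alpha> < l"
  shows "norm \<kappa> * supnorm (D \<alpha> f)
    \<le> A \<alpha> / \<tau>\<^sub>0 ^ mi_size \<alpha> * supnorm f + \<tau>\<^sub>0 * (2 * l * (\<Sum>j=1..N. B \<alpha> j * supnorm (top_op j f)))"
    (is "_ \<le> ?R")
proof -
  have Df: "D \<alpha> f \<in> test_functions" by (intro test_functions_D f)
  have "norm \<kappa> * norm (D \<alpha> f x) \<le> ?R" for x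
  proof -
    let ?h = "\<lambda>\<xi>. cis (x \<bullet> \<xi>) * fourier (D \<alpha> f) (- \<xi>)"
    have inth: "integrable lborel ?h" by (rule integrable_cis_fourier[OF test_functions_smooth_L1[OF Df]])
    have intE: "integrable lborel (\<lambda>\<xi>. E (\<tau>\<^sub>0 *\<^sub>R \<xi>) * ?h \<xi>)"
      using integrable_dilated_multiplier[OF smooth_L1_integrable[OF E_smooth_L1] test_functions_integrable[OF Df], of \<tau>\<^sub>0 x] \<tau>
      by (simp add: mult.assoc)
    have "\<kappa> * D \<alpha> f x = (\<integral>\<xi>. ?h \<xi> \<partial>lborel)" by (rule inversion[OF Df, symmetric])
    also have "\<dots> = (\<integral>\<xi>. E (\<tau>\<^sub>0 *\<^sub>R \<xi>) * ?h \<xi> + (1 - E (\<tau>\<^sub>0 *\<^sub>R \<xi>)) * ?h \<xi> \<partial>lborel)"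
      by (simp add: algebra_simps)
    also have "\<dots> = (\<integral>\<xi>. E (\<tau>\<^sub>0 *\<^sub>R \<xi>) * ?h \<xi> \<partial>lborel) + (\<integral>\<xi>. (1 - E (\<tau>\<^sub>0 *\<^sub>R \<xi>)) * ?h \<xi> \<partial>lborel)"
    proof (rule Bochner_Integration.integral_add[OF intE])
      show "integrable lborel (\<lambda>\<xi>. (1 - E (\<tau>\<^sub>0 *\<^sub>R \<xi>)) * ?h \<xi>)"
        using Bochner_Integration.integrable_diff[OF inth intE] by (simp add: algebra_simps)
    qed
    finally have "norm \<kappa> * norm (D \<alpha> f x) = norm \<dots>" by (simp flip: norm_mult)
    also have "\<dots> \<le> ?R"
      by (intro order_trans[OF norm_triangle_ineq] add_mono low_frequency_bound high_frequency_bound f \<tau> \<alpha>)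
    finally show ?thesis .
  qed
  then have "norm (D \<alpha> f x) \<le> ?R / norm \<kappa>" for x
    using \<kappa>_nonzero by (simp add: pos_le_divide_eq mult.commute)
  then have "supnorm (D \<alpha> f) \<le> ?R / norm \<kappa>" by (rule supnorm_least)
  then show ?thesis using \<kappa>_nonzero by (simp add: pos_le_divide_eq mult.commute)
qed


text \<open>Let \<open>X\<close> be the sum of all norms to be estimated. Principal parts differ
  from the full operators by at most \<open>M * X\<close>, so \<open>X\<close> returns on the right
  with the factor \<open>\<tau> * (b * M)\<close>. As \<tau> is at hand, this factor can be made
  small enough to be absorbed.\<close>

lemma coercive:
  "\<exists>C1 C2. \<forall>f\<in>test_functions. (\<Sum>\<alpha> | mi_size \<alpha> < l. supnorm (D \<alpha> f))
     \<le> C1 * (\<Sum>j=1..N. supnorm (diff_op l (a j) f)) + C2 * supnorm f"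
proof -
  let ?I = "{\<alpha> :: 'n multi_index. mi_size \<alpha> < l}"
  note finI = finite_mi_size_less[of l]
  define M where "M = (\<Sum>j=1..N. \<Sum>\<beta>\<in>?I. norm (a j \<beta>))"
  define b where "b = 2 * real l * (\<Sum>\<alpha>\<in>?I. \<Sum>j=1..N. B \<alpha> j)"
  have M: "0 \<le> M" and b: "0 \<le> b"
    by (auto simp: M_def b_def intro!: sum_nonneg mult_nonneg_nonneg B_nonneg)
  \<comment> \<open>Chosen so that \<open>\<tau> * (b * M)\<close> is at most half of
    \<open>norm \<kappa>\<close>; the \<open>+ 1\<close> keeps the denominator positive.\<close>
  define \<tau> where "\<tau> = min 1 (norm \<kappa> / (2 * (b * M + 1)))"
  have bM: "0 \<le> b * M" using M b by simp
  have \<tau>: "0 < \<tau>" "\<tau> \<le> 1" using \<kappa>_nonzero bM by (auto simp: \<tau>_def)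
  have "\<tau> * (b * M) \<le> norm \<kappa> / (2 * (b * M + 1)) * (b * M + 1)"
    using bM by (intro mult_mono) (auto simp: \<tau>_def)
  also have "\<dots> = norm \<kappa> / 2" using bM by (simp add: field_simps)
  finally have \<tau>bM: "\<tau> * (b * M) \<le> norm \<kappa> / 2" .
  define A' where "A' = (\<Sum>\<alpha>\<in>?I. A \<alpha> / \<tau> ^ mi_size \<alpha>)"
  show ?thesis
  proof (intro exI ballI)
    fix f :: "real^'n \<Rightarrow> complex" assume f: "f \<in> test_functions"
    define X where "X = (\<Sum>\<alpha>\<in>?I. supnorm (D \<alpha> f))"
    define S where "S = (\<Sum>j=1..N. supnorm (diff_op l (a j) f))"
    note nn = test_supnorm(3)[OF test_functions_D[OF f]]
    note nnP = test_supnorm(3)[OF test_functions_diff_op[OF f]]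
    have X0: "0 \<le> X" and S0: "0 \<le> S" unfolding X_def S_def by (intro sum_nonneg nn nnP)+
    have top: "supnorm (top_op j f) \<le> S + M * X" if j: "j \<in> {1..N}" for j
    proof (rule supnorm_least)
      fix x
      have "{\<beta> :: 'n multi_index. mi_size \<beta> \<le> l} = {\<beta>. mi_size \<beta> = l} \<union> ?I" by auto
      then have "diff_op l (a j) f x = top_op j f x + (\<Sum>\<beta>\<in>?I. a j \<beta> * D \<beta> f x)"
        unfolding diff_op_def top_op_def by (subst sum.union_disjoint[symmetric]) (auto simp: finite_mi_size_eq finI)
      then have "norm (top_op j f x) \<le> norm (diff_op l (a j) f x) + norm (\<Sum>\<beta>\<in>?I. a j \<beta> * D \<beta> f x)"
        using norm_triangle_ineq4[of "diff_op l (a j) f x" "\<Sum>\<beta>\<in>?I. a j \<beta> * D \<beta> f x"] by simp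
      also have "\<dots> \<le> S + M * X"
      proof (rule add_mono)
        have "norm (diff_op l (a j) f x) \<le> supnorm (diff_op l (a j) f)"
          by (rule test_supnorm(2)[OF test_functions_diff_op[OF f]])
        also have "\<dots> \<le> S" unfolding S_def using j nnP by (intro member_le_sum) auto
        finally show "norm (diff_op l (a j) f x) \<le> S" .
        have "norm (\<Sum>\<beta>\<in>?I. a j \<beta> * D \<beta> f x) \<le> (\<Sum>\<beta>\<in>?I. norm (a j \<beta>) * X)"
        proof (intro order_trans[OF norm_sum sum_mono])
          fix \<beta> assume \<beta>: "\<beta> \<in> ?I"
          have "norm (D \<beta> f x) \<le> supnorm (D \<beta> f)"
            by (rule test_supnorm(2)[OF test_functions_D[OF f]])
          also have "\<dots> \<le> X" unfolding X_def using \<beta> nn finI by (intro member_le_sum) auto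
          finally show "norm (a j \<beta> * D \<beta> f x) \<le> norm (a j \<beta>) * X"
            by (simp add: norm_mult mult_left_mono)
        qed
        also have "\<dots> = (\<Sum>\<beta>\<in>?I. norm (a j \<beta>)) * X" by (simp add: sum_distrib_right)
        also have "\<dots> \<le> M * X"
        proof (rule mult_right_mono[OF _ X0])
          show "(\<Sum>\<beta>\<in>?I. norm (a j \<beta>)) \<le> M"
            unfolding M_def
            by (rule member_le_sum[where f = "\<lambda>j. \<Sum>\<beta>\<in>?I. norm (a j \<beta>)"]) (use j in \<open>auto intro: sum_nonneg\<close>)
        qed
        finally show "norm (\<Sum>\<beta>\<in>?I. a j \<beta> * D \<beta> f x) \<le> M * X" .
      qed
      finally show "norm (top_op j f x) \<le> S + M * X" .
    qed
    have "norm \<kappa> * X = (\<Sum>\<alpha>\<in>?I. norm \<kappa> * supnorm (D \<alpha> f))" by (simp add: X_def sum_distrib_left)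
    also have "\<dots> \<le> (\<Sum>\<alpha>\<in>?I. A \<alpha> / \<tau> ^ mi_size \<alpha> * supnorm f + \<tau> * (2 * l * (\<Sum>j=1..N. B \<alpha> j * (S + M * X))))"
    proof (intro sum_mono)
      fix \<alpha> assume "\<alpha> \<in> ?I"
      then have "norm \<kappa> * supnorm (D \<alpha> f)
          \<le> A \<alpha> / \<tau> ^ mi_size \<alpha> * supnorm f + \<tau> * (2 * l * (\<Sum>j=1..N. B \<alpha> j * supnorm (top_op j f)))"
        using derivative_bound[OF f \<tau>] by simp
      also have "\<dots> \<le> A \<alpha> / \<tau> ^ mi_size \<alpha> * supnorm f + \<tau> * (2 * l * (\<Sum>j=1..N. B \<alpha> j * (S + M * X)))"
        using \<tau> by (intro add_left_mono mult_left_mono sum_mono top B_nonneg) auto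
      finally show "norm \<kappa> * supnorm (D \<alpha> f) \<le> \<dots>" .
    qed
    also have "\<dots> = A' * supnorm f + \<tau> * (b * (S + M * X))"
      by (simp add: A'_def b_def sum.distrib sum_distrib_left sum_distrib_right mult.assoc)
    also have "\<dots> = A' * supnorm f + \<tau> * (b * S) + (\<tau> * (b * M)) * X" by (simp add: algebra_simps)
    also have "\<dots> \<le> A' * supnorm f + 1 * (b * S) + norm \<kappa> / 2 * X"
      using \<tau> \<tau>bM X0 S0 b test_supnorm(3)[OF f] by (intro add_mono mult_right_mono) auto
    finally have "norm \<kappa> / 2 * X \<le> A' * supnorm f + b * S" by simp
    then have "X \<le> (A' * supnorm f + b * S) / (norm \<kappa> / 2)"
      using \<kappa>_nonzero by (subst pos_le_divide_eq) (auto simp: mult.commute)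
    also have "\<dots> = (2 * b / norm \<kappa>) * S + (2 * A' / norm \<kappa>) * supnorm f"
      using \<kappa>_nonzero by (simp add: field_simps)
    finally show "X \<le> (2 * b / norm \<kappa>) * S + (2 * A' / norm \<kappa>) * supnorm f" .
  qed
qed

end

lemma elliptic_imp_weakly_coercive:
  assumes "0 < l" "elliptic l N a"
  shows "weakly_coercive_Linf l N a"
  unfolding weakly_coercive_iff_supnorm
  by (rule elliptic_system.coercive) (use assms in \<open>simp add: elliptic_system_def\<close>)

section \<open>Finite combinations of evaluations\<close>

text \<open>Such a functional stands for a finite trigonometric sum. Applied to
  \<open>cis (\<zeta> \<bullet> x)\<close>, to this times a symbol, or to a monomial, it gives the
  sum itself, its image under an operator, or a derivative at 0. The field is left open because real
  linear forms are interpolated as well.\<close>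

inductive_set eval_span :: "'v set \<Rightarrow> (('v \<Rightarrow> 'a::field) \<Rightarrow> 'a) set" for X where
  eval_span_zero: "(\<lambda>h. 0) \<in> eval_span X"
| eval_span_ev: "\<xi> \<in> X \<Longrightarrow> (\<lambda>h. h \<xi>) \<in> eval_span X"
| eval_span_add: "\<Phi> \<in> eval_span X \<Longrightarrow> \<Psi> \<in> eval_span X \<Longrightarrow> (\<lambda>h. \<Phi> h + \<Psi> h) \<in> eval_span X"
| eval_span_cmult: "\<Phi> \<in> eval_span X \<Longrightarrow> (\<lambda>h. c * \<Phi> h) \<in> eval_span X"

lemma eval_span_sum:
  "(\<And>i. i \<in> I \<Longrightarrow> \<Phi> i \<in> eval_span X) \<Longrightarrow> (\<lambda>h. \<Sum>i\<in>I. \<Phi> i h) \<in> eval_span X"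
  by (induction I rule: infinite_finite_induct) (simp_all add: eval_span_zero eval_span_add)

lemma eval_span_finite_sum:
  assumes "\<Phi> \<in> eval_span X"
  shows "\<exists>A d. finite A \<and> A \<subseteq> X \<and> (\<forall>h. \<Phi> h = (\<Sum>\<xi>\<in>A. d \<xi> * h \<xi>))"
  using assms
proof induction
  case eval_span_zero
  show ?case by (intro exI[of _ "{}"]) simp
next
  case (eval_span_ev \<xi>)
  then show ?case by (intro exI[of _ "{\<xi>}"] exI[of _ "\<lambda>_. 1"]) simp
next
  case (eval_span_add \<Phi> \<Psi>)
  then obtain A d B e where A: "finite A" "A \<subseteq> X" "\<And>h. \<Phi> h = (\<Sum>\<xi>\<in>A. d \<xi> * h \<xi>)"
    and B: "finite B" "B \<subseteq> X" "\<And>h. \<Psi> h = (\<Sum>\<xi>\<in>B. e \<xi> * h \<xi>)" by auto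
  let ?f = "\<lambda>\<xi>. (if \<xi> \<in> A then d \<xi> else 0) + (if \<xi> \<in> B then e \<xi> else 0)"
  have "\<Phi> h + \<Psi> h = (\<Sum>\<xi>\<in>A \<union> B. ?f \<xi> * h \<xi>)" for h
  proof -
    have "(\<Sum>\<xi>\<in>A. d \<xi> * h \<xi>) = (\<Sum>\<xi>\<in>A \<union> B. (if \<xi> \<in> A then d \<xi> else 0) * h \<xi>)"
      using A B by (intro sum.mono_neutral_cong_left) auto
    moreover have "(\<Sum>\<xi>\<in>B. e \<xi> * h \<xi>) = (\<Sum>\<xi>\<in>A \<union> B. (if \<xi> \<in> B then e \<xi> else 0) * h \<xi>)"
      using A B by (intro sum.mono_neutral_cong_left) auto
    ultimately show ?thesis by (simp add: A(3) B(3) distrib_right sum.distrib)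
  qed
  then show ?case using A B by (intro exI[of _ "A \<union> B"] exI[of _ ?f]) auto
next
  case (eval_span_cmult \<Phi> c)
  then obtain A d where A: "finite A" "A \<subseteq> X" "\<And>h. \<Phi> h = (\<Sum>\<xi>\<in>A. d \<xi> * h \<xi>)" by auto
  then show ?case by (intro exI[of _ A] exI[of _ "\<lambda>\<xi>. c * d \<xi>"]) (simp add: sum_distrib_left mult.assoc)
qed

section \<open>The coercivity estimate for trigonometric sums\<close>

lemma cis_inner_has_pd:
  "has_pd k (\<lambda>x. cis (\<zeta> \<bullet> x)) (\<lambda>x. \<i> * of_real (\<zeta> $ k) * cis (\<zeta> \<bullet> x))"
proof -
  have "has_pd k (\<lambda>x. \<i> * of_real (\<zeta> \<bullet> x)) (\<lambda>_. \<i> * of_real (\<zeta> $ k))"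
    unfolding has_pd_def has_vector_derivative_complex_iff
    by (auto intro!: derivative_eq_intros simp: inner_add_right inner_axis)
  from has_pd_exp[OF this] show ?thesis by (simp add: cis_conv_exp)
qed

lemma cis_inner_smooth: "smooth (\<lambda>x. cis (\<zeta> \<bullet> x))"
proof (rule fun_alg_smooth[where B = "{\<lambda>x. cis (\<zeta> \<bullet> x)}"])
  let ?B = "{\<lambda>x. cis (\<zeta> \<bullet> x)}"
  show "(\<lambda>x. cis (\<zeta> \<bullet> x)) \<in> fun_alg ?B" by (simp add: fun_alg_base)
  show "continuous_on UNIV f" if "f \<in> ?B" for f
    using that by (auto intro!: continuous_on_cis continuous_intros)
  show "\<exists>f'\<in>fun_alg ?B. has_pd k f f'" if "f \<in> ?B" for f k
    using that by (intro bexI[where x = "\<lambda>x. \<i> * of_real (\<zeta> $ k) * cis (\<zeta> \<bullet> x)"] fun_alg_cmult fun_alg_base)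
      (auto simp: cis_inner_has_pd)
qed

lemma D1_cis_mult:
  assumes "smooth g"
  shows "D1 k (\<lambda>x. cis (\<zeta> \<bullet> x) * g x) = (\<lambda>x. of_real (\<zeta> $ k) * (cis (\<zeta> \<bullet> x) * g x) + cis (\<zeta> \<bullet> x) * D1 k g x)"
  unfolding D1_mult[OF cis_inner_smooth assms] D1_has_pd[OF cis_inner_has_pd]
  by (simp add: fun_eq_iff algebra_simps)

text \<open>These are the terms in which some derivative has fallen on the cut-off. Each carries a
  factor \<open>1 / R\<close>; a further derivative hits the exponential or gains another such
  factor, so the class is closed under \<open>D1\<close>.\<close>

inductive_set cutoff_err :: "real^'n::finite \<Rightarrow> (real \<Rightarrow> real^'n \<Rightarrow> complex) set" for \<zeta> where
  err_base: "\<psi> \<in> test_functions \<Longrightarrow> (\<lambda>R x. of_real (1 / R) * (cis (\<zeta> \<bullet> x) * \<psi> ((1 / R) *\<^sub>R x))) \<in> cutoff_err \<zeta>"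
| err_add: "\<Phi> \<in> cutoff_err \<zeta> \<Longrightarrow> \<Psi> \<in> cutoff_err \<zeta> \<Longrightarrow> (\<lambda>R x. \<Phi> R x + \<Psi> R x) \<in> cutoff_err \<zeta>"
| err_cmult: "\<Phi> \<in> cutoff_err \<zeta> \<Longrightarrow> (\<lambda>R x. c * \<Phi> R x) \<in> cutoff_err \<zeta>"
| err_shrink: "\<Phi> \<in> cutoff_err \<zeta> \<Longrightarrow> (\<lambda>R x. of_real (1 / R) * \<Phi> R x) \<in> cutoff_err \<zeta>"

lemma cutoff_err_smooth: "\<Phi> \<in> cutoff_err \<zeta> \<Longrightarrow> smooth (\<Phi> R)"
proof (induction rule: cutoff_err.induct)
  case (err_base \<psi>)
  show ?case
    by (intro smooth_cmult smooth_mult[OF cis_inner_smooth] smooth_scale test_functions_smooth err_base)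
next
  case (err_add \<Phi> \<Psi>)
  then show ?case by (intro smooth_add)
qed (rule smooth_cmult, assumption)+

lemma cutoff_err_D1: "\<Phi> \<in> cutoff_err \<zeta> \<Longrightarrow> (\<lambda>R. D1 k (\<Phi> R)) \<in> cutoff_err \<zeta>"
proof (induction rule: cutoff_err.induct)
  case (err_base \<psi>)
  let ?u = "\<lambda>R x. cis (\<zeta> \<bullet> x) * \<psi> ((1 / R) *\<^sub>R x)"
  let ?v = "\<lambda>R x. cis (\<zeta> \<bullet> x) * D1 k \<psi> ((1 / R) *\<^sub>R x)"
  have \<psi>: "smooth \<psi>" using err_base by (rule test_functions_smooth)
  have "D1 k (\<lambda>x. of_real (1 / R) * ?u R x)
      = (\<lambda>x. of_real (\<zeta> $ k) * (of_real (1 / R) * ?u R x) + of_real (1 / R) * (of_real (1 / R) * ?v R x))" for R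
    by (subst D1_cmult[OF smooth_mult[OF cis_inner_smooth smooth_scale[OF \<psi>]]], subst D1_cis_mult[OF smooth_scale[OF \<psi>]],
        subst D1_scale[OF \<psi>]) (simp add: fun_eq_iff algebra_simps)
  then show ?case
    using cutoff_err.err_add[OF cutoff_err.err_cmult[OF cutoff_err.err_base[OF err_base]]
        cutoff_err.err_shrink[OF cutoff_err.err_base[OF test_functions_D1[OF err_base]]]]
    by simp
next
  case (err_add \<Phi> \<Psi>)
  then show ?case
    using cutoff_err.err_add[OF err_add.IH] by (simp add: D1_add cutoff_err_smooth)
next
  case (err_cmult \<Phi> c)
  then show ?case
    using cutoff_err.err_cmult[OF err_cmult.IH] by (simp add: D1_cmult cutoff_err_smooth)
next
  case (err_shrink \<Phi>)
  then show ?case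
    using cutoff_err.err_shrink[OF err_shrink.IH] by (simp only: D1_cmult cutoff_err_smooth)
qed

lemma cutoff_err_bound: "\<Phi> \<in> cutoff_err \<zeta> \<Longrightarrow> \<exists>C. \<forall>R\<ge>1. \<forall>x. norm (\<Phi> R x) \<le> C / R"
proof (induction rule: cutoff_err.induct)
  case (err_base \<psi>)
  obtain B where B: "\<And>x. norm (\<psi> x) \<le> B" using test_functions_bounded[OF err_base] by auto
  have "norm (of_real (1 / R) * (cis (\<zeta> \<bullet> x) * \<psi> ((1 / R) *\<^sub>R x))) \<le> B / R" if "R \<ge> 1" for R x
    using B[of "(1 / R) *\<^sub>R x"] that by (simp add: norm_mult norm_divide divide_right_mono)
  then show ?case by blast
next
  case (err_add \<Phi> \<Psi>)
  then obtain C D where C: "\<forall>R\<ge>1. \<forall>x. norm (\<Phi> R x) \<le> C / R" and D: "\<forall>R\<ge>1. \<forall>x. norm (\<Psi> R x) \<le> D / R" by blast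
  have "norm (\<Phi> R x + \<Psi> R x) \<le> (C + D) / R" if "R \<ge> 1" for R x
    unfolding add_divide_distrib using C D that by (intro order_trans[OF norm_triangle_ineq] add_mono) auto
  then show ?case by blast
next
  case (err_cmult \<Phi> c)
  then obtain C where C: "\<forall>R\<ge>1. \<forall>x. norm (\<Phi> R x) \<le> C / R" by blast
  have "norm (c * \<Phi> R x) \<le> (norm c * C) / R" if "R \<ge> 1" for R x
    using C that mult_left_mono[OF _ norm_ge_zero, of "norm (\<Phi> R x)" "C / R" c] by (simp add: norm_mult)
  then show ?case by blast
next
  case (err_shrink \<Phi>)
  then obtain C where C: "\<forall>R\<ge>1. \<forall>x. norm (\<Phi> R x) \<le> C / R" by blast
  have "norm (of_real (1 / R) * \<Phi> R x) \<le> C / R" if "R \<ge> 1" for R x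
  proof -
    have "norm (of_real (1 / R) * \<Phi> R x) = 1 / R * norm (\<Phi> R x)"
      using that by (simp add: norm_mult norm_divide)
    also have "\<dots> \<le> 1 * norm (\<Phi> R x)" using that by (intro mult_right_mono) auto
    also have "\<dots> \<le> C / R" using C that by simp
    finally show ?thesis .
  qed
  then show ?case by blast
qed

text \<open>When all derivatives fall on the exponential, the result is the monomial times the
  function; every other Leibniz term lies in \<open>cutoff_err\<close>.\<close>

lemma D_cutoff_cis:
  assumes "\<psi> \<in> test_functions"
  shows "\<exists>C. \<forall>R\<ge>1. \<forall>x. norm (D \<alpha> (\<lambda>x. cis (\<zeta> \<bullet> x) * \<psi> ((1 / R) *\<^sub>R x)) x
     - of_real (mi_power \<zeta> \<alpha>) * (cis (\<zeta> \<bullet> x) * \<psi> ((1 / R) *\<^sub>R x))) \<le> C / R"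
proof -
  let ?u = "\<lambda>R x. cis (\<zeta> \<bullet> x) * \<psi> ((1 / R) *\<^sub>R x)"
  let ?P = "\<lambda>c G. \<exists>\<Phi>\<in>cutoff_err \<zeta>. G = (\<lambda>R x. c * ?u R x + \<Phi> R x)"
  have \<psi>: "smooth \<psi>" using assms by (rule test_functions_smooth)
  have smu: "smooth (?u R)" for R by (intro smooth_mult[OF cis_inner_smooth] smooth_scale \<psi>)
  have "?P (of_real (mi_power \<zeta> \<alpha>)) (\<lambda>R. D \<alpha> (?u R))"
  proof (rule D_product_family[where P = ?P])
    show "?P 1 ?u"
      using err_cmult[OF err_base[OF assms], of 0] by (intro bexI) auto
    fix k c G assume "?P c G"
    then obtain \<Phi> where \<Phi>: "\<Phi> \<in> cutoff_err \<zeta>" and G: "G = (\<lambda>R x. c * ?u R x + \<Phi> R x)" by blast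
    let ?v = "\<lambda>R x. cis (\<zeta> \<bullet> x) * D1 k \<psi> ((1 / R) *\<^sub>R x)"
    have "D1 k (G R) = (\<lambda>x. (of_real (\<zeta> $ k) * c) * ?u R x + (c * (of_real (1 / R) * ?v R x) + D1 k (\<Phi> R) x))" for R
      unfolding G
      by (subst D1_add[OF smooth_cmult[OF smu] cutoff_err_smooth[OF \<Phi>]], subst D1_cmult[OF smu],
          subst D1_cis_mult[OF smooth_scale[OF \<psi>]], subst D1_scale[OF \<psi>]) (simp add: fun_eq_iff algebra_simps)
    moreover have "(\<lambda>R x. c * (of_real (1 / R) * ?v R x) + D1 k (\<Phi> R) x) \<in> cutoff_err \<zeta>"
      by (rule err_add[OF err_cmult[OF err_base[OF test_functions_D1[OF assms]]] cutoff_err_D1[OF \<Phi>]])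
    ultimately show "?P (of_real (\<zeta> $ k) * c) (\<lambda>R. D1 k (G R))"
      by (intro bexI) auto
  qed
  then obtain \<Phi> where \<Phi>: "\<Phi> \<in> cutoff_err \<zeta>"
      and eq: "(\<lambda>R. D \<alpha> (?u R)) = (\<lambda>R x. of_real (mi_power \<zeta> \<alpha>) * ?u R x + \<Phi> R x)" by blast
  have "D \<alpha> (?u R) x - of_real (mi_power \<zeta> \<alpha>) * ?u R x = \<Phi> R x" for R x
    using fun_cong[OF fun_cong[OF eq, of R], of x] by simp
  then show ?thesis using cutoff_err_bound[OF \<Phi>] by simp
qed

definition symbol :: "nat \<Rightarrow> ('n::finite multi_index \<Rightarrow> complex) \<Rightarrow> real^'n \<Rightarrow> complex" where
  "symbol l p \<xi> = (\<Sum>\<alpha> | mi_size \<alpha> \<le> l. p \<alpha> * of_real (mi_power \<xi> \<alpha>))"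

lemma supnorm_cutoff_le:
  assumes "f \<in> test_functions" "\<And>x. norm (f x - of_real (t x) * u x) \<le> c"
    "\<And>x. 0 \<le> t x \<and> t x \<le> 1" "\<And>x. norm (u x) \<le> b"
  shows "supnorm f \<le> b + c"
proof (rule supnorm_least)
  fix x
  have "norm (f x) \<le> norm (of_real (t x) * u x) + norm (f x - of_real (t x) * u x)"
    using norm_triangle_ineq[of "of_real (t x) * u x" "f x - of_real (t x) * u x"] by simp
  also have "norm (of_real (t x) * u x) \<le> 1 * norm (u x)"
    unfolding norm_mult using assms(3)[of x] by (intro mult_right_mono) auto
  finally show "norm (f x) \<le> b + c" using assms(2)[of x] assms(4)[of x] by simp
qed

text \<open>The derivative is taken at the origin only, and arbitrary upper bounds
  \<open>c j\<close> and \<open>c\<^sub>0\<close> replace suprema, so that no supremum of a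
  trigonometric sum is ever computed.\<close>

definition coercivity_bound :: "nat \<Rightarrow> nat \<Rightarrow> (nat \<Rightarrow> 'n::finite multi_index \<Rightarrow> complex) \<Rightarrow> real \<Rightarrow> bool" where
  "coercivity_bound l N a C \<longleftrightarrow> 0 \<le> C \<and> (\<forall>\<Phi>\<in>eval_span UNIV. \<forall>c c\<^sub>0 \<alpha>. mi_size \<alpha> < l \<longrightarrow>
      (\<forall>j\<in>{1..N}. \<forall>x. norm (\<Phi> (\<lambda>\<zeta>. symbol l (a j) \<zeta> * cis (\<zeta> \<bullet> x))) \<le> c j) \<longrightarrow>
      (\<forall>x. norm (\<Phi> (\<lambda>\<zeta>. cis (\<zeta> \<bullet> x))) \<le> c\<^sub>0) \<longrightarrow>
      norm (\<Phi> (\<lambda>\<zeta>. of_real (mi_power \<zeta> \<alpha>))) \<le> C * ((\<Sum>j=1..N. c j) + c\<^sub>0))"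

text \<open>Multiply the sum by a bump dilated by \<open>R\<close>. As the bump has values between 0
  and 1 and the value 1 at 0, it preserves the derivative at 0 and does not increase suprema, up to
  errors of order \<open>1 / R\<close> that disappear as \<open>R\<close> tends to infinity.\<close>

lemma weakly_coercive_imp_coercivity_bound:
  fixes a :: "nat \<Rightarrow> 'n::finite multi_index \<Rightarrow> complex"
  assumes wc: "weakly_coercive_Linf l N a"
  shows "\<exists>C. coercivity_bound l N a C"
proof -
  obtain C1 C2 where C12: "\<And>f. f \<in> test_functions \<Longrightarrow> (\<Sum>\<alpha> | mi_size \<alpha> < l. supnorm (D \<alpha> f))
        \<le> C1 * (\<Sum>j=1..N. supnorm (diff_op l (a j) f)) + C2 * supnorm f"
    using wc unfolding weakly_coercive_iff_supnorm by blast
  define C where "C = max \<bar>C1\<bar> \<bar>C2\<bar>"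
  have C0: "0 \<le> C" by (simp add: C_def)
  have coer: "supnorm (D \<alpha> f) \<le> C * ((\<Sum>j=1..N. supnorm (diff_op l (a j) f)) + supnorm f)"
    if f: "f \<in> test_functions" and \<alpha>: "mi_size \<alpha> < l" for f \<alpha>
  proof -
    have nn: "0 \<le> (\<Sum>j=1..N. supnorm (diff_op l (a j) f))" "0 \<le> supnorm f"
      by (intro sum_nonneg test_supnorm(3) test_functions_diff_op f)+
    have "supnorm (D \<alpha> f) \<le> (\<Sum>\<alpha> | mi_size \<alpha> < l. supnorm (D \<alpha> f))"
      using \<alpha> test_supnorm(3)[OF test_functions_D[OF f]] by (intro member_le_sum) (auto simp: finite_mi_size_less)
    also have "\<dots> \<le> C * (\<Sum>j=1..N. supnorm (diff_op l (a j) f)) + C * supnorm f"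
      by (rule order_trans[OF C12[OF f]]) (use nn in \<open>intro add_mono mult_right_mono; simp add: C_def\<close>)
    finally show ?thesis by (simp add: distrib_left)
  qed
  obtain \<phi> :: "real^'n \<Rightarrow> real" where test: "(\<lambda>x. complex_of_real (\<phi> x)) \<in> test_functions"
    and \<phi>0: "\<phi> 0 = 1" and \<phi>01: "\<And>x. 0 \<le> \<phi> x \<and> \<phi> x \<le> 1" using exists_bump by auto
  show ?thesis
    unfolding coercivity_bound_def
  proof (intro exI[of _ C] conjI C0 ballI allI impI)
    fix \<Phi> :: "(real^'n \<Rightarrow> complex) \<Rightarrow> complex" and c c\<^sub>0 and \<alpha> :: "'n multi_index"
    assume "\<Phi> \<in> eval_span UNIV" and \<alpha>: "mi_size \<alpha> < l"
      and P: "\<forall>j\<in>{1..N}. \<forall>x. norm (\<Phi> (\<lambda>\<zeta>. symbol l (a j) \<zeta> * cis (\<zeta> \<bullet> x))) \<le> c j"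
      and u: "\<forall>x. norm (\<Phi> (\<lambda>\<zeta>. cis (\<zeta> \<bullet> x))) \<le> c\<^sub>0"
    then obtain I d where I: "finite I" and \<Phi>: "\<And>h. \<Phi> h = (\<Sum>i\<in>I. d i * h i)"
      using eval_span_finite_sum[of \<Phi> UNIV] by auto
    have c: "norm (\<Sum>i\<in>I. d i * symbol l (a j) i * cis (i \<bullet> x)) \<le> c j" if "j \<in> {1..N}" for j x
      using P that unfolding \<Phi> by (simp add: mult.assoc)
    have c0: "norm (\<Sum>i\<in>I. d i * cis (i \<bullet> x)) \<le> c\<^sub>0" for x using u unfolding \<Phi> by simp
    let ?e = "\<lambda>R i x. cis (i \<bullet> x) * complex_of_real (\<phi> ((1 / R) *\<^sub>R x))"
    define W where "W i \<beta> = (SOME W. \<forall>R\<ge>1. \<forall>x. norm (D \<beta> (?e R i) x - of_real (mi_power i \<beta>) * ?e R i x) \<le> W / R)" for i \<beta>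
    have W: "norm (D \<beta> (?e R i) x - of_real (mi_power i \<beta>) * ?e R i x) \<le> W i \<beta> / R" if "R \<ge> 1" for i \<beta> R x
      using someI_ex[OF D_cutoff_cis[OF test, of \<beta> "i"]] that unfolding W_def by simp
    define f where "f R x = (\<Sum>i\<in>I. d i * ?e R i x)" for R x
    have e_test: "?e R i \<in> test_functions" if "R \<ge> 1" for R i
      using that by (intro test_functions_mult[OF cis_inner_smooth] test_functions_scale[OF test]) auto
    have f_test: "f R \<in> test_functions" if "R \<ge> 1" for R
      unfolding f_def[abs_def] using that by (intro test_functions_sum test_functions_cmult e_test)
    define Y where "Y \<beta> = (\<Sum>i\<in>I. norm (d i) * W i \<beta>)" for \<beta>
    have Df: "norm (D \<beta> (f R) x - of_real (\<phi> ((1 / R) *\<^sub>R x)) * (\<Sum>i\<in>I. d i * of_real (mi_power i \<beta>) * cis (i \<bullet> x)))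
        \<le> Y \<beta> / R" if R: "R \<ge> 1" for R x \<beta>
    proof -
      have "D \<beta> (f R) x = (\<Sum>i\<in>I. d i * D \<beta> (?e R i) x)"
        unfolding f_def[abs_def] using D_sum_cmult[OF I test_functions_smooth[OF e_test[OF R]]] by simp
      then have "D \<beta> (f R) x - of_real (\<phi> ((1 / R) *\<^sub>R x)) * (\<Sum>i\<in>I. d i * of_real (mi_power i \<beta>) * cis (i \<bullet> x))
          = (\<Sum>i\<in>I. d i * (D \<beta> (?e R i) x - of_real (mi_power i \<beta>) * ?e R i x))"
        by (simp add: sum_distrib_left sum_subtractf right_diff_distrib mult_ac)
      also have "norm \<dots> \<le> (\<Sum>i\<in>I. norm (d i) * (W i \<beta> / R))"
        by (intro order_trans[OF norm_sum sum_mono]) (simp only: norm_mult, intro mult_left_mono W[OF R] norm_ge_zero)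
      also have "\<dots> = Y \<beta> / R" by (simp add: Y_def sum_divide_distrib)
      finally show ?thesis .
    qed
    define Z where "Z j = (\<Sum>\<beta> | mi_size \<beta> \<le> l. norm (a j \<beta>) * Y \<beta>)" for j
    have Pf: "supnorm (diff_op l (a j) (f R)) \<le> c j + Z j / R" if R: "R \<ge> 1" and j: "j \<in> {1..N}" for R j
    proof (rule supnorm_cutoff_le[OF test_functions_diff_op[OF f_test[OF R]]])
      fix x
      let ?t = "complex_of_real (\<phi> ((1 / R) *\<^sub>R x))"
      show "norm (\<Sum>i\<in>I. d i * symbol l (a j) i * cis (i \<bullet> x)) \<le> c j" using c j by blast
      show "0 \<le> \<phi> ((1 / R) *\<^sub>R x) \<and> \<phi> ((1 / R) *\<^sub>R x) \<le> 1" by (rule \<phi>01)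
      have "(\<Sum>i\<in>I. d i * symbol l (a j) i * cis (i \<bullet> x))
          = (\<Sum>\<beta> | mi_size \<beta> \<le> l. a j \<beta> * (\<Sum>i\<in>I. d i * of_real (mi_power i \<beta>) * cis (i \<bullet> x)))"
        unfolding symbol_def sum_distrib_left sum_distrib_right by (subst sum.swap) (simp add: mult_ac)
      then have "diff_op l (a j) (f R) x - ?t * (\<Sum>i\<in>I. d i * symbol l (a j) i * cis (i \<bullet> x))
          = (\<Sum>\<beta> | mi_size \<beta> \<le> l. a j \<beta> * (D \<beta> (f R) x - ?t * (\<Sum>i\<in>I. d i * of_real (mi_power i \<beta>) * cis (i \<bullet> x))))"
        by (simp add: diff_op_def sum_distrib_left[of ?t] sum_subtractf right_diff_distrib mult.left_commute)
      also have "norm \<dots> \<le> (\<Sum>\<beta> | mi_size \<beta> \<le> l. norm (a j \<beta>) * (Y \<beta> / R))"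
        by (intro order_trans[OF norm_sum sum_mono]) (simp only: norm_mult, intro mult_left_mono Df[OF R] norm_ge_zero)
      also have "\<dots> = Z j / R" by (simp add: Z_def sum_divide_distrib)
      finally show "norm (diff_op l (a j) (f R) x - ?t * (\<Sum>i\<in>I. d i * symbol l (a j) i * cis (i \<bullet> x))) \<le> Z j / R" .
    qed
    have f0: "supnorm (f R) \<le> c\<^sub>0 + 0" if R: "R \<ge> 1" for R
    proof (rule supnorm_cutoff_le[OF f_test[OF R]])
      show "norm (f R x - of_real (\<phi> ((1 / R) *\<^sub>R x)) * (\<Sum>i\<in>I. d i * cis (i \<bullet> x))) \<le> 0" for x
        by (simp add: f_def sum_distrib_left mult_ac)
    qed (use c0 \<phi>01 in auto)
    define K where "K = C * (\<Sum>j=1..N. Z j) + Y \<alpha>"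
    have main: "norm (\<Sum>i\<in>I. d i * of_real (mi_power i \<alpha>)) \<le> C * ((\<Sum>j=1..N. c j) + c\<^sub>0) + K / R" if R: "R \<ge> 1" for R
    proof -
      let ?s = "\<Sum>i\<in>I. d i * of_real (mi_power i \<alpha>)"
      have "norm ?s \<le> norm (D \<alpha> (f R) 0) + norm (D \<alpha> (f R) 0 - ?s)"
        using norm_triangle_ineq4[of "D \<alpha> (f R) 0" "D \<alpha> (f R) 0 - ?s"] by simp
      also have "norm (D \<alpha> (f R) 0 - ?s) \<le> Y \<alpha> / R"
        using Df[OF R, of \<alpha> 0] by (simp add: \<phi>0)
      also have "norm (D \<alpha> (f R) 0) \<le> supnorm (D \<alpha> (f R))"
        by (rule test_supnorm(2)[OF test_functions_D[OF f_test[OF R]]])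
      also have "\<dots> \<le> C * ((\<Sum>j=1..N. supnorm (diff_op l (a j) (f R))) + supnorm (f R))"
        by (rule coer[OF f_test[OF R] \<alpha>])
      also have "\<dots> \<le> C * ((\<Sum>j=1..N. c j + Z j / R) + c\<^sub>0)"
        using f0[OF R] by (intro mult_left_mono add_mono sum_mono Pf C0 R) auto
      also have "C * ((\<Sum>j=1..N. c j + Z j / R) + c\<^sub>0) + Y \<alpha> / R = C * ((\<Sum>j=1..N. c j) + c\<^sub>0) + K / R"
        by (simp add: K_def sum.distrib sum_divide_distrib[symmetric] algebra_simps add_divide_distrib)
      finally show ?thesis by simp
    qed
    have "((\<lambda>R. C * ((\<Sum>j=1..N. c j) + c\<^sub>0) + K / R) \<longlongrightarrow> C * ((\<Sum>j=1..N. c j) + c\<^sub>0) + 0) at_top"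
      by (intro tendsto_add tendsto_const real_tendsto_divide_at_top[OF tendsto_const filterlim_ident])
    from tendsto_lowerbound[OF this, of "norm (\<Sum>i\<in>I. d i * of_real (mi_power i \<alpha>))"] main
    show "norm (\<Phi> (\<lambda>\<zeta>. of_real (mi_power \<zeta> \<alpha>))) \<le> C * ((\<Sum>j=1..N. c j) + c\<^sub>0)"
      unfolding \<Phi> by (auto intro: eventually_at_top_linorderI[of 1])
  qed
qed

section \<open>Interpolation\<close>

text \<open>Given functionals \<open>L i\<close> dual to the functions indexed by \<open>J\<close>,
  independence yields a point where \<open>g k\<close> differs from the combination of the
  \<open>g i\<close> with coefficients \<open>L i (g k)\<close>. Evaluation there, corrected by the
  \<open>L i\<close>, annihilates all \<open>g j\<close> with \<open>j\<close> in \<open>J\<close>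
  but not \<open>g k\<close>.\<close>

lemma interpolation:
  fixes g :: "'i \<Rightarrow> 'v \<Rightarrow> 'a::field"
  assumes "finite J"
    and "\<And>c. \<forall>\<xi>\<in>X. (\<Sum>j\<in>J. c j * g j \<xi>) = 0 \<Longrightarrow> \<forall>j\<in>J. c j = 0"
  shows "\<exists>\<Phi>\<in>eval_span X. \<forall>j\<in>J. \<Phi> (g j) = b j"
  using assms
proof (induction J arbitrary: b)
  case empty
  then show ?case using eval_span_zero by blast
next
  case (insert k J)
  have "\<forall>j\<in>J. c j = 0" if c: "\<forall>\<xi>\<in>X. (\<Sum>j\<in>J. c j * g j \<xi>) = 0" for c
  proof -
    let ?c = "\<lambda>j. if j = k then 0 else c j"
    have "(\<Sum>j\<in>insert k J. ?c j * g j \<xi>) = (\<Sum>j\<in>J. c j * g j \<xi>)" for \<xi>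
      using insert.hyps by (simp, intro sum.cong) auto
    with c have "\<forall>j\<in>insert k J. ?c j = 0" by (intro insert.prems) simp
    then show ?thesis using insert.hyps by (metis insertCI)
  qed
  note IH = insert.IH[OF this]
  define L where "L i = (SOME \<Phi>. \<Phi> \<in> eval_span X \<and> (\<forall>j\<in>J. \<Phi> (g j) = (if i = j then 1 else 0)))" for i
  have L: "L i \<in> eval_span X" "j \<in> J \<Longrightarrow> L i (g j) = (if i = j then 1 else 0)" for i j
  proof -
    have "\<exists>\<Phi>. \<Phi> \<in> eval_span X \<and> (\<forall>j\<in>J. \<Phi> (g j) = (if i = j then 1 else 0))"
      using IH[of "\<lambda>j. if i = j then 1 else 0"] by (simp add: Bex_def)
    from someI_ex[OF this] show "L i \<in> eval_span X" "j \<in> J \<Longrightarrow> L i (g j) = (if i = j then 1 else 0)"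
      unfolding L_def by simp_all
  qed
  have "\<exists>\<xi>\<in>X. g k \<xi> - (\<Sum>i\<in>J. L i (g k) * g i \<xi>) \<noteq> 0"
  proof (rule ccontr)
    assume neg: "\<not> ?thesis"
    let ?c = "\<lambda>j. if j = k then 1 else - L j (g k)"
    have "(\<Sum>j\<in>insert k J. ?c j * g j \<xi>) = g k \<xi> - (\<Sum>i\<in>J. L i (g k) * g i \<xi>)" for \<xi>
    proof -
      have "(\<Sum>j\<in>J. ?c j * g j \<xi>) = (\<Sum>i\<in>J. - (L i (g k) * g i \<xi>))"
        using insert.hyps by (intro sum.cong) auto
      then show ?thesis using insert.hyps by (simp add: sum_negf)
    qed
    with neg have "\<forall>j\<in>insert k J. ?c j = 0" by (intro insert.prems) simp
    then show False by (metis insertI1 zero_neq_one)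
  qed
  then obtain \<xi> where \<xi>: "\<xi> \<in> X" and s: "g k \<xi> - (\<Sum>i\<in>J. L i (g k) * g i \<xi>) \<noteq> 0" by blast
  define \<Psi> where "\<Psi> h = h \<xi> + (- 1) * (\<Sum>i\<in>J. g i \<xi> * L i h)" for h
  have \<Psi>: "\<Psi> \<in> eval_span X"
    unfolding \<Psi>_def[abs_def]
    by (intro eval_span_add eval_span_cmult eval_span_sum eval_span_ev L \<xi>)
  have \<Psi>J: "\<Psi> (g j) = 0" if "j \<in> J" for j
    using that insert.hyps by (simp add: \<Psi>_def L if_distrib[of "\<lambda>x. _ * x"] cong: if_cong)
  have \<Psi>k: "\<Psi> (g k) \<noteq> 0" using s by (simp add: \<Psi>_def mult.commute)
  define t where "t = (b k - (\<Sum>i\<in>J. b i * L i (g k))) / \<Psi> (g k)"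
  let ?\<Phi> = "\<lambda>h. (\<Sum>i\<in>J. b i * L i h) + t * \<Psi> h"
  have "?\<Phi> \<in> eval_span X"
    by (intro eval_span_add eval_span_cmult eval_span_sum L \<Psi>)
  moreover have "?\<Phi> (g j) = b j" if "j \<in> insert k J" for j
  proof (cases "j = k")
    case True
    then show ?thesis using \<Psi>k by (simp add: t_def)
  next
    case False
    with that have "j \<in> J" by simp
    then show ?thesis using insert.hyps \<Psi>J
      by (simp add: L if_distrib[of "\<lambda>x. _ * x"] cong: if_cong)
  qed
  ultimately show ?case by (intro bexI[where x = ?\<Phi>] ballI)
qed

section \<open>Asymptotics of symbols along a ray\<close>

text \<open>A remainder of order \<open>1 / r\<close>, uniform up to polynomial growth in the shift
  \<zeta>. The growth is harmless if \<open>r\<close> exceeds a sufficiently high power of the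
  shifts, which is arranged by the choice of scales.\<close>

definition ray_small :: "(real \<Rightarrow> real^'n::finite \<Rightarrow> complex) \<Rightarrow> bool" where
  "ray_small F \<longleftrightarrow> (\<exists>C M. 0 \<le> C \<and> (\<forall>r\<ge>1. \<forall>\<zeta>. norm (F r \<zeta>) \<le> C / r * (1 + norm \<zeta>) ^ M))"

lemma ray_smallI:
  "0 \<le> C \<Longrightarrow> (\<And>r \<zeta>. 1 \<le> r \<Longrightarrow> norm (F r \<zeta>) \<le> C / r * (1 + norm \<zeta>) ^ M) \<Longrightarrow> ray_small F"
  unfolding ray_small_def by blast

lemma ray_smallE:
  assumes "ray_small F"
  obtains C M where "0 \<le> C" "\<And>r \<zeta>. 1 \<le> r \<Longrightarrow> norm (F r \<zeta>) \<le> C / r * (1 + norm \<zeta>) ^ M"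
  using assms unfolding ray_small_def by blast

lemma ray_small_cong:
  assumes "ray_small F" "\<And>r \<zeta>. 1 \<le> r \<Longrightarrow> norm (G r \<zeta>) \<le> norm (F r \<zeta>)"
  shows "ray_small G"
proof -
  obtain C M where C: "0 \<le> C" "\<And>r \<zeta>. 1 \<le> r \<Longrightarrow> norm (F r \<zeta>) \<le> C / r * (1 + norm \<zeta>) ^ M"
    using assms(1) by (rule ray_smallE) blast
  show ?thesis by (rule ray_smallI[OF C(1)]) (rule order_trans[OF assms(2) C(2)])
qed

lemma ray_small_zero: "ray_small (\<lambda>r \<zeta>. 0)"
  by (rule ray_smallI[of 0]) auto

lemma ray_small_add:
  assumes "ray_small F" "ray_small G" shows "ray_small (\<lambda>r \<zeta>. F r \<zeta> + G r \<zeta>)"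
proof -
  obtain C M where C: "0 \<le> C" "\<And>r \<zeta>. 1 \<le> r \<Longrightarrow> norm (F r \<zeta>) \<le> C / r * (1 + norm \<zeta>) ^ M"
    using assms(1) by (rule ray_smallE) blast
  obtain D K where D: "0 \<le> D" "\<And>r \<zeta>. 1 \<le> r \<Longrightarrow> norm (G r \<zeta>) \<le> D / r * (1 + norm \<zeta>) ^ K"
    using assms(2) by (rule ray_smallE) blast
  show ?thesis
  proof (rule ray_smallI)
    show "0 \<le> C + D" using C D by simp
    fix r :: real and \<zeta> :: "real^'a" assume r: "1 \<le> r"
    have "norm (F r \<zeta> + G r \<zeta>) \<le> C / r * (1 + norm \<zeta>) ^ M + D / r * (1 + norm \<zeta>) ^ K"
      by (intro order_trans[OF norm_triangle_ineq] add_mono C D r)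
    also have "\<dots> \<le> C / r * (1 + norm \<zeta>) ^ (M + K) + D / r * (1 + norm \<zeta>) ^ (M + K)"
      using C D r by (intro add_mono mult_left_mono power_increasing) auto
    finally show "norm (F r \<zeta> + G r \<zeta>) \<le> (C + D) / r * (1 + norm \<zeta>) ^ (M + K)"
      by (simp add: add_divide_distrib distrib_right)
  qed
qed

text \<open>Two factors of order \<open>1 / r\<close> leave room for one factor \<open>r\<close>;
  this handles the second-order term in the product rule.\<close>

lemma ray_small_scaled_mult:
  assumes "ray_small F" "ray_small G" shows "ray_small (\<lambda>r \<zeta>. of_real r * (F r \<zeta> * G r \<zeta>))"
proof -
  obtain C M where C: "0 \<le> C" "\<And>r \<zeta>. 1 \<le> r \<Longrightarrow> norm (F r \<zeta>) \<le> C / r * (1 + norm \<zeta>) ^ M"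
    using assms(1) by (rule ray_smallE) blast
  obtain D K where D: "0 \<le> D" "\<And>r \<zeta>. 1 \<le> r \<Longrightarrow> norm (G r \<zeta>) \<le> D / r * (1 + norm \<zeta>) ^ K"
    using assms(2) by (rule ray_smallE) blast
  show ?thesis
  proof (rule ray_smallI)
    show "0 \<le> C * D" using C D by simp
    fix r :: real and \<zeta> :: "real^'a" assume r: "1 \<le> r"
    have "norm (of_real r * (F r \<zeta> * G r \<zeta>)) = r * (norm (F r \<zeta>) * norm (G r \<zeta>))"
      using r by (simp add: norm_mult)
    also have "\<dots> \<le> r * ((C / r * (1 + norm \<zeta>) ^ M) * (D / r * (1 + norm \<zeta>) ^ K))"
      using C(1) D(1) r by (intro mult_left_mono mult_mono C D) auto
    also have "\<dots> = (C * D) / r * (1 + norm \<zeta>) ^ (M + K)"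
      using r by (simp add: power_add field_simps)
    finally show "norm (of_real r * (F r \<zeta> * G r \<zeta>)) \<le> (C * D) / r * (1 + norm \<zeta>) ^ (M + K)" .
  qed
qed

lemma ray_small_cmult:
  assumes "ray_small F" shows "ray_small (\<lambda>r \<zeta>. c * F r \<zeta>)"
proof -
  obtain C M where C: "0 \<le> C" "\<And>r \<zeta>. 1 \<le> r \<Longrightarrow> norm (F r \<zeta>) \<le> C / r * (1 + norm \<zeta>) ^ M"
    using assms(1) by (rule ray_smallE) blast
  show ?thesis
  proof (rule ray_smallI)
    show "0 \<le> norm c * C" using C by simp
    fix r :: real and \<zeta> :: "real^'a" assume r: "1 \<le> r"
    show "norm (c * F r \<zeta>) \<le> (norm c * C) / r * (1 + norm \<zeta>) ^ M"
      using mult_left_mono[OF C(2)[OF r] norm_ge_zero] by (simp add: norm_mult mult.assoc)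
  qed
qed

lemma ray_small_sum:
  "(\<And>i. i \<in> I \<Longrightarrow> ray_small (F i)) \<Longrightarrow> ray_small (\<lambda>r \<zeta>. \<Sum>i\<in>I. F i r \<zeta>)"
  by (induction I rule: infinite_finite_induct) (simp_all add: ray_small_zero ray_small_add)

definition lin :: "('n::finite \<Rightarrow> complex) \<Rightarrow> real^'n \<Rightarrow> complex" where
  "lin v \<zeta> = (\<Sum>k\<in>UNIV. v k * of_real (\<zeta> $ k))"

lemma ray_small_affine: "ray_small (\<lambda>r \<zeta>. (lin v \<zeta> + c) / of_real r)"
proof (rule ray_smallI)
  let ?C = "(\<Sum>k\<in>UNIV. norm (v k)) + norm c"
  show "0 \<le> ?C" by (simp add: sum_nonneg)
  fix r :: real and \<zeta> :: "real^'a" assume r: "1 \<le> r"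
  have "norm (lin v \<zeta>) \<le> (\<Sum>k\<in>UNIV. norm (v k) * norm \<zeta>)"
    unfolding lin_def
    by (intro order_trans[OF norm_sum sum_mono]) (simp add: norm_mult mult_left_mono component_le_norm_cart)
  then have "norm (lin v \<zeta> + c) \<le> (\<Sum>k\<in>UNIV. norm (v k)) * norm \<zeta> + norm c"
    by (intro order_trans[OF norm_triangle_ineq]) (simp add: sum_distrib_right)
  also have "\<dots> \<le> ?C * (1 + norm \<zeta>) ^ 1"
    by (simp add: algebra_simps sum_nonneg)
  finally show "norm ((lin v \<zeta> + c) / of_real r) \<le> ?C / r * (1 + norm \<zeta>) ^ 1"
    using r by (simp add: norm_divide divide_right_mono)
qed

text \<open>\<open>h\<close> is to be thought of as homogeneous of degree \<open>m\<close>; \<open>lin v\<close> is its derivative at \<open>\<xi>\<close>, and the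
  condition on \<open>lin v \<xi>\<close> is Euler's relation.\<close>

definition ray_expansion :: "real^'n::finite \<Rightarrow> nat \<Rightarrow> (real^'n \<Rightarrow> complex) \<Rightarrow> ('n \<Rightarrow> complex) \<Rightarrow> bool" where
  "ray_expansion \<xi> m h v \<longleftrightarrow> lin v \<xi> = of_nat m * h \<xi> \<and>
     ray_small (\<lambda>r \<zeta>. of_real r * (h (r *\<^sub>R \<xi> + \<zeta>) / of_real r ^ m - h \<xi>) - lin v \<zeta>)"

lemma ray_small_div:
  assumes "ray_small F" shows "ray_small (\<lambda>r \<zeta>. F r \<zeta> / of_real r)"
proof (rule ray_small_cong[OF assms])
  fix r :: real and \<zeta> assume r: "1 \<le> r"
  have "norm (F r \<zeta>) / r \<le> norm (F r \<zeta>) / 1" using r by (intro divide_left_mono) auto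
  then show "norm (F r \<zeta> / of_real r) \<le> norm (F r \<zeta>)" using r by (simp add: norm_divide)
qed

lemma ray_small_eq:
  assumes "ray_small F" "\<And>r \<zeta>. 1 \<le> r \<Longrightarrow> G r \<zeta> = F r \<zeta>" shows "ray_small G"
  by (rule ray_small_cong[OF assms(1)]) (simp add: assms(2))

lemma ray_expansion_first_order:
  assumes "ray_expansion \<xi> m h v"
  shows "ray_small (\<lambda>r \<zeta>. h (r *\<^sub>R \<xi> + \<zeta>) / of_real r ^ m - h \<xi>)"
proof -
  let ?G = "\<lambda>r \<zeta>. of_real r * (h (r *\<^sub>R \<xi> + \<zeta>) / of_real r ^ m - h \<xi>) - lin v \<zeta>"
  have "ray_small ?G" using assms by (simp add: ray_expansion_def)
  from ray_small_add[OF ray_small_div[OF this] ray_small_affine[of v 0]]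
  show ?thesis by (rule ray_small_eq) (simp add: add_divide_distrib[symmetric])
qed

lemma lin_comb: "lin (\<lambda>k. a * v k + b * w k) \<zeta> = a * lin v \<zeta> + b * lin w \<zeta>"
  by (simp add: lin_def sum_distrib_left sum.distrib distrib_right mult.assoc)

text \<open>The product rule for the derivatives at \<xi>; in Euler's relation the degrees
  add.\<close>

lemma ray_expansion_mult:
  assumes "ray_expansion \<xi> m f v" "ray_expansion \<xi> k g w"
  shows "ray_expansion \<xi> (m + k) (\<lambda>\<xi>. f \<xi> * g \<xi>) (\<lambda>i. f \<xi> * w i + g \<xi> * v i)"
  unfolding ray_expansion_def lin_comb
proof
  show "f \<xi> * lin w \<xi> + g \<xi> * lin v \<xi> = of_nat (m + k) * (f \<xi> * g \<xi>)"
    using assms by (simp add: ray_expansion_def algebra_simps)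
  let ?X = "\<lambda>r \<zeta>. f (r *\<^sub>R \<xi> + \<zeta>) / of_real r ^ m - f \<xi>"
  let ?Y = "\<lambda>r \<zeta>. g (r *\<^sub>R \<xi> + \<zeta>) / of_real r ^ k - g \<xi>"
  \<comment> \<open>An exact identity that splits off the product of the two increments from the two
    first-order remainders.\<close>
  have *: "c * (x * y - a * b) - (a * w + b * v)
      = c * ((x - a) * (y - b)) + (b * (c * (x - a) - v) + a * (c * (y - b) - w))" for a b c v w x y :: complex
    by (simp add: algebra_simps)
  have "ray_small (\<lambda>r \<zeta>. of_real r * (?X r \<zeta> * ?Y r \<zeta>)
      + (g \<xi> * (of_real r * ?X r \<zeta> - lin v \<zeta>) + f \<xi> * (of_real r * ?Y r \<zeta> - lin w \<zeta>)))"
    using assms unfolding ray_expansion_def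
    by (intro ray_small_add ray_small_scaled_mult ray_small_cmult ray_expansion_first_order[OF assms(1)]
        ray_expansion_first_order[OF assms(2)]) auto
  then show "ray_small (\<lambda>r \<zeta>. of_real r * (f (r *\<^sub>R \<xi> + \<zeta>) * g (r *\<^sub>R \<xi> + \<zeta>) / of_real r ^ (m + k) - f \<xi> * g \<xi>)
      - (f \<xi> * lin w \<zeta> + g \<xi> * lin v \<zeta>))"
    by (rule ray_small_eq) (simp add: power_add *[symmetric])
qed

lemma ray_expansion_one: "ray_expansion \<xi> 0 (\<lambda>_. 1) (\<lambda>_. 0)"
  by (simp add: ray_expansion_def lin_def ray_small_zero)

lemma lin_unit: "lin (\<lambda>j. if j = k then 1 else 0) \<zeta> = of_real (\<zeta> $ k)"
  by (simp add: lin_def if_distrib[of "\<lambda>x. x * _"] cong: if_cong)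

lemma ray_expansion_coord: "ray_expansion \<xi> 1 (\<lambda>\<xi>. of_real (\<xi> $ k)) (\<lambda>j. if j = k then 1 else 0)"
  unfolding ray_expansion_def lin_unit
  by (intro conjI ray_small_eq[OF ray_small_zero]) (simp_all add: field_simps)

lemma ray_expansion_mi_power:
  "\<exists>v. ray_expansion \<xi> (mi_size \<alpha>) (\<lambda>\<xi>. of_real (mi_power \<xi> \<alpha>)) v"
proof -
  have pow: "\<exists>v. ray_expansion \<xi> n (\<lambda>\<xi>. of_real (\<xi> $ k) ^ n) v" for k n
  proof (induction n)
    case 0
    show ?case using ray_expansion_one by auto
  next
    case (Suc n)
    then obtain v where "ray_expansion \<xi> n (\<lambda>\<xi>. of_real (\<xi> $ k) ^ n) v" by blast
    from ray_expansion_mult[OF ray_expansion_coord[of \<xi> k] this] show ?case by auto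
  qed
  have "\<exists>v. ray_expansion \<xi> (\<Sum>k\<in>K. \<alpha> k) (\<lambda>\<xi>. \<Prod>k\<in>K. of_real (\<xi> $ k) ^ \<alpha> k) v" if "finite K" for K
    using that
  proof induction
    case empty
    show ?case using ray_expansion_one by auto
  next
    case (insert k K)
    then obtain v where v: "ray_expansion \<xi> (\<Sum>k\<in>K. \<alpha> k) (\<lambda>\<xi>. \<Prod>k\<in>K. of_real (\<xi> $ k) ^ \<alpha> k) v" by blast
    obtain w where "ray_expansion \<xi> (\<alpha> k) (\<lambda>\<xi>. of_real (\<xi> $ k) ^ \<alpha> k) w" using pow by blast
    from ray_expansion_mult[OF this v] insert.hyps show ?case by auto
  qed
  from this[of UNIV] show ?thesis by (simp add: mi_size_def mi_power_def)
qed

lemma mi_power_ray: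
  "ray_small (\<lambda>r \<zeta>. of_real (mi_power (r *\<^sub>R \<xi> + \<zeta>) \<alpha>) / of_real r ^ mi_size \<alpha> - of_real (mi_power \<xi> \<alpha>))"
  using ray_expansion_mi_power[of \<xi> \<alpha>] ray_expansion_first_order by blast

lemma mi_power_ray_higher:
  assumes "mi_size \<alpha> < m"
  shows "ray_small (\<lambda>r \<zeta>. of_real (mi_power (r *\<^sub>R \<xi> + \<zeta>) \<alpha>) / of_real r ^ m)"
  using assms
proof (induction m)
  case (Suc m)
  show ?case
  proof (cases "mi_size \<alpha> = m")
    case True
    from ray_small_add[OF ray_small_div[OF mi_power_ray[of \<xi> \<alpha>]] ray_small_affine[of "\<lambda>_. 0" "of_real (mi_power \<xi> \<alpha>)"]]
    show ?thesis unfolding True by (rule ray_small_eq) (simp add: lin_def diff_divide_distrib)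
  next
    case False
    with Suc have "ray_small (\<lambda>r \<zeta>. of_real (mi_power (r *\<^sub>R \<xi> + \<zeta>) \<alpha>) / of_real r ^ m)" by simp
    from ray_small_div[OF this] show ?thesis by (rule ray_small_eq) simp
  qed
qed simp

text \<open>Sort the symbol by degree. Degree \<open>l\<close> gives the principal symbol and its
  derivative \<open>lin v\<close>; degree \<open>l - 1\<close> gives its value at \<xi>, the
  constant \<open>b\<close>; lower degrees lose a factor \<open>1 / r\<close> and go into the
  remainder.\<close>

lemma symbol_ray_expansion:
  fixes p :: "'n::finite multi_index \<Rightarrow> complex"
  assumes "0 < l"
  shows "\<exists>v b. lin v \<xi> = of_nat l * principal_symbol l p \<xi> \<and>
    ray_small (\<lambda>r \<zeta>. symbol l p (r *\<^sub>R \<xi> + \<zeta>) / of_real r ^ (l - 1) - (of_real r * principal_symbol l p \<xi> + lin v \<zeta> + b))"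
proof -
  let ?I = "{\<alpha> :: 'n multi_index. mi_size \<alpha> \<le> l}"
  let ?h = "\<lambda>\<alpha> \<xi>. complex_of_real (mi_power \<xi> \<alpha>)"
  have "\<forall>\<alpha>. \<exists>v. ray_expansion \<xi> (mi_size \<alpha>) (?h \<alpha>) v" using ray_expansion_mi_power by blast
  then obtain w where w: "\<And>\<alpha>. ray_expansion \<xi> (mi_size \<alpha>) (?h \<alpha>) (w \<alpha>)" by metis
  define v where "v k = (\<Sum>\<alpha> | mi_size \<alpha> = l. p \<alpha> * w \<alpha> k)" for k
  define b where "b = (\<Sum>\<alpha> | mi_size \<alpha> = l - 1. p \<alpha> * ?h \<alpha> \<xi>)"
  have lin_v: "lin v \<zeta> = (\<Sum>\<alpha> | mi_size \<alpha> = l. p \<alpha> * lin (w \<alpha>) \<zeta>)" for \<zeta>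
    unfolding lin_def v_def sum_distrib_left sum_distrib_right by (subst sum.swap) (simp add: mult.assoc)
  have "lin v \<xi> = of_nat l * principal_symbol l p \<xi>"
    using w unfolding lin_v principal_symbol_def sum_distrib_left ray_expansion_def
    by (intro sum.cong) (auto simp: mult_ac)
  moreover
  let ?T = "\<lambda>\<alpha> r \<zeta>. (if mi_size \<alpha> = l then p \<alpha> * (of_real r * ?h \<alpha> \<xi> + lin (w \<alpha>) \<zeta>) else 0)
     + (if mi_size \<alpha> = l - 1 then p \<alpha> * ?h \<alpha> \<xi> else 0)"
  have "ray_small (\<lambda>r \<zeta>. p \<alpha> * ?h \<alpha> (r *\<^sub>R \<xi> + \<zeta>) / of_real r ^ (l - 1) - ?T \<alpha> r \<zeta>)" if "\<alpha> \<in> ?I" for \<alpha>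
  proof -
    have "mi_size \<alpha> \<le> l" using that by simp
    then have "mi_size \<alpha> = l \<or> (mi_size \<alpha> = l - 1 \<and> l - 1 \<noteq> l) \<or> mi_size \<alpha> < l - 1"
      using assms by linarith
    then consider "mi_size \<alpha> = l" | "mi_size \<alpha> = l - 1" "l - 1 \<noteq> l" | "mi_size \<alpha> < l - 1" by auto
    then show ?thesis
    proof cases
      case 1
      have "ray_small (\<lambda>r \<zeta>. p \<alpha> * (of_real r * (?h \<alpha> (r *\<^sub>R \<xi> + \<zeta>) / of_real r ^ l - ?h \<alpha> \<xi>) - lin (w \<alpha>) \<zeta>))"
        using w[of \<alpha>] 1 by (intro ray_small_cmult) (simp add: ray_expansion_def)
      then show ?thesis
      proof (rule ray_small_eq)
        fix r :: real and \<zeta> assume "1 \<le> r"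
        moreover have "complex_of_real r ^ l = of_real r * of_real r ^ (l - 1)"
          using assms by (cases l) auto
        ultimately show "p \<alpha> * ?h \<alpha> (r *\<^sub>R \<xi> + \<zeta>) / of_real r ^ (l - 1) - ?T \<alpha> r \<zeta>
           = p \<alpha> * (of_real r * (?h \<alpha> (r *\<^sub>R \<xi> + \<zeta>) / of_real r ^ l - ?h \<alpha> \<xi>) - lin (w \<alpha>) \<zeta>)"
          using 1 assms by (simp add: algebra_simps)
      qed
    next
      case 2
      have "ray_small (\<lambda>r \<zeta>. p \<alpha> * (?h \<alpha> (r *\<^sub>R \<xi> + \<zeta>) / of_real r ^ (l - 1) - ?h \<alpha> \<xi>))"
        using mi_power_ray[of \<xi> \<alpha>] 2 by (intro ray_small_cmult) simp
      then show ?thesis by (rule ray_small_eq) (use 2 in \<open>simp add: algebra_simps\<close>)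
    next
      case 3
      have "ray_small (\<lambda>r \<zeta>. p \<alpha> * (?h \<alpha> (r *\<^sub>R \<xi> + \<zeta>) / of_real r ^ (l - 1)))"
        by (intro ray_small_cmult mi_power_ray_higher 3)
      then show ?thesis by (rule ray_small_eq) (use 3 in auto)
    qed
  qed
  then have "ray_small (\<lambda>r \<zeta>. \<Sum>\<alpha>\<in>?I. p \<alpha> * ?h \<alpha> (r *\<^sub>R \<xi> + \<zeta>) / of_real r ^ (l - 1) - ?T \<alpha> r \<zeta>)"
    by (rule ray_small_sum)
  then have "ray_small (\<lambda>r \<zeta>. symbol l p (r *\<^sub>R \<xi> + \<zeta>) / of_real r ^ (l - 1) - (of_real r * principal_symbol l p \<xi> + lin v \<zeta> + b))"
  proof (rule ray_small_eq)
    fix r :: real and \<zeta> :: "real^'n"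
    have l1: "{\<alpha>\<in>?I. mi_size \<alpha> = l} = {\<alpha>. mi_size \<alpha> = l}" and l2: "{\<alpha>\<in>?I. mi_size \<alpha> = l - 1} = {\<alpha>. mi_size \<alpha> = l - 1}" by auto
    have "(\<Sum>\<alpha>\<in>?I. ?T \<alpha> r \<zeta>) = (\<Sum>\<alpha> | mi_size \<alpha> = l. p \<alpha> * (of_real r * ?h \<alpha> \<xi> + lin (w \<alpha>) \<zeta>)) + b"
      unfolding sum.distrib b_def by (simp only: sum.inter_filter[OF finite_mi_size_le, symmetric] l1 l2)
    also have "\<dots> = of_real r * principal_symbol l p \<xi> + lin v \<zeta> + b"
      unfolding lin_v principal_symbol_def by (simp add: sum.distrib sum_distrib_left distrib_left mult.left_commute)
    finally show "symbol l p (r *\<^sub>R \<xi> + \<zeta>) / of_real r ^ (l - 1) - (of_real r * principal_symbol l p \<xi> + lin v \<zeta> + b)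
        = (\<Sum>\<alpha>\<in>?I. p \<alpha> * ?h \<alpha> (r *\<^sub>R \<xi> + \<zeta>) / of_real r ^ (l - 1) - ?T \<alpha> r \<zeta>)"
      unfolding sum_subtractf symbol_def sum_divide_distrib by simp
  qed
  ultimately show ?thesis by blast
qed

lemma symbol_ray_leading:
  assumes "0 < l"
  shows "ray_small (\<lambda>r \<zeta>. symbol l p (r *\<^sub>R \<xi> + \<zeta>) / of_real r ^ l - principal_symbol l p \<xi>)"
proof -
  obtain v b where "ray_small (\<lambda>r \<zeta>. symbol l p (r *\<^sub>R \<xi> + \<zeta>) / of_real r ^ (l - 1) - (of_real r * principal_symbol l p \<xi> + lin v \<zeta> + b))"
    using symbol_ray_expansion[OF assms] by blast
  from ray_small_add[OF ray_small_div[OF this] ray_small_affine[of v b]] show ?thesis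
  proof (rule ray_small_eq)
    fix r :: real and \<zeta> assume "1 \<le> r"
    moreover have "complex_of_real r ^ l = of_real r ^ (l - 1) * of_real r"
      using assms by (cases l) auto
    ultimately show "symbol l p (r *\<^sub>R \<xi> + \<zeta>) / of_real r ^ l - principal_symbol l p \<xi>
      = (symbol l p (r *\<^sub>R \<xi> + \<zeta>) / of_real r ^ (l - 1) - (of_real r * principal_symbol l p \<xi> + lin v \<zeta> + b)) / of_real r + (lin v \<zeta> + b) / of_real r"
      by (simp add: diff_divide_distrib add_divide_distrib)
  qed
qed

section \<open>Lacunary sums of localized oscillations\<close>

lemma norm_cis_minus_one: "norm (cis x - 1) = 2 * \<bar>sin (x / 2)\<bar>"
proof -
  have "(norm (cis x - 1))\<^sup>2 = (cos x - 1)\<^sup>2 + (sin x)\<^sup>2" by (simp add: cmod_power2)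
  also have "\<dots> = 2 - 2 * cos x"
    using sin_cos_squared_add[of x] by (simp add: power2_eq_square algebra_simps)
  also have "\<dots> = (2 * \<bar>sin (x / 2)\<bar>)\<^sup>2"
    using cos_double_sin[of "x / 2"] by (simp add: power_mult_distrib)
  finally show ?thesis by (rule power2_eq_imp_eq) auto
qed

lemma norm_cis_minus_one_le: "norm (cis x - 1) \<le> \<bar>x\<bar>"
  unfolding norm_cis_minus_one using abs_sin_x_le_abs_x[of "x / 2"] by simp

text \<open>Jordan's inequality: a concave function lies above its chord.\<close>

lemma sin_ge_chord:
  assumes "0 \<le> y" "y \<le> pi / 2" shows "2 * y / pi \<le> sin y"
proof -
  have "convex_on {0..pi} (\<lambda>x. - sin x)"
    by (rule f''_ge0_imp_convex[where f' = "\<lambda>x. - cos x" and f'' = sin])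
      (auto intro!: derivative_eq_intros sin_ge_zero)
  from convex_onD[OF this, of "2 * y / pi" 0 "pi / 2"] assms
  show ?thesis by (simp add: field_simps)
qed

lemma norm_cis_minus_one_ge:
  assumes "\<bar>x\<bar> \<le> pi" shows "2 * \<bar>x\<bar> / pi \<le> norm (cis x - 1)"
proof -
  have "sin (\<bar>x\<bar> / 2) \<le> \<bar>sin (x / 2)\<bar>" by (cases "0 \<le> x") auto
  with sin_ge_chord[of "\<bar>x\<bar> / 2"] assms show ?thesis unfolding norm_cis_minus_one by simp
qed

text \<open>A one-sided Dirichlet kernel divided by its number of terms: a localization factor with
  integer frequencies below \<open>S\<close>, equal to 1 at multiples of 2 pi if
  \<open>S > 0\<close>.\<close>

definition dirichlet :: "nat \<Rightarrow> real \<Rightarrow> complex" where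
  "dirichlet S s = (\<Sum>p<S. cis (real p * s)) / of_nat S"

lemma dirichlet_le_one: "norm (dirichlet S s) \<le> 1"
proof -
  have "norm (\<Sum>p<S. cis (real p * s)) \<le> (\<Sum>p<S. 1)"
    by (rule order_trans[OF norm_sum]) simp
  then show ?thesis by (cases "S = 0") (simp_all add: dirichlet_def norm_divide)
qed

text \<open>Sum the geometric series: the numerator is at most 2, and the denominator is bounded
  below by the chord estimate.\<close>

lemma dirichlet_decay:
  assumes "\<bar>s\<bar> \<le> pi" shows "norm (dirichlet S s) * (real S * \<bar>s\<bar>) \<le> pi"
proof (cases "s = 0 \<or> S = 0")
  case False
  then have "0 < 2 * \<bar>s\<bar> / pi" by simp
  also have ge: "\<dots> \<le> norm (cis s - 1)" by (rule norm_cis_minus_one_ge[OF assms])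
  finally have "cis s \<noteq> 1" by auto
  have "(\<Sum>p<S. cis (real p * s)) = (\<Sum>p<S. cis s ^ p)"
    by (intro sum.cong refl) (simp add: Complex.DeMoivre)
  then have "(\<Sum>p<S. cis (real p * s)) = (cis s ^ S - 1) / (cis s - 1)"
    by (simp only: geometric_sum[OF \<open>cis s \<noteq> 1\<close>])
  then have "norm (\<Sum>p<S. cis (real p * s)) * norm (cis s - 1) = norm (cis s ^ S - 1)"
    using \<open>cis s \<noteq> 1\<close> by (simp add: norm_divide)
  also have "\<dots> \<le> 2"
    using norm_triangle_ineq4[of "cis s ^ S" 1] by (simp add: norm_power)
  finally have "norm (\<Sum>p<S. cis (real p * s)) * (2 * \<bar>s\<bar> / pi) \<le> 2"
    using mult_left_mono[OF ge, of "norm (\<Sum>p<S. cis (real p * s))"] by simp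
  then have "norm (\<Sum>p<S. cis (real p * s)) * \<bar>s\<bar> \<le> pi" by (simp add: field_simps)
  then show ?thesis using False by (simp add: dirichlet_def norm_divide)
qed auto

text \<open>At fixed \<open>r\<close> the bounds pass through three regimes: geometric growth while
  \<open>L i * r\<close> is at most 1, then at most one transitional term, then geometric decay once
  \<open>S i * r\<close> is at least 1. They contribute \<open>2 * B'\<close>, \<open>B\<close> and
  \<open>2 * E\<close>.\<close>

lemma lacunary_sum_bound:
  fixes S L f :: "nat \<Rightarrow> real"
  assumes r: "0 \<le> r" and B: "0 \<le> B" "0 \<le> B'" "0 \<le> E"
    and S: "\<And>i. 1 \<le> S i" "\<And>i. S i \<le> L i" "\<And>i. 2 * L i \<le> S (Suc i)"
    and f: "\<And>i. f i \<le> B" "\<And>i. f i \<le> B' * (L i * r)" "\<And>i. f i * (S i * r) \<le> E"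
  shows "(\<Sum>i<m. f i) \<le> 2 * B' + B + 2 * E"
proof -
  \<comment> \<open>The invariant: the first alternative holds before the transition, the second
    after it. The slack \<open>2 * E / (S m * r)\<close> in the latter at least halves at each step
    and thereby pays for the next term.\<close>
  have "((\<Sum>i<m. f i) \<le> B' * (L m * r) \<and> (\<Sum>i<m. f i) \<le> 2 * B') \<or>
     (1 \<le> S m * r \<and> (\<Sum>i<m. f i) \<le> 2 * B' + B + 2 * E * (1 - 1 / (S m * r)))" for m
  proof (induction m)
    case 0
    have "0 \<le> L 0" using S(1,2)[of 0] by simp
    then show ?case using r B by simp
  next
    case (Suc m)
    have L2: "2 * L m \<le> L (Suc m)" using S(2,3) order_trans by blast
    have S2: "2 * (S m * r) \<le> S (Suc m) * r"
      using mult_right_mono[OF order_trans[OF mult_left_mono[OF S(2)[of m], of 2] S(3)[of m]] r] by simp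
    from Suc show ?case
    proof (elim disjE conjE)
      assume s: "(\<Sum>i<m. f i) \<le> B' * (L m * r)" "(\<Sum>i<m. f i) \<le> 2 * B'"
      show ?thesis
      proof (cases "L m * r \<le> 1")
        case True
        have "(\<Sum>i<Suc m. f i) \<le> B' * (2 * (L m * r))" using s(1) f(2)[of m] by simp
        also have "B' * (2 * (L m * r)) \<le> B' * (L (Suc m) * r)"
          using L2 r B mult_right_mono[OF L2 r] by (intro mult_left_mono) auto
        finally have "(\<Sum>i<Suc m. f i) \<le> B' * (L (Suc m) * r)" .
        moreover have "B' * (2 * (L m * r)) \<le> 2 * B'" using True B mult_left_mono[of "L m * r" 1 B'] by (simp add: mult_ac)
        ultimately show ?thesis using \<open>(\<Sum>i<Suc m. f i) \<le> B' * (2 * (L m * r))\<close> by linarith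
      next
        case False
        then have 1: "1 \<le> S (Suc m) * r" using mult_right_mono[OF S(3)[of m] r] by simp
        then have "0 \<le> 2 * E * (1 - 1 / (S (Suc m) * r))" using B by simp
        then show ?thesis using 1 s(2) f(1)[of m] by simp
      qed
    next
      assume x: "1 \<le> S m * r" and s: "(\<Sum>i<m. f i) \<le> 2 * B' + B + 2 * E * (1 - 1 / (S m * r))"
      have x': "1 \<le> S (Suc m) * r" using S2 x by linarith
      have "f m \<le> E / (S m * r)" using f(3)[of m] x by (simp add: pos_le_divide_eq)
      moreover have "2 * E / (S (Suc m) * r) \<le> 2 * E / (2 * (S m * r))"
        using x S2 B by (intro divide_left_mono) auto
      ultimately show ?thesis using s x' by (simp add: right_diff_distrib)
    qed
  qed
  from this[of m] show ?thesis
  proof (elim disjE conjE)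
    assume "1 \<le> S m * r" "(\<Sum>i<m. f i) \<le> 2 * B' + B + 2 * E * (1 - 1 / (S m * r))"
    moreover from this have "2 * E * (1 - 1 / (S m * r)) \<le> 2 * E * 1" using B by (intro mult_left_mono) auto
    ultimately show ?thesis by simp
  qed (use B in simp)
qed

text \<open>The leading part of the image of a corrected oscillation, as a function of the angles
  \<open>s = \<xi>\<^sub>0 \<bullet> x\<close> and \<open>t = \<eta> \<bullet> x\<close>. It
  vanishes at \<open>s = t = 0\<close> exactly if the weights add up to \<open>b\<close>.\<close>

definition oscillation ::
  "'a set \<Rightarrow> ('a \<Rightarrow> complex) \<Rightarrow> ('a \<Rightarrow> int) \<Rightarrow> ('a \<Rightarrow> int) \<Rightarrow> complex \<Rightarrow> nat \<Rightarrow> real \<Rightarrow> real \<Rightarrow> complex" where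
  "oscillation A w p q b n s t =
     b * cis (real n * s) - (\<Sum>\<xi>\<in>A. w \<xi> * cis (real n * (of_int (p \<xi>) * s + of_int (q \<xi>) * t)))"

text \<open>Each summand is close to \<open>0\<close> near the lattice \<open>(2\<pi>\<int>)\<^sup>2\<close> on the scale \<open>1 / L i\<close>, and away from it on the
  scale \<open>1 / S i\<close>; for lacunary scales at most one summand is not small at a given point.\<close>

lemma localized_oscillation_bound:
  fixes p q :: "'a \<Rightarrow> int" and w :: "'a \<Rightarrow> complex" and S L :: "nat \<Rightarrow> nat"
  assumes b: "(\<Sum>\<xi>\<in>A. w \<xi>) = b"
    and SL: "\<forall>i. 1 \<le> S i \<and> S i \<le> L i \<and> 2 * L i \<le> S (Suc i)"
  shows "\<exists>K. \<forall>m s t. norm (\<Sum>i<m. dirichlet (S i) s * dirichlet (S i) t * oscillation A w p q b (L i) s t) \<le> K"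
proof (intro exI allI)
  fix m s t
  let ?h = "oscillation A w p q b"
  define B where "B = norm b + (\<Sum>\<xi>\<in>A. norm (w \<xi>))"
  define B' where "B' = norm b + (\<Sum>\<xi>\<in>A. norm (w \<xi>) * (\<bar>of_int (p \<xi>)\<bar> + \<bar>of_int (q \<xi>)\<bar>))"
  have nn: "0 \<le> B" "0 \<le> B'" by (auto simp: B_def B'_def intro!: add_nonneg_nonneg sum_nonneg)
  have cis_period: "cis (x - 2 * pi * of_int k) = cis x" for x k
    using cis_mult[of x "- (2 * pi * of_int k)"] cis_multiple_2pi[of "- of_int k"] by simp
  \<comment> \<open>The representative of an angle modulo 2 pi of least modulus. All frequencies are
    integers, so passing to it changes nothing, and estimates near 0 serve near every lattice
    point.\<close>
  define red where "red s = s - 2 * pi * of_int (round (s / (2 * pi)))" for s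
  have red_le: "\<bar>red s\<bar> \<le> pi" for s
  proof -
    have "\<bar>of_int (round (s / (2 * pi))) - s / (2 * pi)\<bar> \<le> 1 / 2" by (rule of_int_round_abs_le)
    then have "2 * pi * \<bar>of_int (round (s / (2 * pi))) - s / (2 * pi)\<bar> \<le> 2 * pi * (1 / 2)"
      by (intro mult_left_mono) auto
    moreover have "red s = 2 * pi * (s / (2 * pi) - of_int (round (s / (2 * pi))))"
      by (simp add: red_def right_diff_distrib)
    then have "\<bar>red s\<bar> = 2 * pi * \<bar>of_int (round (s / (2 * pi))) - s / (2 * pi)\<bar>"
      by (simp only: abs_mult abs_minus_commute) simp
    ultimately show ?thesis by simp
  qed
  have dred: "dirichlet n s = dirichlet n (red s)" for n s
  proof -
    have "cis (real p * red s) = cis (real p * s)" for p :: nat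
      using cis_period[of "real p * s" "int p * round (s / (2 * pi))"] by (simp add: red_def algebra_simps)
    then show ?thesis by (simp add: dirichlet_def)
  qed
  have hred: "?h n s t = ?h n (red s) (red t)" for n s t
  proof -
    have "cis (real n * red s) = cis (real n * s)"
      using cis_period[of "real n * s" "int n * round (s / (2 * pi))"] by (simp add: red_def algebra_simps)
    moreover have "cis (real n * (of_int (p \<xi>) * red s + of_int (q \<xi>) * red t)) = cis (real n * (of_int (p \<xi>) * s + of_int (q \<xi>) * t))" for \<xi>
      using cis_period[of "real n * (of_int (p \<xi>) * s + of_int (q \<xi>) * t)"
          "int n * (p \<xi> * round (s / (2 * pi)) + q \<xi> * round (t / (2 * pi)))"]
      by (simp add: red_def algebra_simps)
    ultimately show ?thesis by (simp add: oscillation_def)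
  qed
  have hB: "norm (?h n s t) \<le> B" for n s t
  proof -
    have "norm (?h n s t) \<le> norm (b * cis (real n * s)) + norm (\<Sum>\<xi>\<in>A. w \<xi> * cis (real n * (of_int (p \<xi>) * s + of_int (q \<xi>) * t)))"
      unfolding oscillation_def by (rule norm_triangle_ineq4)
    also have "\<dots> \<le> B"
      unfolding B_def by (intro add_mono order_trans[OF norm_sum]) (simp_all add: norm_mult)
    finally show ?thesis .
  qed
  define r where "r = max \<bar>red s\<bar> \<bar>red t\<bar>"
  have r: "0 \<le> r" "\<bar>red s\<bar> \<le> r" "\<bar>red t\<bar> \<le> r" by (auto simp: r_def)
  have hB': "norm (?h n (red s) (red t)) \<le> B' * (real n * r)" for n
  proof -
    let ?x = "\<lambda>\<xi>. real n * (of_int (p \<xi>) * red s + of_int (q \<xi>) * red t)"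
    \<comment> \<open>Since the weights add up to \<open>b\<close>, the constants cancel and only
      increments of exponentials remain.\<close>
    have "?h n (red s) (red t) = b * (cis (real n * red s) - 1) - (\<Sum>\<xi>\<in>A. w \<xi> * (cis (?x \<xi>) - 1))"
      by (simp add: oscillation_def right_diff_distrib sum_subtractf b)
    also have "norm \<dots> \<le> norm (b * (cis (real n * red s) - 1)) + norm (\<Sum>\<xi>\<in>A. w \<xi> * (cis (?x \<xi>) - 1))"
      by (rule norm_triangle_ineq4)
    also have "\<dots> \<le> norm b * (real n * r) + (\<Sum>\<xi>\<in>A. norm (w \<xi>) * ((\<bar>of_int (p \<xi>)\<bar> + \<bar>of_int (q \<xi>)\<bar>) * (real n * r)))"
    proof (intro add_mono order_trans[OF norm_sum sum_mono])
      show "norm (b * (cis (real n * red s) - 1)) \<le> norm b * (real n * r)"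
        unfolding norm_mult using r
        by (intro mult_left_mono order_trans[OF norm_cis_minus_one_le]) (auto simp: abs_mult mult_left_mono)
      fix \<xi>
      have "\<bar>?x \<xi>\<bar> \<le> real n * (\<bar>of_int (p \<xi>)\<bar> * r + \<bar>of_int (q \<xi>)\<bar> * r)"
        unfolding abs_mult abs_of_nat using r
        by (intro mult_left_mono order_trans[OF abs_triangle_ineq] add_mono) (auto simp: abs_mult mult_left_mono)
      then show "norm (w \<xi> * (cis (?x \<xi>) - 1)) \<le> norm (w \<xi>) * ((\<bar>of_int (p \<xi>)\<bar> + \<bar>of_int (q \<xi>)\<bar>) * (real n * r))"
        unfolding norm_mult
        by (intro mult_left_mono order_trans[OF norm_cis_minus_one_le]) (auto simp: algebra_simps)
    qed
    also have "\<dots> = B' * (real n * r)"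
      by (simp add: B'_def distrib_right sum_distrib_right mult.assoc)
    finally show ?thesis .
  qed
  define f where "f i = norm (dirichlet (S i) s * dirichlet (S i) t * ?h (L i) s t)" for i
  have dd: "norm (dirichlet (S i) s * dirichlet (S i) t) \<le> 1" for i
    unfolding norm_mult using dirichlet_le_one by (intro mult_le_one) auto
  have f1: "f i \<le> norm (?h (L i) s t)" for i
    unfolding f_def norm_mult[of "_ * _"] using dd by (intro mult_left_le_one_le) auto
  have "(\<Sum>i<m. f i) \<le> 2 * B' + B + 2 * (pi * B)"
  proof (rule lacunary_sum_bound[where r = r and S = "\<lambda>i. real (S i)" and L = "\<lambda>i. real (L i)"])
    show "f i \<le> B" for i using f1 hB order_trans by blast
    show "f i \<le> B' * (real (L i) * r)" for i using f1[of i] hB'[of "L i"] hred[of "L i" s t] by simp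
    show "f i * (real (S i) * r) \<le> pi * B" for i
    proof -
      \<comment> \<open>The kernel in the larger of the two reduced angles supplies the decay; the
        other kernel is at most 1.\<close>
      have "norm (dirichlet (S i) s * dirichlet (S i) t) * (real (S i) * r) \<le> pi"
      proof (cases "\<bar>red s\<bar> \<le> \<bar>red t\<bar>")
        case True
        then have "r = \<bar>red t\<bar>" by (simp add: r_def)
        then have "norm (dirichlet (S i) s) * (norm (dirichlet (S i) t) * (real (S i) * r)) \<le> 1 * pi"
          using dirichlet_decay[OF red_le, of "S i" t] dirichlet_le_one r unfolding dred[symmetric]
          by (intro mult_mono) auto
        then show ?thesis by (simp add: norm_mult mult.assoc)
      next
        case False
        then have "r = \<bar>red s\<bar>" by (simp add: r_def)
        then have "norm (dirichlet (S i) t) * (norm (dirichlet (S i) s) * (real (S i) * r)) \<le> 1 * pi"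
          using dirichlet_decay[OF red_le, of "S i" s] dirichlet_le_one r unfolding dred[symmetric]
          by (intro mult_mono) auto
        then show ?thesis by (simp add: norm_mult mult_ac)
      qed
      then have "norm (dirichlet (S i) s * dirichlet (S i) t) * (real (S i) * r) * norm (?h (L i) s t) \<le> pi * B"
        using hB by (intro mult_mono) auto
      then show ?thesis by (simp add: f_def norm_mult mult_ac)
    qed
    show "2 * real (L i) \<le> real (S (Suc i))" for i using SL by (metis of_nat_le_iff of_nat_mult of_nat_numeral)
  qed (use SL nn r in auto)
  then show "norm (\<Sum>i<m. dirichlet (S i) s * dirichlet (S i) t * ?h (L i) s t) \<le> 2 * B' + B + 2 * (pi * B)"
    unfolding f_def by (rule order_trans[OF norm_sum])
qed

section \<open>Weakly coercive systems are elliptic\<close>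

lemma ray_small_norm:
  "ray_small F \<Longrightarrow> ray_small (\<lambda>r \<zeta>. of_real (norm (F r \<zeta>)))"
  by (erule ray_small_cong) simp

section \<open>Averages over frequency shifts, and the alternative for affine forms\<close>

definition avg :: "nat \<Rightarrow> (nat \<Rightarrow> nat \<Rightarrow> complex) \<Rightarrow> complex" where
  "avg S f = (\<Sum>p<S. \<Sum>q<S. f p q) / of_nat S ^ 2"

lemma avg_diff_bound:
  assumes "\<And>p q. p < S \<Longrightarrow> q < S \<Longrightarrow> norm (f p q - g p q) \<le> c" "0 < S"
  shows "norm (avg S f - avg S g) \<le> c"
proof -
  have "norm (\<Sum>p<S. \<Sum>q<S. f p q - g p q) \<le> (\<Sum>p<S. \<Sum>q<S. c)"
    by (intro order_trans[OF norm_sum sum_mono]) (auto intro: assms)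
  then have "norm (\<Sum>p<S. \<Sum>q<S. f p q - g p q) / real S ^ 2 \<le> (\<Sum>p<S. \<Sum>q<S. c) / real S ^ 2"
    by (intro divide_right_mono) auto
  also have "\<dots> = c" using assms(2) by (simp add: power2_eq_square)
  finally show ?thesis
    by (simp add: avg_def sum_subtractf norm_divide norm_power flip: diff_divide_distrib)
qed

lemma avg_const: "0 < S \<Longrightarrow> avg S (\<lambda>p q. z) = z"
  by (simp add: avg_def power2_eq_square)

lemma avg_bound:
  assumes "\<And>p q. p < S \<Longrightarrow> q < S \<Longrightarrow> norm (f p q) \<le> c" "0 < S"
  shows "norm (avg S f) \<le> c"
  using avg_diff_bound[of S f "\<lambda>_ _. 0" c] assms by (simp add: avg_const)

text \<open>Averaging over shifts of the frequency is multiplication by two Dirichlet kernels, so a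
  finite combination of exponentials is localized and remains one.\<close>

lemma avg_dirichlet:
  "avg S (\<lambda>p q. cis (real p * s + real q * t) * z) = dirichlet S s * dirichlet S t * z"
proof -
  have "(\<Sum>p<S. \<Sum>q<S. cis (real p * s + real q * t) * z) = (\<Sum>p<S. cis (real p * s)) * (\<Sum>q<S. cis (real q * t)) * z"
    by (subst sum_product) (simp only: sum_distrib_right cis_mult)
  then show ?thesis by (simp add: avg_def dirichlet_def power2_eq_square)
qed

lemma lin_scaleR: "lin v (c *\<^sub>R \<zeta>) = of_real c * lin v \<zeta>"
  by (simp add: lin_def sum_distrib_left mult_ac)

lemma lin_add: "lin v (\<zeta> + \<eta>) = lin v \<zeta> + lin v \<eta>"
  by (simp add: lin_def distrib_left sum.distrib)

lemma Re_lin: "Re (lin v \<zeta>) = (\<chi> k. Re (v k)) \<bullet> \<zeta>" and Im_lin: "Im (lin v \<zeta>) = (\<chi> k. Im (v k)) \<bullet> \<zeta>"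
  by (simp_all add: lin_def inner_vec_def)

text \<open>Over the reals these are \<open>2N\<close> linear forms. If they are dependent, they and \<open>\<xi>\<close> span at most \<open>2N\<close> dimensions.\<close>

lemma complex_affine_alternative:
  fixes v :: "nat \<Rightarrow> 'n::finite \<Rightarrow> complex" and \<xi> :: "real^'n"
  assumes card: "2 * N + 1 \<le> CARD('n)"
  shows "(\<exists>\<eta>. \<forall>j\<in>{1..N}. lin (v j) \<eta> + b j = 0) \<or> (\<exists>\<eta>. \<eta> \<noteq> 0 \<and> \<xi> \<bullet> \<eta> = 0 \<and> (\<forall>j\<in>{1..N}. lin (v j) \<eta> = 0))"
proof -
  let ?J = "{1..N} \<times> (UNIV :: bool set)"
  define u where "u i = (if snd i then (\<chi> k. Re (v (fst i) k)) else (\<chi> k. Im (v (fst i) k)))" for i :: "nat \<times> bool"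
  define g where "g i \<eta> = u i \<bullet> \<eta>" for i \<eta>
  have finJ: "finite ?J" and cardJ: "card ?J = 2 * N" by (simp_all add: card_cartesian_product)
  have lin_g: "lin (v j) \<eta> = Complex (g (j, True) \<eta>) (g (j, False) \<eta>)" for j \<eta>
    by (rule complex_eqI) (simp_all add: Re_lin Im_lin g_def u_def)
  show ?thesis
  proof (cases "\<forall>c. (\<forall>\<eta>. (\<Sum>i\<in>?J. c i * g i \<eta>) = 0) \<longrightarrow> (\<forall>i\<in>?J. c i = 0)")
    case True
    define b' where "b' i = (if snd i then - Re (b (fst i)) else - Im (b (fst i)))" for i :: "nat \<times> bool"
    have "\<exists>\<Phi>\<in>eval_span UNIV. \<forall>i\<in>?J. \<Phi> (g i) = b' i"
      by (rule interpolation[OF finJ]) (use True in simp)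
    then obtain \<Phi> where "\<Phi> \<in> eval_span UNIV" and \<Phi>: "\<forall>i\<in>?J. \<Phi> (g i) = b' i" by auto
    then obtain A d where A: "finite A" "\<And>h. \<Phi> h = (\<Sum>\<xi>\<in>A. d \<xi> * h \<xi>)"
      using eval_span_finite_sum[of \<Phi> UNIV] by auto
    \<comment> \<open>On linear forms, a combination of evaluations is the evaluation at the same
      combination of points.\<close>
    define \<eta> where "\<eta> = (\<Sum>\<xi>\<in>A. d \<xi> *\<^sub>R \<xi>)"
    have "g i \<eta> = b' i" if "i \<in> ?J" for i
    proof -
      have "b' i = (\<Sum>\<xi>\<in>A. d \<xi> * g i \<xi>)" using \<Phi> that unfolding A(2) by (metis)
      then show ?thesis by (simp add: \<eta>_def g_def inner_sum_right)
    qed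
    then have "lin (v j) \<eta> + b j = 0" if "j \<in> {1..N}" for j
      using that by (simp add: lin_g b'_def complex_eq_iff)
    then show ?thesis by blast
  next
    case False
    then obtain c i\<^sub>0 where c: "\<And>\<eta>. (\<Sum>i\<in>?J. c i * g i \<eta>) = 0" and i0: "i\<^sub>0 \<in> ?J" "c i\<^sub>0 \<noteq> 0" by auto
    \<comment> \<open>One form is dropped on account of the dependence. The remaining ones and \<xi>
      are at most \<open>2 * N\<close> vectors, so some nonzero vector is orthogonal to all of them,
      and the relation then makes the dropped form vanish on it too.\<close>
    let ?T = "insert \<xi> (u ` (?J - {i\<^sub>0}))"
    have "dim ?T \<le> card ?T" by (rule dim_le_card') (use finJ in simp)
    also have "\<dots> \<le> Suc (card (u ` (?J - {i\<^sub>0})))" using finJ by (intro card_insert_le_m1) auto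
    also have "\<dots> \<le> Suc (card (?J - {i\<^sub>0}))" using finJ by (simp add: card_image_le)
    also have "\<dots> = 2 * N" using i0 finJ cardJ card_Suc_Diff1 by metis
    finally have "dim ?T < DIM(real^'n)" using card by simp
    then obtain \<eta> where \<eta>: "\<eta> \<noteq> 0" "\<And>y. y \<in> span ?T \<Longrightarrow> orthogonal \<eta> y"
      using orthogonal_to_subspace_exists by blast
    have orth: "y \<bullet> \<eta> = 0" if "y \<in> ?T" for y
      using \<eta>(2)[OF span_base[OF that]] by (simp add: orthogonal_def inner_commute)
    have g0: "g i \<eta> = 0" if "i \<in> ?J - {i\<^sub>0}" for i
      using orth[of "u i"] that by (simp add: g_def)
    have "(\<Sum>i\<in>?J. c i * g i \<eta>) = c i\<^sub>0 * g i\<^sub>0 \<eta> + (\<Sum>i\<in>?J - {i\<^sub>0}. c i * g i \<eta>)"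
      by (rule sum.remove[OF finJ i0(1)])
    then have "g i\<^sub>0 \<eta> = 0" using c[of \<eta>] i0(2) g0 by simp
    with g0 have "g i \<eta> = 0" if "i \<in> ?J" for i using that by (cases "i = i\<^sub>0") auto
    then have "lin (v j) \<eta> = 0" if "j \<in> {1..N}" for j
      using that by (simp add: lin_g complex_eq_iff)
    with \<eta>(1) orth[of \<xi>] show ?thesis by auto
  qed
qed

section \<open>Interpolation at integer combinations of two frequencies\<close>

definition int_lattice :: "real^'n::finite \<Rightarrow> real^'n \<Rightarrow> (real^'n) set" where
  "int_lattice \<xi> \<eta> = {of_int p *\<^sub>R \<xi> + of_int q *\<^sub>R \<eta> | p q. True}"

lemma principal_symbol_continuous: "continuous_on UNIV (principal_symbol l p)"
  by (rule smooth_continuous[OF poly_fun_smooth[OF principal_symbol_poly]])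

text \<open>Homogeneity passes from integer to rational coefficients, continuity from rational to
  real ones.\<close>

lemma lattice_zero_imp_span_zero:
  fixes F :: "real^'n::finite \<Rightarrow> complex"
  assumes F: "\<And>\<zeta>. \<zeta> \<in> int_lattice \<xi> \<eta> \<Longrightarrow> F \<zeta> = 0"
    and cont: "continuous_on UNIV F" and hom: "\<And>c \<zeta>. F (c *\<^sub>R \<zeta>) = of_real (c ^ l) * F \<zeta>"
    and \<zeta>: "\<zeta> \<in> span {\<xi>, \<eta>}"
  shows "F \<zeta> = 0"
proof -
  obtain s t where st: "\<zeta> = s *\<^sub>R \<xi> + t *\<^sub>R \<eta>"
  proof -
    obtain s where "\<zeta> - s *\<^sub>R \<xi> \<in> span {\<eta>}" using \<zeta> by (auto simp: span_breakdown_eq)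
    then obtain t where "\<zeta> - s *\<^sub>R \<xi> = t *\<^sub>R \<eta>" by (auto simp: span_singleton)
    then have "\<zeta> = s *\<^sub>R \<xi> + t *\<^sub>R \<eta>" by (simp add: algebra_simps)
    then show ?thesis by (rule that)
  qed
  define fl where "fl x n = of_int \<lfloor>x * real (Suc n)\<rfloor> / real (Suc n)" for x n
  have fl: "(\<lambda>n. fl x n) \<longlonglongrightarrow> x" for x
  proof (rule LIMSEQ_I)
    fix e :: real assume "0 < e"
    then obtain n\<^sub>0 where n0: "1 / real (Suc n\<^sub>0) < e" using nat_approx_posE by blast
    have "norm (fl x n - x) < e" if "n\<^sub>0 \<le> n" for n
    proof -
      have "\<bar>of_int \<lfloor>x * real (Suc n)\<rfloor> - x * real (Suc n)\<bar> \<le> 1" by linarith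
      then have "\<bar>(of_int \<lfloor>x * real (Suc n)\<rfloor> - x * real (Suc n)) / real (Suc n)\<bar> \<le> 1 / real (Suc n)"
        unfolding abs_divide by (simp add: divide_right_mono)
      moreover have "(of_int \<lfloor>x * real (Suc n)\<rfloor> - x * real (Suc n)) / real (Suc n) = fl x n - x"
        by (simp add: fl_def field_simps)
      moreover have "1 / real (Suc n) \<le> 1 / real (Suc n\<^sub>0)" using that by (simp add: frac_le)
      ultimately show ?thesis unfolding real_norm_def using n0 by (simp only:)
    qed
    then show "\<exists>n\<^sub>0. \<forall>n\<ge>n\<^sub>0. norm (fl x n - x) < e" by blast
  qed
  have "F (fl s n *\<^sub>R \<xi> + fl t n *\<^sub>R \<eta>) = 0" for n
  proof -
    have "fl s n *\<^sub>R \<xi> + fl t n *\<^sub>R \<eta> = (1 / real (Suc n)) *\<^sub>R (of_int \<lfloor>s * real (Suc n)\<rfloor> *\<^sub>R \<xi> + of_int \<lfloor>t * real (Suc n)\<rfloor> *\<^sub>R \<eta>)"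
      by (simp add: fl_def scaleR_add_right)
    moreover have "F (of_int \<lfloor>s * real (Suc n)\<rfloor> *\<^sub>R \<xi> + of_int \<lfloor>t * real (Suc n)\<rfloor> *\<^sub>R \<eta>) = 0"
      by (rule F) (auto simp: int_lattice_def)
    ultimately show ?thesis by (simp only: hom mult_zero_right)
  qed
  moreover have "(\<lambda>n. F (fl s n *\<^sub>R \<xi> + fl t n *\<^sub>R \<eta>)) \<longlonglongrightarrow> F (s *\<^sub>R \<xi> + t *\<^sub>R \<eta>)"
    by (rule continuous_on_tendsto_compose[OF cont tendsto_add[OF tendsto_scaleR[OF fl tendsto_const] tendsto_scaleR[OF fl tendsto_const]]]) auto
  ultimately have "(\<lambda>n. 0) \<longlonglongrightarrow> F (s *\<^sub>R \<xi> + t *\<^sub>R \<eta>)" by simp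
  then show ?thesis unfolding st using LIMSEQ_unique tendsto_const by blast
qed

text \<open>Independence on the plane survives restriction to the lattice. Interpolation points with
  integer coordinates are what makes the oscillations periodic in both angles.\<close>

lemma lattice_interpolation:
  fixes a :: "nat \<Rightarrow> 'n::finite multi_index \<Rightarrow> complex"
  assumes ind: "lin_indep_on (span {\<xi>, \<eta>}) N (\<lambda>j. principal_symbol l (a j))"
  shows "\<exists>A d. finite A \<and> A \<subseteq> int_lattice \<xi> \<eta> \<and> (\<forall>j\<in>{1..N}. (\<Sum>\<zeta>\<in>A. d \<zeta> * principal_symbol l (a j) \<zeta>) = b j)"
proof -
  let ?P = "\<lambda>j. principal_symbol l (a j)"
  have "\<exists>\<Phi>\<in>eval_span (int_lattice \<xi> \<eta>). \<forall>j\<in>{1..N}. \<Phi> (?P j) = b j"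
  proof (rule interpolation)
    fix c :: "nat \<Rightarrow> complex"
    assume z: "\<forall>\<zeta>\<in>int_lattice \<xi> \<eta>. (\<Sum>j\<in>{1..N}. c j * ?P j \<zeta>) = 0"
    have "(\<Sum>j\<in>{1..N}. c j * ?P j \<zeta>) = 0" if "\<zeta> \<in> span {\<xi>, \<eta>}" for \<zeta>
    proof (rule lattice_zero_imp_span_zero[where F = "\<lambda>\<zeta>. \<Sum>j\<in>{1..N}. c j * ?P j \<zeta>" and l = l, OF _ _ _ that])
      show "continuous_on UNIV (\<lambda>\<zeta>. \<Sum>j\<in>{1..N}. c j * ?P j \<zeta>)"
        by (intro continuous_on_sum continuous_on_mult continuous_on_const principal_symbol_continuous)
      show "(\<Sum>j\<in>{1..N}. c j * ?P j (r *\<^sub>R \<zeta>)) = of_real (r ^ l) * (\<Sum>j\<in>{1..N}. c j * ?P j \<zeta>)" for r \<zeta>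
        unfolding principal_symbol_scaleR sum_distrib_left by (simp only: mult.left_commute)
    qed (use z in simp)
    then show "\<forall>j\<in>{1..N}. c j = 0" using ind unfolding lin_indep_on_def by blast
  qed simp
  then obtain \<Phi> where "\<Phi> \<in> eval_span (int_lattice \<xi> \<eta>)" "\<forall>j\<in>{1..N}. \<Phi> (?P j) = b j" by auto
  moreover from eval_span_finite_sum[OF this(1)] obtain A d
    where "finite A" "A \<subseteq> int_lattice \<xi> \<eta>" "\<And>h. \<Phi> h = (\<Sum>\<xi>\<in>A. d \<xi> * h \<xi>)" by auto
  ultimately show ?thesis by (intro exI[of _ A] exI[of _ d]) simp
qed

text \<open>The situation at a common zero of the principal symbols, to be refuted: the term of
  order \<open>r\<close> is absent from the expansions, and Euler's relation makes the linear parts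
  vanish at \<open>\<xi>\<^sub>0\<close>.\<close>

locale degenerate_direction =
  fixes l N :: nat and a :: "nat \<Rightarrow> 'n::finite multi_index \<Rightarrow> complex" and C :: real
    and \<xi>\<^sub>0 :: "real^'n" and k\<^sub>0 :: 'n and v :: "nat \<Rightarrow> 'n \<Rightarrow> complex" and b :: "nat \<Rightarrow> complex"
  assumes l2: "2 \<le> l" and C: "coercivity_bound l N a C" and k\<^sub>0: "\<xi>\<^sub>0 $ k\<^sub>0 \<noteq> 0"
    and lin_v: "\<And>j. j \<in> {1..N} \<Longrightarrow> lin (v j) \<xi>\<^sub>0 = 0"
    and ray: "\<And>j. j \<in> {1..N} \<Longrightarrow>
      ray_small (\<lambda>r \<zeta>. symbol l (a j) (r *\<^sub>R \<xi>\<^sub>0 + \<zeta>) / of_real r ^ (l - 1) - (lin (v j) \<zeta> + b j))"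
begin

definition F :: "nat \<Rightarrow> real \<Rightarrow> real^'n \<Rightarrow> complex" where
  "F j r \<zeta> = symbol l (a j) (r *\<^sub>R \<xi>\<^sub>0 + \<zeta>) / of_real r ^ (l - 1) - (lin (v j) \<zeta> + b j)"

lemma F_small: "j \<in> {1..N} \<Longrightarrow> ray_small (F j)"
  using ray unfolding F_def[abs_def] .

text \<open>A derivative of the highest order that the estimate controls, in a coordinate in which
  \<open>\<xi>\<^sub>0\<close> is not 0, so that its symbol \<open>m\<^sub>0\<close> at
  \<open>\<xi>\<^sub>0\<close> is nonzero.\<close>

definition \<alpha>\<^sub>0 :: "'n multi_index" where "\<alpha>\<^sub>0 k = (if k = k\<^sub>0 then l - 1 else 0)"

definition m\<^sub>0 :: complex where "m\<^sub>0 = of_real (mi_power \<xi>\<^sub>0 \<alpha>\<^sub>0)"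

lemma \<alpha>\<^sub>0_size: "mi_size \<alpha>\<^sub>0 = l - 1"
  by (simp add: mi_size_def \<alpha>\<^sub>0_def)

lemma m\<^sub>0_nonzero: "m\<^sub>0 \<noteq> 0"
  using k\<^sub>0 by (auto simp: m\<^sub>0_def mi_power_def \<alpha>\<^sub>0_def)

lemma C_nonneg: "0 \<le> C"
  using C by (simp add: coercivity_bound_def)

lemma coercive_bound:
  assumes "\<Phi> \<in> eval_span UNIV"
    and "\<And>j x. j \<in> {1..N} \<Longrightarrow> norm (\<Phi> (\<lambda>\<zeta>. symbol l (a j) \<zeta> * cis (\<zeta> \<bullet> x))) \<le> c j"
    and "\<And>x. norm (\<Phi> (\<lambda>\<zeta>. cis (\<zeta> \<bullet> x))) \<le> c\<^sub>0"
  shows "norm (\<Phi> (\<lambda>\<zeta>. of_real (mi_power \<zeta> \<alpha>\<^sub>0))) \<le> C * ((\<Sum>j=1..N. c j) + c\<^sub>0)"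
proof -
  have "mi_size \<alpha>\<^sub>0 < l" using l2 by (simp add: \<alpha>\<^sub>0_size)
  with C[unfolded coercivity_bound_def, THEN conjunct2, rule_format, OF assms(1)] assms(2,3)
  show ?thesis by simp
qed

definition F\<^sub>0 :: "real \<Rightarrow> real^'n \<Rightarrow> complex" where
  "F\<^sub>0 r \<zeta> = of_real (mi_power (r *\<^sub>R \<xi>\<^sub>0 + \<zeta>) \<alpha>\<^sub>0) / of_real r ^ (l - 1) - m\<^sub>0"

lemma F\<^sub>0_small: "ray_small F\<^sub>0"
  using mi_power_ray[of \<xi>\<^sub>0 \<alpha>\<^sub>0] unfolding F\<^sub>0_def[abs_def] m\<^sub>0_def \<alpha>\<^sub>0_size .

text \<open>Take one exponential of frequency \<open>r \<xi>\<^sub>0 + \<eta>\<close>, divided by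
  \<open>r ^ (l - 1)\<close>. Its images reduce to the remainders \<open>F j\<close>, of order
  \<open>1 / r\<close>, while its derivative of index \<open>\<alpha>\<^sub>0\<close> at 0 tends to
  \<open>m\<^sub>0\<close>.\<close>

lemma no_affine_zero: "\<not> (\<forall>j\<in>{1..N}. lin (v j) \<eta> + b j = 0)"
proof
  assume \<eta>: "\<forall>j\<in>{1..N}. lin (v j) \<eta> + b j = 0"
  let ?G = "\<lambda>r \<zeta>. (\<Sum>j\<in>{1..N}. complex_of_real (norm (F j r \<zeta>))) + of_real (norm (F\<^sub>0 r \<zeta>))"
  have "ray_small ?G"
    by (intro ray_small_add ray_small_sum ray_small_norm F\<^sub>0_small F_small)
  then obtain c M where G: "0 \<le> c" "\<And>r \<zeta>. 1 \<le> r \<Longrightarrow> norm (?G r \<zeta>) \<le> c / r * (1 + norm \<zeta>) ^ M"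
    by (rule ray_smallE) blast
  define W where "W = c * (1 + norm \<eta>) ^ M"
  have W0: "0 \<le> W" using G(1) by (simp add: W_def)
  have main: "norm m\<^sub>0 \<le> (W + C * (real N * W + 1)) / r" if r: "1 \<le> r" for r
  proof -
    have "?G r \<eta> = of_real ((\<Sum>j\<in>{1..N}. norm (F j r \<eta>)) + norm (F\<^sub>0 r \<eta>))" by simp
    then have "norm (?G r \<eta>) = (\<Sum>j\<in>{1..N}. norm (F j r \<eta>)) + norm (F\<^sub>0 r \<eta>)"
      by (simp only: norm_of_real) (simp add: sum_nonneg)
    with G(2)[OF r, of \<eta>] have sum: "(\<Sum>j\<in>{1..N}. norm (F j r \<eta>)) + norm (F\<^sub>0 r \<eta>) \<le> W / r"
      by (simp add: W_def)
    have F: "norm (F j r \<eta>) \<le> W / r" if j: "j \<in> {1..N}" for j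
    proof -
      have "norm (F j r \<eta>) \<le> (\<Sum>j\<in>{1..N}. norm (F j r \<eta>))"
        by (rule member_le_sum[where f = "\<lambda>j. norm (F j r \<eta>)"]) (use j in auto)
      then show ?thesis using sum norm_ge_zero[of "F\<^sub>0 r \<eta>"] by linarith
    qed
    have F0: "norm (F\<^sub>0 r \<eta>) \<le> W / r"
      using sum sum_nonneg[of "{1..N}" "\<lambda>j. norm (F j r \<eta>)"] by simp
    let ?\<Phi> = "\<lambda>h. (1 / of_real r ^ (l - 1)) * h (r *\<^sub>R \<xi>\<^sub>0 + \<eta>) :: complex"
    have "norm (?\<Phi> (\<lambda>\<zeta>. of_real (mi_power \<zeta> \<alpha>\<^sub>0))) \<le> C * ((\<Sum>j=1..N. W / r) + 1 / r)"
    proof (rule coercive_bound)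
      show "?\<Phi> \<in> eval_span UNIV" by (intro eval_span_cmult eval_span_ev) simp
      fix j x assume j: "j \<in> {1..N}"
      have "?\<Phi> (\<lambda>\<zeta>. symbol l (a j) \<zeta> * cis (\<zeta> \<bullet> x)) = F j r \<eta> * cis ((r *\<^sub>R \<xi>\<^sub>0 + \<eta>) \<bullet> x)"
        using \<eta> j by (simp add: F_def)
      then show "norm (?\<Phi> (\<lambda>\<zeta>. symbol l (a j) \<zeta> * cis (\<zeta> \<bullet> x))) \<le> W / r"
        using F[OF j] by (simp add: norm_mult)
    next
      fix x
      \<comment> \<open>Here \<open>l\<close> being at least 2 makes the function itself small
        too.\<close>
      have "1 / r ^ (l - 1) \<le> 1 / r ^ 1"
        using r l2 by (intro divide_left_mono power_increasing mult_pos_pos zero_less_power) auto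
      then show "norm (?\<Phi> (\<lambda>\<zeta>. cis (\<zeta> \<bullet> x))) \<le> 1 / r"
        using r by (simp add: norm_mult norm_divide norm_power)
    qed
    moreover have "?\<Phi> (\<lambda>\<zeta>. of_real (mi_power \<zeta> \<alpha>\<^sub>0)) = m\<^sub>0 + F\<^sub>0 r \<eta>" by (simp add: F\<^sub>0_def)
    ultimately have "norm (m\<^sub>0 + F\<^sub>0 r \<eta>) \<le> C * (real N * (W / r) + 1 / r)" by simp
    then have "norm m\<^sub>0 \<le> C * (real N * (W / r) + 1 / r) + W / r"
      using F0 norm_triangle_ineq4[of "m\<^sub>0 + F\<^sub>0 r \<eta>" "F\<^sub>0 r \<eta>"] by simp
    also have "\<dots> = (W + C * (real N * W + 1)) / r" by (simp add: add_divide_distrib distrib_left)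
    finally show ?thesis .
  qed
  define K where "K = W + C * (real N * W + 1)"
  have K0: "0 \<le> K" using W0 C_nonneg by (simp add: K_def)
  \<comment> \<open>With this choice \<open>norm m\<^sub>0 * r\<close> equals
    \<open>norm m\<^sub>0 + K\<close>, which exceeds the bound \<open>K\<close>.\<close>
  define r where "r = 1 + K / norm m\<^sub>0"
  have r: "1 \<le> r" using K0 by (simp add: r_def)
  have "norm m\<^sub>0 * r \<le> K" using main[OF r] r by (simp add: K_def pos_le_divide_eq)
  moreover have "norm m\<^sub>0 * r = norm m\<^sub>0 + K" using m\<^sub>0_nonzero by (simp add: r_def distrib_left)
  ultimately show False using m\<^sub>0_nonzero by simp
qed

text \<open>The functional \<open>\<Phi> i\<close> below stands for a function that oscillates at frequency about \<open>L i *\<^sub>R \<xi>\<^sub>0\<close> and is localized on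
  the scale \<open>1 / S i\<close>. Its derivative of index \<open>\<alpha>\<^sub>0\<close> at \<open>0\<close> is about \<open>m\<^sub>0\<close>; the terms indexed by \<open>A\<close>, which hardly affect
  that derivative, make the image under each operator vanish at \<open>0\<close>. Hence the sum of the images over \<open>m\<close> lacunary scales
  stays bounded, while the derivative grows like \<open>m\<close>.\<close>

lemma no_planar_degeneracy:
  assumes \<eta>: "\<And>j. j \<in> {1..N} \<Longrightarrow> lin (v j) \<eta> = 0"
    and ind: "lin_indep_on (span {\<xi>\<^sub>0, \<eta>}) N (\<lambda>j. principal_symbol l (a j))"
  shows False
proof -
  let ?P = "\<lambda>j. principal_symbol l (a j)"
  \<comment> \<open>One set of weights serves all operators: the corrections cancel every constant
    \<open>b j\<close> at the origin.\<close>
  obtain A d where finA: "finite A" and A: "A \<subseteq> int_lattice \<xi>\<^sub>0 \<eta>"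
    and dP': "\<forall>j\<in>{1..N}. (\<Sum>\<zeta>\<in>A. d \<zeta> * ?P j \<zeta>) = b j"
    using lattice_interpolation[OF ind, of b] by (elim exE conjE)
  have dP: "(\<Sum>\<zeta>\<in>A. d \<zeta> * ?P j \<zeta>) = b j" if "j \<in> {1..N}" for j using dP' that by blast
  have "\<forall>\<zeta>\<in>A. \<exists>p q. \<zeta> = of_int p *\<^sub>R \<xi>\<^sub>0 + of_int q *\<^sub>R \<eta>"
    using A by (auto simp: int_lattice_def)
  then obtain p q where pq: "\<And>\<zeta>. \<zeta> \<in> A \<Longrightarrow> \<zeta> = of_int (p \<zeta>) *\<^sub>R \<xi>\<^sub>0 + of_int (q \<zeta>) *\<^sub>R \<eta>" by metis
  define H where "H j \<xi> r \<zeta> = symbol l (a j) (r *\<^sub>R \<xi> + \<zeta>) / of_real r ^ l - ?P j \<xi>" for j \<xi> r \<zeta>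
  define H\<^sub>0 where "H\<^sub>0 \<xi> r \<zeta> = complex_of_real (mi_power (r *\<^sub>R \<xi> + \<zeta>) \<alpha>\<^sub>0) / of_real r ^ l" for \<xi> r \<zeta>
  have H: "ray_small (H j \<xi>)" for j \<xi>
    unfolding H_def[abs_def] using l2 by (intro symbol_ray_leading) simp
  have H0: "ray_small (H\<^sub>0 \<xi>)" for \<xi>
    unfolding H\<^sub>0_def[abs_def] using l2 by (intro mi_power_ray_higher) (simp add: \<alpha>\<^sub>0_size)
  \<comment> \<open>A single function dominating all remainders, so that one exponent
    \<open>M\<close> is known before the scales are chosen.\<close>
  define g where "g r \<zeta> = (\<Sum>j\<in>{1..N}. norm (F j r \<zeta>) + (\<Sum>\<xi>\<in>A. norm (d \<xi>) * norm (H j \<xi> r \<zeta>)))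
      + (norm (F\<^sub>0 r \<zeta>) + (\<Sum>\<xi>\<in>A. norm (d \<xi>) * norm (H\<^sub>0 \<xi> r \<zeta>)))" for r \<zeta>
  have "ray_small (\<lambda>r \<zeta>. (\<Sum>j\<in>{1..N}. complex_of_real (norm (F j r \<zeta>)) + (\<Sum>\<xi>\<in>A. of_real (norm (d \<xi>)) * of_real (norm (H j \<xi> r \<zeta>))))
      + (of_real (norm (F\<^sub>0 r \<zeta>)) + (\<Sum>\<xi>\<in>A. of_real (norm (d \<xi>)) * of_real (norm (H\<^sub>0 \<xi> r \<zeta>)))))"
    by (intro ray_small_add ray_small_sum ray_small_cmult ray_small_norm F\<^sub>0_small F_small H H0)
  then have "ray_small (\<lambda>r \<zeta>. complex_of_real (g r \<zeta>))" by (simp add: g_def)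
  then obtain c M where c: "0 \<le> c" "\<And>r \<zeta>. 1 \<le> r \<Longrightarrow> norm (complex_of_real (g r \<zeta>)) \<le> c / r * (1 + norm \<zeta>) ^ M"
    by (rule ray_smallE) blast
  have nn: "0 \<le> (\<Sum>\<xi>\<in>A. norm (d \<xi>) * norm (H j \<xi> r \<zeta>))" "0 \<le> (\<Sum>\<xi>\<in>A. norm (d \<xi>) * norm (H\<^sub>0 \<xi> r \<zeta>))"
    "0 \<le> (\<Sum>j\<in>{1..N}. norm (F j r \<zeta>) + (\<Sum>\<xi>\<in>A. norm (d \<xi>) * norm (H j \<xi> r \<zeta>)))" for j r \<zeta>
    by (intro sum_nonneg add_nonneg_nonneg mult_nonneg_nonneg norm_ge_zero)+
  have gF: "norm (F j r \<zeta>) + (\<Sum>\<xi>\<in>A. norm (d \<xi>) * norm (H j \<xi> r \<zeta>)) \<le> g r \<zeta>" if "j \<in> {1..N}" for j r \<zeta>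
  proof -
    have "norm (F j r \<zeta>) + (\<Sum>\<xi>\<in>A. norm (d \<xi>) * norm (H j \<xi> r \<zeta>))
        \<le> (\<Sum>j\<in>{1..N}. norm (F j r \<zeta>) + (\<Sum>\<xi>\<in>A. norm (d \<xi>) * norm (H j \<xi> r \<zeta>)))"
      by (rule member_le_sum[where f = "\<lambda>j. norm (F j r \<zeta>) + (\<Sum>\<xi>\<in>A. norm (d \<xi>) * norm (H j \<xi> r \<zeta>))"])
        (use that nn(1) in auto)
    then show ?thesis unfolding g_def using nn(2)[of r \<zeta>] norm_ge_zero[of "F\<^sub>0 r \<zeta>"] by linarith
  qed
  have gF0: "norm (F\<^sub>0 r \<zeta>) + (\<Sum>\<xi>\<in>A. norm (d \<xi>) * norm (H\<^sub>0 \<xi> r \<zeta>)) \<le> g r \<zeta>" for r \<zeta>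
    unfolding g_def using nn(3)[of r \<zeta>] by linarith
  define c\<^sub>0 where "c\<^sub>0 = 1 + norm \<xi>\<^sub>0 + norm \<eta>"
  define W where "W = c * c\<^sub>0 ^ M"
  have W0: "0 \<le> W" unfolding W_def c\<^sub>0_def using c(1) by simp
  \<comment> \<open>Shifts at stage \<open>i\<close> have size of order \<open>S i\<close>, so the
    remainders are of order \<open>S i ^ M / L i\<close>. Taking
    \<open>L i = 2 ^ i * S i ^ (M + 1)\<close> makes them summable, and
    \<open>S (Suc i) = 2 * L i\<close> gives the lacunarity.\<close>
  define S :: "nat \<Rightarrow> nat" where "S = rec_nat 1 (\<lambda>i s. 2 * (2 ^ i * s ^ (M + 1)))"
  define L where "L i = 2 ^ i * S i ^ (M + 1)" for i
  have S_Suc: "S (Suc i) = 2 * L i" and S_0: "S 0 = 1" for i by (simp_all add: S_def L_def)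
  have S1: "1 \<le> S i" for i
    by (induction i) (simp_all add: S_0 S_Suc L_def)
  have SL: "S i \<le> L i" for i
  proof -
    have "S i * 1 \<le> S i * (2 ^ i * S i ^ M)" using S1[of i] by (intro mult_le_mono) auto
    then show ?thesis by (simp add: L_def mult_ac)
  qed
  have L2: "2 ^ i \<le> real (L i)" for i
  proof -
    have "(2::nat) ^ i * 1 \<le> 2 ^ i * S i ^ (M + 1)" using S1[of i] by (intro mult_le_mono) auto
    then have "real (2 ^ i) \<le> real (L i)" unfolding L_def by (simp only: of_nat_le_iff mult_1_right)
    then show ?thesis by simp
  qed
  have L1: "1 \<le> real (L i)" for i
    by (rule order_trans[OF _ L2[of i]]) simp
  define z where "z p q = real p *\<^sub>R \<xi>\<^sub>0 + real q *\<^sub>R \<eta>" for p q :: nat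
  have gz: "g (real (L i)) (z p q) \<le> W / 2 ^ i" if "p < S i" "q < S i" for i p q
  proof -
    have "norm (z p q) \<le> real p * norm \<xi>\<^sub>0 + real q * norm \<eta>"
      unfolding z_def by (rule order_trans[OF norm_triangle_ineq]) simp
    also have "\<dots> \<le> real (S i) * norm \<xi>\<^sub>0 + real (S i) * norm \<eta>"
      using that by (intro add_mono mult_right_mono) auto
    finally have "1 + norm (z p q) \<le> real (S i) * c\<^sub>0"
      using S1[of i] by (simp add: c\<^sub>0_def distrib_left)
    then have "(1 + norm (z p q)) ^ M \<le> (real (S i) * c\<^sub>0) ^ M" by (intro power_mono) auto
    then have "c / real (L i) * (1 + norm (z p q)) ^ M \<le> c / real (L i) * (real (S i) * c\<^sub>0) ^ M"
      using c(1) by (intro mult_left_mono) auto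
    moreover have "g (real (L i)) (z p q) \<le> norm (complex_of_real (g (real (L i)) (z p q)))" by simp
    ultimately have "g (real (L i)) (z p q) \<le> c / real (L i) * (real (S i) * c\<^sub>0) ^ M"
      using c(2)[OF L1[of i], of "z p q"] by linarith
    also have "\<dots> = W / 2 ^ i / real (S i)"
      using S1[of i] by (simp add: W_def L_def power_mult_distrib field_simps)
    also have "\<dots> \<le> W / 2 ^ i / 1" using S1[of i] W0 by (intro divide_left_mono) auto
    finally show ?thesis by simp
  qed
  let ?r = "\<lambda>i. complex_of_real (real (L i))"
  \<comment> \<open>The main exponential is divided by the power \<open>l - 1\<close>, the growth of
    its symbol along the degenerate ray; the corrections by the power \<open>l\<close>, that of the
    principal symbols. Their derivative of order \<open>l - 1\<close> is then only of order
    \<open>1 / L i\<close>.\<close>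
  define T where "T i p q h = (1 / ?r i ^ (l - 1)) * h (real (L i) *\<^sub>R \<xi>\<^sub>0 + z p q)
      + (- 1) * (\<Sum>\<xi>\<in>A. (d \<xi> / ?r i ^ l) * h (real (L i) *\<^sub>R \<xi> + z p q))" for i p q and h :: "real^'n \<Rightarrow> complex"
  define \<Phi> where "\<Phi> i h = avg (S i) (\<lambda>p q. T i p q h)" for i and h :: "real^'n \<Rightarrow> complex"
  have \<Phi>_span: "\<Phi> i \<in> eval_span UNIV" for i
  proof -
    have "(\<lambda>h. (1 / of_nat (S i) ^ 2) * (\<Sum>p<S i. \<Sum>q<S i. T i p q h)) \<in> eval_span UNIV"
      unfolding T_def by (intro eval_span_cmult eval_span_sum eval_span_add eval_span_ev UNIV_I)
    then show ?thesis by (simp add: \<Phi>_def[abs_def] avg_def)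
  qed
  define h where "h j i = oscillation A (\<lambda>\<xi>. d \<xi> * ?P j \<xi>) p q (b j) (L i)" for j i
  have \<Phi>P: "norm (\<Phi> i (\<lambda>\<zeta>. symbol l (a j) \<zeta> * cis (\<zeta> \<bullet> x))
      - dirichlet (S i) (\<xi>\<^sub>0 \<bullet> x) * dirichlet (S i) (\<eta> \<bullet> x) * h j i (\<xi>\<^sub>0 \<bullet> x) (\<eta> \<bullet> x)) \<le> W / 2 ^ i"
    if j: "j \<in> {1..N}" for i j x
    unfolding \<Phi>_def avg_dirichlet[symmetric]
  proof (rule avg_diff_bound)
    show "0 < S i" using S1[of i] by simp
    fix p' q' assume p'q': "p' < S i" "q' < S i"
    let ?z = "z p' q'" and ?L = "real (L i)"
    \<comment> \<open>The shifts stay in the plane on which all linear parts vanish, so localization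
      leaves the leading coefficient \<open>b j\<close> unchanged.\<close>
    have linz: "lin (v j) ?z = 0" by (simp add: z_def lin_add lin_scaleR \<eta>[OF j] lin_v[OF j])
    have e0: "cis (real p' * (\<xi>\<^sub>0 \<bullet> x) + real q' * (\<eta> \<bullet> x)) * cis (?L * (\<xi>\<^sub>0 \<bullet> x)) = cis ((?L *\<^sub>R \<xi>\<^sub>0 + ?z) \<bullet> x)"
      by (simp add: cis_mult z_def inner_add_left add_ac)
    have e: "cis (real p' * (\<xi>\<^sub>0 \<bullet> x) + real q' * (\<eta> \<bullet> x)) * cis (?L * (of_int (p \<xi>) * (\<xi>\<^sub>0 \<bullet> x) + of_int (q \<xi>) * (\<eta> \<bullet> x)))
        = cis ((?L *\<^sub>R \<xi> + ?z) \<bullet> x)" if "\<xi> \<in> A" for \<xi>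
    proof -
      have "\<xi> \<bullet> x = of_int (p \<xi>) * (\<xi>\<^sub>0 \<bullet> x) + of_int (q \<xi>) * (\<eta> \<bullet> x)"
        by (subst pq[OF that]) (simp add: inner_add_left)
      then show ?thesis by (simp add: cis_mult z_def inner_add_left add_ac)
    qed
    have "cis (real p' * (\<xi>\<^sub>0 \<bullet> x) + real q' * (\<eta> \<bullet> x)) * h j i (\<xi>\<^sub>0 \<bullet> x) (\<eta> \<bullet> x)
        = b j * cis ((?L *\<^sub>R \<xi>\<^sub>0 + ?z) \<bullet> x) - (\<Sum>\<xi>\<in>A. d \<xi> * ?P j \<xi> * cis ((?L *\<^sub>R \<xi> + ?z) \<bullet> x))"
    proof -
      have "cis (real p' * (\<xi>\<^sub>0 \<bullet> x) + real q' * (\<eta> \<bullet> x)) * (\<Sum>\<xi>\<in>A. d \<xi> * ?P j \<xi> * cis (?L * (of_int (p \<xi>) * (\<xi>\<^sub>0 \<bullet> x) + of_int (q \<xi>) * (\<eta> \<bullet> x))))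
         = (\<Sum>\<xi>\<in>A. d \<xi> * ?P j \<xi> * cis ((?L *\<^sub>R \<xi> + ?z) \<bullet> x))"
        unfolding sum_distrib_left by (intro sum.cong refl) (simp only: e[symmetric] mult_ac)
      then show ?thesis unfolding h_def oscillation_def right_diff_distrib e0[symmetric] by (simp only: mult_ac)
    qed
    then have eq: "T i p' q' (\<lambda>\<zeta>. symbol l (a j) \<zeta> * cis (\<zeta> \<bullet> x)) - cis (real p' * (\<xi>\<^sub>0 \<bullet> x) + real q' * (\<eta> \<bullet> x)) * h j i (\<xi>\<^sub>0 \<bullet> x) (\<eta> \<bullet> x)
        = F j ?L ?z * cis ((?L *\<^sub>R \<xi>\<^sub>0 + ?z) \<bullet> x) - (\<Sum>\<xi>\<in>A. d \<xi> * H j \<xi> ?L ?z * cis ((?L *\<^sub>R \<xi> + ?z) \<bullet> x))"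
      by (simp add: T_def F_def H_def linz left_diff_distrib right_diff_distrib sum_subtractf mult_ac)
    show "norm (T i p' q' (\<lambda>\<zeta>. symbol l (a j) \<zeta> * cis (\<zeta> \<bullet> x)) - cis (real p' * (\<xi>\<^sub>0 \<bullet> x) + real q' * (\<eta> \<bullet> x)) * h j i (\<xi>\<^sub>0 \<bullet> x) (\<eta> \<bullet> x)) \<le> W / 2 ^ i"
      unfolding eq
    proof (rule order_trans[OF norm_triangle_ineq4 order_trans[OF _ order_trans[OF gF[OF j] gz[OF p'q']]]], rule add_mono)
      show "norm (\<Sum>\<xi>\<in>A. d \<xi> * H j \<xi> ?L ?z * cis ((?L *\<^sub>R \<xi> + ?z) \<bullet> x)) \<le> (\<Sum>\<xi>\<in>A. norm (d \<xi>) * norm (H j \<xi> ?L ?z))"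
        by (rule order_trans[OF norm_sum]) (simp add: norm_mult)
    qed (simp add: norm_mult)
  qed
  define D' where "D' = 1 + (\<Sum>\<xi>\<in>A. norm (d \<xi>))"
  have \<Phi>u: "norm (\<Phi> i (\<lambda>\<zeta>. cis (\<zeta> \<bullet> x))) \<le> D' / 2 ^ i" for i x
    unfolding \<Phi>_def
  proof (rule avg_bound)
    show "0 < S i" using S1[of i] by simp
    fix p' q' assume "p' < S i" "q' < S i"
    let ?L = "real (L i)"
    have inv: "1 / ?L ^ n \<le> 1 / 2 ^ i" if "1 \<le> n" for n
    proof -
      have "2 ^ i \<le> ?L ^ 1" using L2 by simp
      also have "\<dots> \<le> ?L ^ n" using L1[of i] that by (intro power_increasing) auto
      finally show ?thesis by (intro divide_left_mono) (use L1[of i] in auto)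
    qed
    have "norm (T i p' q' (\<lambda>\<zeta>. cis (\<zeta> \<bullet> x))) \<le> norm ((1 / ?r i ^ (l - 1)) * cis ((?L *\<^sub>R \<xi>\<^sub>0 + z p' q') \<bullet> x))
        + norm (\<Sum>\<xi>\<in>A. (d \<xi> / ?r i ^ l) * cis ((?L *\<^sub>R \<xi> + z p' q') \<bullet> x))"
      unfolding T_def by (rule order_trans[OF norm_triangle_ineq]) simp
    also have "\<dots> \<le> 1 / ?L ^ (l - 1) + (\<Sum>\<xi>\<in>A. norm (d \<xi>) * (1 / ?L ^ l))"
      by (intro add_mono order_trans[OF norm_sum sum_mono]) (simp_all add: norm_mult norm_divide norm_power)
    also have "\<dots> \<le> 1 / 2 ^ i + (\<Sum>\<xi>\<in>A. norm (d \<xi>) * (1 / 2 ^ i))"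
      using l2 by (intro add_mono sum_mono mult_left_mono inv) auto
    also have "\<dots> = D' / 2 ^ i" by (simp add: D'_def add_divide_distrib sum_divide_distrib)
    finally show "norm (T i p' q' (\<lambda>\<zeta>. cis (\<zeta> \<bullet> x))) \<le> D' / 2 ^ i" .
  qed
  have \<Phi>m: "norm (\<Phi> i (\<lambda>\<zeta>. of_real (mi_power \<zeta> \<alpha>\<^sub>0)) - m\<^sub>0) \<le> W / 2 ^ i" for i
  proof -
    have pos: "0 < S i" using S1[of i] by simp
    have "norm (\<Phi> i (\<lambda>\<zeta>. of_real (mi_power \<zeta> \<alpha>\<^sub>0)) - avg (S i) (\<lambda>p q. m\<^sub>0)) \<le> W / 2 ^ i"
      unfolding \<Phi>_def
    proof (rule avg_diff_bound[OF _ pos])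
      fix p' q' assume p'q': "p' < S i" "q' < S i"
      let ?z = "z p' q'" and ?L = "real (L i)"
      have "T i p' q' (\<lambda>\<zeta>. of_real (mi_power \<zeta> \<alpha>\<^sub>0)) - m\<^sub>0 = F\<^sub>0 ?L ?z - (\<Sum>\<xi>\<in>A. d \<xi> * H\<^sub>0 \<xi> ?L ?z)"
        by (simp add: T_def F\<^sub>0_def H\<^sub>0_def)
      also have "norm \<dots> \<le> norm (F\<^sub>0 ?L ?z) + (\<Sum>\<xi>\<in>A. norm (d \<xi>) * norm (H\<^sub>0 \<xi> ?L ?z))"
        by (rule order_trans[OF norm_triangle_ineq4]) (intro add_mono order_trans[OF norm_sum], simp_all add: norm_mult)
      also have "\<dots> \<le> W / 2 ^ i" by (rule order_trans[OF gF0 gz[OF p'q']])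
      finally show "norm (T i p' q' (\<lambda>\<zeta>. of_real (mi_power \<zeta> \<alpha>\<^sub>0)) - m\<^sub>0) \<le> W / 2 ^ i" .
    qed
    then show ?thesis by (simp add: avg_const[OF pos])
  qed
  have "\<exists>K. \<forall>m x. norm (\<Sum>i<m. dirichlet (S i) (\<xi>\<^sub>0 \<bullet> x) * dirichlet (S i) (\<eta> \<bullet> x) * h j i (\<xi>\<^sub>0 \<bullet> x) (\<eta> \<bullet> x)) \<le> K"
    if j: "j \<in> {1..N}" for j
  proof -
    have "\<forall>i. 1 \<le> S i \<and> S i \<le> L i \<and> 2 * L i \<le> S (Suc i)" using S1 SL S_Suc by simp
    from localized_oscillation_bound[OF dP[OF j] this, of p q]
    have "\<exists>K. \<forall>m s t. norm (\<Sum>i<m. dirichlet (S i) s * dirichlet (S i) t * h j i s t) \<le> K"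
      unfolding h_def .
    then show ?thesis by blast
  qed
  then have "\<forall>j\<in>{1..N}. \<exists>K. \<forall>m x. norm (\<Sum>i<m. dirichlet (S i) (\<xi>\<^sub>0 \<bullet> x) * dirichlet (S i) (\<eta> \<bullet> x) * h j i (\<xi>\<^sub>0 \<bullet> x) (\<eta> \<bullet> x)) \<le> K" by blast
  from bchoice[OF this] obtain K where K: "\<And>j m x. j \<in> {1..N} \<Longrightarrow>
      norm (\<Sum>i<m. dirichlet (S i) (\<xi>\<^sub>0 \<bullet> x) * dirichlet (S i) (\<eta> \<bullet> x) * h j i (\<xi>\<^sub>0 \<bullet> x) (\<eta> \<bullet> x)) \<le> K j" by blast
  have geo: "(\<Sum>i<m. Y / 2 ^ i) \<le> 2 * Y" if "0 \<le> Y" for Y :: real and m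
  proof -
    have "(\<Sum>i<m. Y / 2 ^ i) = 2 * Y - 2 * Y / 2 ^ m"
      by (induction m) (simp_all add: field_simps)
    then show ?thesis using that by simp
  qed
  have D'0: "0 \<le> D'" by (simp add: D'_def sum_nonneg add_nonneg_nonneg)
  define Z where "Z = 2 * W + C * ((\<Sum>j=1..N. K j + 2 * W) + 2 * D')"
  \<comment> \<open>The bound \<open>Z\<close> does not depend on \<open>m\<close>: the localized
    leading parts add up to at most \<open>K j\<close>, and all errors form geometric
    series.\<close>
  have "real m * norm m\<^sub>0 \<le> Z" for m
  proof -
    let ?\<Psi> = "\<lambda>h. \<Sum>i<m. \<Phi> i h"
    have "norm (?\<Psi> (\<lambda>\<zeta>. of_real (mi_power \<zeta> \<alpha>\<^sub>0))) \<le> C * ((\<Sum>j=1..N. K j + 2 * W) + 2 * D')"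
    proof (rule coercive_bound)
      show "?\<Psi> \<in> eval_span UNIV" by (intro eval_span_sum \<Phi>_span)
      fix j x assume j: "j \<in> {1..N}"
      let ?f = "\<lambda>i. \<Phi> i (\<lambda>\<zeta>. symbol l (a j) \<zeta> * cis (\<zeta> \<bullet> x))"
      let ?g = "\<lambda>i. dirichlet (S i) (\<xi>\<^sub>0 \<bullet> x) * dirichlet (S i) (\<eta> \<bullet> x) * h j i (\<xi>\<^sub>0 \<bullet> x) (\<eta> \<bullet> x)"
      have "norm (\<Sum>i<m. ?f i) \<le> norm (\<Sum>i<m. ?g i) + norm (\<Sum>i<m. ?f i - ?g i)"
        using norm_triangle_ineq[of "\<Sum>i<m. ?g i" "\<Sum>i<m. ?f i - ?g i"] by (simp add: sum_subtractf)
      also have "norm (\<Sum>i<m. ?f i - ?g i) \<le> (\<Sum>i<m. W / 2 ^ i)"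
        by (rule order_trans[OF norm_sum sum_mono]) (rule \<Phi>P[OF j])
      also have "\<dots> \<le> 2 * W" by (rule geo[OF W0])
      finally show "norm (\<Sum>i<m. ?f i) \<le> K j + 2 * W" using K[OF j, where m = m and x = x] by linarith
    next
      fix x
      have "norm (\<Sum>i<m. \<Phi> i (\<lambda>\<zeta>. cis (\<zeta> \<bullet> x))) \<le> (\<Sum>i<m. D' / 2 ^ i)"
        by (rule order_trans[OF norm_sum sum_mono]) (rule \<Phi>u)
      also have "\<dots> \<le> 2 * D'" by (rule geo[OF D'0])
      finally show "norm (\<Sum>i<m. \<Phi> i (\<lambda>\<zeta>. cis (\<zeta> \<bullet> x))) \<le> 2 * D'" .
    qed
    moreover have "norm (of_nat m * m\<^sub>0 - ?\<Psi> (\<lambda>\<zeta>. of_real (mi_power \<zeta> \<alpha>\<^sub>0))) \<le> 2 * W"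
    proof -
      have "of_nat m * m\<^sub>0 - ?\<Psi> (\<lambda>\<zeta>. of_real (mi_power \<zeta> \<alpha>\<^sub>0)) = - (\<Sum>i<m. \<Phi> i (\<lambda>\<zeta>. of_real (mi_power \<zeta> \<alpha>\<^sub>0)) - m\<^sub>0)"
        by (simp add: sum_subtractf)
      also have "norm \<dots> \<le> (\<Sum>i<m. W / 2 ^ i)"
        unfolding norm_minus_cancel by (rule order_trans[OF norm_sum sum_mono]) (rule \<Phi>m)
      also have "\<dots> \<le> 2 * W" by (rule geo[OF W0])
      finally show ?thesis .
    qed
    ultimately have "norm (of_nat m * m\<^sub>0) \<le> Z"
      using norm_triangle_sub[of "of_nat m * m\<^sub>0" "?\<Psi> (\<lambda>\<zeta>. of_real (mi_power \<zeta> \<alpha>\<^sub>0))"] unfolding Z_def by linarith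
    then show ?thesis by (simp add: norm_mult)
  qed
  moreover obtain m where "Z < real m * norm m\<^sub>0"
    using reals_Archimedean3[of "norm m\<^sub>0"] m\<^sub>0_nonzero by auto
  ultimately show False by (meson not_le)
qed

end

lemma weakly_coercive_imp_elliptic:
  fixes a :: "nat \<Rightarrow> 'n::finite multi_index \<Rightarrow> complex"
  assumes l: "2 \<le> l" and card: "2 * N + 1 \<le> CARD('n)"
    and ind: "\<And>V :: (real^'n) set. subspace V \<Longrightarrow> dim V = 2 \<Longrightarrow> lin_indep_on V N (\<lambda>j. principal_symbol l (a j))"
    and wc: "weakly_coercive_Linf l N a"
  shows "elliptic l N a"
  unfolding elliptic_def
proof (intro allI impI, rule ccontr)
  fix \<xi> :: "real^'n"
  assume \<xi>: "\<xi> \<noteq> 0" and "\<not> (\<exists>j\<in>{1..N}. principal_symbol l (a j) \<xi> \<noteq> 0)"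
  then have zero: "principal_symbol l (a j) \<xi> = 0" if "j \<in> {1..N}" for j using that by blast
  have "\<forall>j\<in>{1..N}. \<exists>vb. lin (fst vb) \<xi> = 0 \<and>
      ray_small (\<lambda>r \<zeta>. symbol l (a j) (r *\<^sub>R \<xi> + \<zeta>) / of_real r ^ (l - 1) - (lin (fst vb) \<zeta> + snd vb))"
  proof
    fix j assume j: "j \<in> {1..N}"
    show "\<exists>vb. lin (fst vb) \<xi> = 0 \<and>
        ray_small (\<lambda>r \<zeta>. symbol l (a j) (r *\<^sub>R \<xi> + \<zeta>) / of_real r ^ (l - 1) - (lin (fst vb) \<zeta> + snd vb))"
      using symbol_ray_expansion[of l \<xi> "a j"] l by (simp add: zero[OF j])
  qed
  from bchoice[OF this] obtain vb where vb: "\<forall>j\<in>{1..N}. lin (fst (vb j)) \<xi> = 0 \<and>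
      ray_small (\<lambda>r \<zeta>. symbol l (a j) (r *\<^sub>R \<xi> + \<zeta>) / of_real r ^ (l - 1) - (lin (fst (vb j)) \<zeta> + snd (vb j)))"
    by (elim exE)
  obtain C where C: "coercivity_bound l N a C" using weakly_coercive_imp_coercivity_bound[OF wc] by (elim exE)
  obtain k where k: "\<xi> $ k \<noteq> 0" using \<xi> by (auto simp: vec_eq_iff)
  define v where "v j = fst (vb j)" for j
  define b where "b j = snd (vb j)" for j
  interpret degenerate_direction l N a C \<xi> k v b
    using l C k vb by unfold_locales (simp_all add: v_def b_def)
  have "\<not> (\<exists>\<eta>. \<forall>j\<in>{1..N}. lin (v j) \<eta> + b j = 0)" using no_affine_zero by simp
  then obtain \<eta> where \<eta>: "\<eta> \<noteq> 0" "\<xi> \<bullet> \<eta> = 0" "\<forall>j\<in>{1..N}. lin (v j) \<eta> = 0"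
    using complex_affine_alternative[OF card, of v b \<xi>] by auto
  have "\<xi> \<noteq> \<eta>" using \<xi> \<eta> by auto
  \<comment> \<open>Orthogonality ensures that the two vectors span a genuine plane, to which the
    independence hypothesis applies.\<close>
  have "\<xi> \<notin> span {\<eta>}" using \<xi> \<eta> by (auto simp: span_singleton)
  then have "independent {\<xi>, \<eta>}" using \<eta>(1) by (intro independent_insertI independent_empty) auto
  from dim_span_eq_card_independent[OF this] have "dim (span {\<xi>, \<eta>}) = 2" using \<open>\<xi> \<noteq> \<eta>\<close> by simp
  then have "lin_indep_on (span {\<xi>, \<eta>}) N (\<lambda>j. principal_symbol l (a j))" by (intro ind) auto
  then show False using no_planar_degeneracy[of \<eta>] \<eta>(3) by blast
qed

theorem theorem4p9:
  fixes l N :: nat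
    and a :: "nat \<Rightarrow> 'n::finite multi_index \<Rightarrow> complex"
  assumes "l \<ge> 2" and "N \<ge> 1"
    and "CARD('n) \<ge> 2 * N + 1"
    and "\<And>V :: (real^'n) set. subspace V \<Longrightarrow> dim V = 2 \<Longrightarrow>
           lin_indep_on V N (\<lambda>j. principal_symbol l (a j))"
  shows "weakly_coercive_Linf l N a \<longleftrightarrow> elliptic l N a"
  using assms elliptic_imp_weakly_coercive[of l N a] weakly_coercive_imp_elliptic[of l N a] by auto

end
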